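(* Let $q$ be a probability mass function on $\mathbb{Z}$ satisfying the standing assumptions below, and let $S=(S_n)_{n\ge 0}$ be the random walk with $S_0=0$ and i.i.d. increments of law $q$. Let $\theta:\mathbb{Z}\to[0,1]$ be such that $\{z:\theta(z)\neq 0\}$ is finite. Let $X=(X_n)_{n\ge0}$ be the sequence of coin tosses generated by the walk: conditionally on $S$, the $X_n$ are independent $\{-1,1\}$-valued with $E[X_n\mid S]=\theta(S_n)$. Then there exist functions $\theta_n:\{-1,1\}^n\to\mathbb{R}^{\mathbb{Z}}$, not depending on $\theta$, such that almost surely there is a map $T:\mathbb{Z}\to\mathbb{Z}$ of the form $T(z)=z+c$ or $T(z)=-z+c$ for some $c\in\mathbb{Z}$ ($T$ may depend on $\theta$) with $$\lim_{n\to\infty}\theta_n(X_1,\dots,X_n)(z)=\theta(T(z))\quad\text{for all } z\in\mathbb{Z}.$$ That is, the biases can be recovered up to a shift and reflection of $\mathbb{Z}$ from the coin tosses alone, without observing the path $S$.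
   Context: A coin toss with bias $\theta$ is a $\{-1,1\}$-valued random variable with expectation $\theta$. Standing assumptions on $q$: $\sum_z z\,q(z)=0$; $\sum_z z^2q(z)<\infty$; $q(z)=q(-z)$ for all $z$; $\gcd\{n\ge1: q^{*n}(0)>0\}=1$, where $q^{*n}$ is the $n$-fold convolution of $q$; and the additive subgroup generated by the support of $q$ is $\mathbb{Z}$. *)

theory Defs
  imports "HOL-Probability.Probability"
begin

primrec conv_pow :: "int pmf \<Rightarrow> nat \<Rightarrow> int pmf" where
  "conv_pow q 0 = return_pmf 0"
| "conv_pow q (Suc n) = bind_pmf (conv_pow q n) (\<lambda>x. map_pmf (\<lambda>y. x + y) q)"

definition int_subgroup_generated :: "int set \<Rightarrow> int set" where
  "int_subgroup_generated A =
     \<Inter>{H. 0 \<in> H \<and> (\<forall>x\<in>H. \<forall>y\<in>H. x + y \<in> H) \<and> (\<forall>x\<in>H. - x \<in> H) \<and> A \<subseteq> H}"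

definition standing_assms :: "int pmf \<Rightarrow> bool" where
  "standing_assms q \<longleftrightarrow>
     (\<lambda>z. real_of_int z ^ 2 * pmf q z) summable_on UNIV
   \<and> (\<Sum>\<^sub>\<infinity>z. real_of_int z * pmf q z) = 0
   \<and> (\<forall>z. pmf q z = pmf q (- z))
   \<and> Gcd {n::nat. n \<ge> 1 \<and> pmf (conv_pow q n) 0 > 0} = 1
   \<and> int_subgroup_generated (set_pmf q) = UNIV"

text \<open>Canonical probability space: omega i = (xi_(i+1), U_i) with xi i.i.d. of law q
  and U i.i.d. uniform on [0,1], all independent.\<close>
definition walk_space :: "int pmf \<Rightarrow> (nat \<Rightarrow> int \<times> real) measure" where
  "walk_space q = PiM UNIV (\<lambda>_. measure_pmf q \<Otimes>\<^sub>M uniform_measure lborel {0..1::real})"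

definition walk :: "(nat \<Rightarrow> int \<times> real) \<Rightarrow> nat \<Rightarrow> int" where
  "walk \<omega> n = (\<Sum>i<n. fst (\<omega> i))"

text \<open>Coin toss X_n: given the walk, independent, {-1,1}-valued with P(X_n = 1) = (1 + theta(S_n))/2,
  i.e. E[X_n | S] = theta(S_n).\<close>
definition coin :: "(int \<Rightarrow> real) \<Rightarrow> (nat \<Rightarrow> int \<times> real) \<Rightarrow> nat \<Rightarrow> int" where
  "coin \<theta> \<omega> n = (if snd (\<omega> n) \<le> (1 + \<theta> (walk \<omega> n)) / 2 then 1 else -1)"

end

theory Submission
  imports Defs
begin

text \<open>
  For a gap triple \<open>(g\<^sub>1, g\<^sub>2, g\<^sub>3)\<close> consider the sum over \<open>m \<le> n\<close> of the products of the four tosses at times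
  \<open>m\<close>, \<open>m + g\<^sub>1\<close>, \<open>m + g\<^sub>1 + g\<^sub>2\<close>, \<open>m + g\<^sub>1 + g\<^sub>2 + g\<^sub>3\<close>, divided by the Green function \<open>a\<^sub>n\<close>, the sum of \<open>P(S\<^sub>m = 0)\<close>
  over \<open>m \<le> n\<close>.  Since \<open>a\<^sub>n\<close> is at least of order \<open>\<surd>n\<close> (finite variance), the noise of the tosses does not dominate and these
  statistics are bounded in \<open>L\<^sup>2\<close>; their means converge to a moment of \<open>\<theta>\<close>.  They do not concentrate
  themselves, but along rapidly growing times they are almost uncorrelated, so averages of them converge in \<open>L\<^sup>2\<close>,
  uniformly over biases supported in a fixed window, and almost surely along a fast subsequence.

  The moments pair the four-point correlations of \<open>\<theta>\<close> with the transition probabilities \<open>p\<^sub>g\<close>.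
  The characteristic function of \<open>q\<close> has modulus one only at \<open>0\<close>, so as \<open>g\<close> grows the pairing with a finitely
  supported function detects its (analytic) Fourier transform near \<open>0\<close>, hence its even part.  So the correlations
  symmetrized over the signs of the increments are known.  If the extreme points \<open>a < b\<close> of the support of \<open>\<theta>\<close> are at
  distance \<open>D\<close>, taking \<open>\<plusminus>D\<close> as middle increment forces the path across the support, and with
  \<open>U x = \<theta> (a + x)\<close> one reads off \<open>U x * U (D - y) + U (D - x) * U y\<close>.  Splitting \<open>U\<close> into its even and odd
  parts under \<open>x \<mapsto> D - x\<close> shows that this determines \<open>U\<close> up to that reflection.

  Finally, bias functions on the shortest possible interval that fit the estimated moments form a compact family whose
  limit points are the finitely many true solutions.
\<close>

section \<open>Fourier representation of the transition probabilities\<close>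

text \<open>Two tosses would only give the autocorrelation of \<theta>, which in general does not
  determine \<theta> up to shift and reflection. Moreover the sign of every increment is lost
  separately, since the transition probabilities are even. Four tosses cure both: a middle increment
  equal to plus or minus the width pins the walk to the two end sites, an outer increment of the
  wrong sign leaves the support, and the two outer increments probe the profile independently, which
  produces rank-one products. Those leave only signs open; nonnegativity of the biases fixes all but
  the one that is the reflection.

  The estimator must not know \<theta>, so every limit is uniform over \<open>bias_on N\<close>; the
  window N is unknown too, so stage k works with window k and is trusted only from some stage on.
  Late statistics forget early ones because, wherever an early pattern leaves the walk, the expected
  sum of later patterns is the same to leading order in \<open>gnorm n\<close>. The bound of n by a
  multiple of \<open>(gnorm n)\<^sup>2\<close> pays for the order n pairs of overlapping patterns in
  the second moment.\<close>

lemma pmf_expectation_bind_bounded: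
  fixes f :: "'a \<Rightarrow> real"
  assumes "\<And>x. \<bar>f x\<bar> \<le> B"
  shows "measure_pmf.expectation (bind_pmf M N) f
    = measure_pmf.expectation M (\<lambda>x. measure_pmf.expectation (N x) f)"
  unfolding measure_pmf_bind
  by (rule integral_bind[where K = "count_space UNIV" and B = B and B' = 1])
     (use assms in \<open>auto simp: measure_pmf_in_subprob_algebra measure_pmf.finite_measure_axioms\<close>)

lemma pmf_integrable_bounded:
  fixes f :: "'a \<Rightarrow> real"
  assumes "\<And>x. \<bar>f x\<bar> \<le> B"
  shows "integrable (measure_pmf M) f"
  by (rule measure_pmf.integrable_const_bound[where B = B]) (use assms in auto)

text \<open>Normalised to mass one, so that bounded measurable functions are integrable and Fourier
  coefficients need no extra factor.\<close>

definition circ :: "real measure" where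
  "circ = uniform_measure lborel {-pi..pi}"

lemma prob_space_circ: "prob_space circ"
  unfolding circ_def by (rule prob_space_uniform_measure) auto

interpretation circ: prob_space circ
  by (rule prob_space_circ)

lemma sets_circ [simp, measurable_cong]: "sets circ = sets borel"
  by (simp add: circ_def)

lemma space_circ [simp]: "space circ = UNIV"
  by (simp add: circ_def)

lemma AE_circ: "AE t in circ. t \<in> {-pi..pi}"
  unfolding circ_def by (rule AE_uniform_measureI) auto

lemma circ_integral:
  fixes f :: "real \<Rightarrow> real"
  assumes [measurable]: "f \<in> borel_measurable borel"
  shows "integral\<^sup>L circ f = (1 / (2 * pi)) * integral\<^sup>L lborel (\<lambda>t. indicator {-pi..pi} t *\<^sub>R f t)"
proof -
  have "circ = density lborel (\<lambda>t. ennreal (indicator {-pi..pi} t / (2 * pi)))"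
    unfolding circ_def uniform_measure_def
    by (rule density_cong) (auto split: split_indicator simp: divide_ennreal ennreal_1[symmetric] simp del: ennreal_1)
  moreover have "integral\<^sup>L (density lborel (\<lambda>t. ennreal (indicator {-pi..pi} t / (2 * pi)))) f
      = integral\<^sup>L lborel (\<lambda>t. (indicator {-pi..pi} t / (2 * pi)) *\<^sub>R f t)"
    by (rule integral_density) auto
  ultimately have "integral\<^sup>L circ f = integral\<^sup>L lborel (\<lambda>t. (indicator {-pi..pi} t / (2 * pi)) *\<^sub>R f t)"
    by (simp only:)
  also have "\<dots> = integral\<^sup>L lborel (\<lambda>t. (1 / (2 * pi)) * (indicator {-pi..pi} t *\<^sub>R f t))"
    by (intro Bochner_Integration.integral_cong) auto
  also have "\<dots> = (1 / (2 * pi)) * integral\<^sup>L lborel (\<lambda>t. indicator {-pi..pi} t *\<^sub>R f t)"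
    by (rule integral_mult_right_zero)
  finally show ?thesis .
qed

lemma circ_integral_cos_int: "integral\<^sup>L circ (\<lambda>t. cos (t * of_int k)) = of_bool (k = 0)"
proof (cases "k = 0")
  case True
  then show ?thesis by (simp add: circ.prob_space[simplified])
next
  case False
  have "integral\<^sup>L lborel (\<lambda>t. indicator {-pi..pi} t *\<^sub>R cos (t * of_int k))
      = sin (pi * of_int k) / of_int k - sin (- pi * of_int k) / of_int k"
    by (rule integral_FTC_atLeastAtMost)
       (use False in \<open>auto intro!: derivative_eq_intros continuous_intros
          simp: has_real_derivative_iff_has_vector_derivative[symmetric]\<close>)
  also have "sin (pi * of_int k) = 0"
    by (metis mult.commute sin_zero_iff_int2)
  finally show ?thesis using False by (simp add: circ_integral)
qed

lemma circ_integrable: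
  fixes f :: "real \<Rightarrow> real"
  assumes "f \<in> borel_measurable borel" "\<And>t. \<bar>f t\<bar> \<le> B"
  shows "integrable circ f"
  by (rule circ.integrable_const_bound[where B = B]) (use assms in auto)

lemma circ_measure_Icc:
  assumes "-pi \<le> a" "a \<le> b" "b \<le> pi"
  shows "measure circ {a..b} = (b - a) / (2 * pi)"
proof -
  have "{-pi..pi} \<inter> {a..b} = {a..b}" using assms by auto
  then show ?thesis
    using assms unfolding circ_def
    by (subst measure_uniform_measure) auto
qed

locale symm_walk =
  fixes q :: "int pmf"
  assumes standing: "standing_assms q"
begin

abbreviation p :: "nat \<Rightarrow> int \<Rightarrow> real" where
  "p n z \<equiv> pmf (conv_pow q n) z"

text \<open>The characteristic function of \<open>q\<close>; symmetry of \<open>q\<close> kills its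
  imaginary part, so the cosine suffices.\<close>

definition phi :: "real \<Rightarrow> real" where
  "phi t = measure_pmf.expectation q (\<lambda>z. cos (t * of_int z))"

lemma map_uminus_q: "map_pmf uminus q = q"
proof (rule pmf_eqI)
  fix z
  have "pmf (map_pmf uminus q) (- (- z)) = pmf q (- z)"
    by (rule pmf_map_inj') auto
  then show "pmf (map_pmf uminus q) z = pmf q z"
    using standing by (simp add: standing_assms_def)
qed

lemma expectation_sin: "measure_pmf.expectation q (\<lambda>z. sin (t * real_of_int z)) = 0"
proof -
  have "measure_pmf.expectation q (\<lambda>z. sin (t * real_of_int z))
      = measure_pmf.expectation (map_pmf uminus q) (\<lambda>z. sin (t * of_int z))"
    by (simp only: map_uminus_q)
  also have "\<dots> = - measure_pmf.expectation q (\<lambda>z. sin (t * real_of_int z))"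
    by simp
  finally show ?thesis by simp
qed

lemma expectation_cos_conv_pow:
  "measure_pmf.expectation (conv_pow q n) (\<lambda>z. cos (t * of_int z)) = phi t ^ n
   \<and> measure_pmf.expectation (conv_pow q n) (\<lambda>z. sin (t * of_int z)) = 0"
proof (induction n)
  case 0
  then show ?case by simp
next
  case (Suc n)
  note int = pmf_integrable_bounded[where B = 1]
  have c: "measure_pmf.expectation q (\<lambda>y. cos (t * of_int (x + y))) = cos (t * of_int x) * phi t" for x
    by (simp add: ring_distribs cos_add Bochner_Integration.integral_diff int expectation_sin phi_def)
  have s: "measure_pmf.expectation q (\<lambda>y. sin (t * of_int (x + y))) = sin (t * of_int x) * phi t" for x
    by (simp add: ring_distribs sin_add Bochner_Integration.integral_add int expectation_sin phi_def)
  show ?case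
    using Suc by (simp add: pmf_expectation_bind_bounded[where B = 1] c[simplified] s[simplified])
qed

lemma phi_abs_le: "\<bar>phi t\<bar> \<le> 1"
proof -
  have "\<bar>phi t\<bar> \<le> measure_pmf.expectation q (\<lambda>z. \<bar>cos (t * of_int z)\<bar>)"
    unfolding phi_def by (rule integral_abs_bound)
  also have "\<dots> \<le> measure_pmf.expectation q (\<lambda>z. 1)"
    by (intro integral_mono pmf_integrable_bounded[where B = 1]) auto
  finally show ?thesis by simp
qed

lemma isCont_phi: "isCont phi t"
  unfolding continuous_at_sequentially comp_def phi_def
proof (intro allI impI)
  fix x :: "nat \<Rightarrow> real" assume x: "x \<longlonglongrightarrow> t"
  show "(\<lambda>n. measure_pmf.expectation q (\<lambda>z. cos (x n * of_int z)))
      \<longlonglongrightarrow> measure_pmf.expectation q (\<lambda>z. cos (t * of_int z))"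
    by (rule integral_dominated_convergence[where w = "\<lambda>_. 1"])
       (auto intro!: tendsto_intros x)
qed

lemma phi_measurable [measurable]: "phi \<in> borel_measurable borel"
  by (intro borel_measurable_continuous_onI) (auto simp: continuous_on_eq_continuous_at isCont_phi)

lemma phi_minus: "phi (- t) = phi t"
  by (simp add: phi_def)

lemma p_uminus: "p n (- z) = p n z"
proof (induction n arbitrary: z)
  case 0
  then show ?case by (simp add: indicator_def)
next
  case (Suc n)
  have "conv_pow q (Suc n) = map_pmf uminus (conv_pow q (Suc n))"
  proof -
    have m: "map_pmf uminus (conv_pow q n) = conv_pow q n"
    proof (rule pmf_eqI)
      fix z
      have "pmf (map_pmf uminus (conv_pow q n)) (- (- z)) = p n (- z)"
        by (rule pmf_map_inj') auto
      then show "pmf (map_pmf uminus (conv_pow q n)) z = p n z"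
        using Suc.IH by simp
    qed
    have "map_pmf uminus (conv_pow q (Suc n))
        = bind_pmf (map_pmf uminus (conv_pow q n)) (\<lambda>x. map_pmf ((+) x) (map_pmf uminus q))"
      by (simp add: map_bind_pmf bind_map_pmf map_pmf_comp)
    then show ?thesis by (simp add: m map_uminus_q)
  qed
  moreover have "pmf (map_pmf uminus (conv_pow q (Suc n))) (- z) = p (Suc n) z"
    by (rule pmf_map_inj') auto
  ultimately show ?case by metis
qed

text \<open>Fourier inversion: \<open>phi t ^ n\<close> is itself an expectation of cosines, and
  after Fubini the orthogonality of the cosines leaves the average of the masses at \<open>d\<close>
  and \<open>- d\<close>, which agree.\<close>

lemma p_fourier: "p n d = integral\<^sup>L circ (\<lambda>t. phi t ^ n * cos (t * of_int d))"
proof -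
  interpret pair_sigma_finite "measure_pmf (conv_pow q n)" circ ..
  have meas: "(\<lambda>(z, t). cos (t * real_of_int z) * cos (t * real_of_int d))
      \<in> borel_measurable (measure_pmf (conv_pow q n) \<Otimes>\<^sub>M circ)"
    by measurable
  have "integral\<^sup>L circ (\<lambda>t. phi t ^ n * cos (t * of_int d))
     = integral\<^sup>L circ (\<lambda>t. measure_pmf.expectation (conv_pow q n)
          (\<lambda>z. cos (t * of_int z) * cos (t * of_int d)))"
    using expectation_cos_conv_pow by simp
  also have "\<dots> = measure_pmf.expectation (conv_pow q n)
      (\<lambda>z. integral\<^sup>L circ (\<lambda>t. cos (t * of_int z) * cos (t * of_int d)))"
  proof (rule Fubini_integral)
    interpret P: prob_space "measure_pmf (conv_pow q n) \<Otimes>\<^sub>M circ"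
      by (intro prob_space_pair measure_pmf.prob_space_axioms prob_space_circ)
    have "\<bar>cos x * cos y\<bar> \<le> 1" for x y :: real
      by (auto simp: abs_mult intro!: mult_le_one)
    then show "integrable (measure_pmf (conv_pow q n) \<Otimes>\<^sub>M circ)
        (\<lambda>(z, t). cos (t * real_of_int z) * cos (t * real_of_int d))"
      by (intro P.integrable_const_bound[where B = 1] AE_I2) (use meas in auto)
  qed
  also have "(\<lambda>z. integral\<^sup>L circ (\<lambda>t. cos (t * of_int z) * cos (t * of_int d)))
      = (\<lambda>z. (of_bool (z = d) + of_bool (z = - d)) / 2)"
  proof
    fix z
    have eq: "cos (t * of_int z) * cos (t * of_int d)
        = (cos (t * of_int (z - d)) + cos (t * of_int (z + d))) / 2" for t :: real
      by (simp add: cos_times_cos ring_distribs)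
    have "integral\<^sup>L circ (\<lambda>t. cos (t * of_int z) * cos (t * of_int d))
        = (integral\<^sup>L circ (\<lambda>t. cos (t * of_int (z - d))) + integral\<^sup>L circ (\<lambda>t. cos (t * of_int (z + d)))) / 2"
      unfolding eq
      by (subst Bochner_Integration.integral_add[symmetric])
         (auto intro!: circ_integrable[where B = 1])
    then show "integral\<^sup>L circ (\<lambda>t. cos (t * of_int z) * cos (t * of_int d))
        = (of_bool (z = d) + of_bool (z = - d)) / 2"
      unfolding circ_integral_cos_int by (auto simp: eq_neg_iff_add_eq_0)
  qed
  also have "measure_pmf.expectation (conv_pow q n) (\<lambda>z. (of_bool (z = d) + of_bool (z = - d)) / 2 :: real)
      = (p n d + p n (- d)) / 2"
  proof -
    have 1: "measure_pmf.expectation (conv_pow q n) (\<lambda>z. of_bool (z = y)) = p n y" for y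
      by (subst integral_measure_pmf_real[where A = "{y}"]) auto
    show ?thesis
      by (simp add: Bochner_Integration.integral_add pmf_integrable_bounded[where B = 1] 1)
  qed
  finally show ?thesis by (simp add: p_uminus)
qed

end

text \<open>Up to a unimodular factor an even real trigonometric sum is a nonzero polynomial in
  \<open>cis t\<close>, so it has finitely many zeros on the circle. It may still vanish at 0, but a
  punctured neighbourhood is free of zeros, and evenness carries the sign from the right to the
  left.\<close>

lemma trig_sum_sign_near_0:
  fixes h :: "int \<Rightarrow> real" and L :: nat
  assumes even: "\<And>d. h (- d) = h d" and nz: "h d0 \<noteq> 0"
    and supp: "\<And>d. h d \<noteq> 0 \<Longrightarrow> d \<in> {-int L..int L}"
  defines "f \<equiv> \<lambda>t. \<Sum>d\<in>{-int L..int L}. h d * cos (t * of_int d)"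
  obtains \<sigma> \<delta> :: real where "\<sigma> = 1 \<or> \<sigma> = -1" "0 < \<delta>" "\<delta> < pi" "\<And>t. 0 < \<bar>t\<bar> \<Longrightarrow> \<bar>t\<bar> \<le> \<delta> \<Longrightarrow> 0 < \<sigma> * f t"
proof -
  \<comment> \<open>Multiplication by \<open>cis (t * L)\<close> shifts the exponents from -L..L to
    0..2L and turns the sum into a polynomial.\<close>
  define P :: "complex poly" where "P = (\<Sum>i\<le>2 * L. monom (of_real (h (int i - int L))) i)"
  have coeffP: "poly.coeff P i = (if i \<le> 2 * L then of_real (h (int i - int L)) else 0)" for i
    unfolding P_def coeff_sum coeff_monom by (simp add: sum.delta)
  have "P \<noteq> 0"
  proof
    assume "P = 0"
    then have "poly.coeff P (nat (d0 + int L)) = 0" by simp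
    then show False using supp[OF nz] nz by (auto simp: coeffP split: if_splits)
  qed
  have reindex: "(\<Sum>i\<le>2 * L. F (int i - int L)) = (\<Sum>d\<in>{-int L..int L}. F d)" for F :: "int \<Rightarrow> complex"
    by (rule sum.reindex_bij_witness[where i = "\<lambda>d. nat (d + int L)" and j = "\<lambda>i. int i - int L"]) auto
  have cis_sum: "(\<Sum>d\<in>{-int L..int L}. of_real (h d) * cis (t * of_int d)) = complex_of_real (f t)" for t
  proof -
    have "(\<Sum>d\<in>{-int L..int L}. h d * sin (t * of_int d)) = (\<Sum>d\<in>{-int L..int L}. h (- d) * sin (t * of_int (- d)))"
      by (rule sum.reindex_bij_witness[where i = uminus and j = uminus]) auto
    then have "(\<Sum>d\<in>{-int L..int L}. h d * sin (t * of_int d)) = 0"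
      by (simp add: even sum_negf)
    then show ?thesis by (simp add: complex_eq_iff f_def cis.sel)
  qed
  have polyP: "poly P (cis t) = cis (t * of_nat L) * of_real (f t)" for t
  proof -
    have "poly P (cis t) = (\<Sum>i\<le>2 * L. of_real (h (int i - int L)) * cis (t * of_nat i))"
      by (simp add: P_def poly_sum poly_monom Complex.DeMoivre mult_ac)
    also have "\<dots> = (\<Sum>i\<le>2 * L. cis (t * of_nat L) * (of_real (h (int i - int L)) * cis (t * of_int (int i - int L))))"
      by (intro sum.cong refl) (simp add: mult.left_commute cis_mult ring_distribs)
    also have "\<dots> = cis (t * of_nat L) * (\<Sum>d\<in>{-int L..int L}. of_real (h d) * cis (t * of_int d))"
      by (simp only: sum_distrib_left[symmetric] reindex[of "\<lambda>d. of_real (h d) * cis (t * of_int d)"])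
    finally show ?thesis by (simp only: cis_sum)
  qed
  define Z where "Z = {t \<in> {0<..pi}. f t = 0}"
  have "inj_on cis Z"
    by (rule inj_onI) (auto simp: Z_def complex_eq_iff cis.sel intro!: cos_inj_pi)
  moreover have "cis ` Z \<subseteq> {z. poly P z = 0}"
    by (auto simp: Z_def polyP)
  ultimately have finZ: "finite Z"
    using poly_roots_finite[OF \<open>P \<noteq> 0\<close>] by (meson finite_imageD finite_subset)
  \<comment> \<open>Inserting pi keeps the minimum defined when there are no zeros; halving puts
    \<delta> strictly below the smallest zero and below pi.\<close>
  define \<delta> where "\<delta> = Min (insert pi Z) / 2"
  have "Min (insert pi Z) \<in> insert pi Z" using finZ by (intro Min_in) auto
  then have \<delta>: "0 < \<delta>" "\<delta> < pi"
    using pi_gt_zero by (auto simp: \<delta>_def Z_def)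
  have nzero: "f t \<noteq> 0" if "0 < t" "t \<le> \<delta>" for t
  proof
    assume "f t = 0"
    then have "t \<in> Z" using that \<delta> by (auto simp: Z_def)
    then have "Min (insert pi Z) \<le> t" using finZ by auto
    then show False using that \<delta> by (simp add: \<delta>_def)
  qed
  have cont: "continuous_on A f" for A
    unfolding f_def by (intro continuous_intros)
  define \<sigma> where "\<sigma> = sgn (f \<delta>)"
  have \<sigma>: "\<sigma> = 1 \<or> \<sigma> = -1" using nzero[of \<delta>] \<delta> by (auto simp: \<sigma>_def sgn_if)
  have pos: "0 < \<sigma> * f t" if t: "0 < t" "t \<le> \<delta>" for t
  proof (rule ccontr)
    assume "\<not> 0 < \<sigma> * f t"
    then have le: "\<sigma> * f t \<le> 0" by simp
    have ge: "0 \<le> \<sigma> * f \<delta>" by (simp add: \<sigma>_def sgn_if)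
    have "continuous_on {t..\<delta>} (\<lambda>x. \<sigma> * f x)"
      by (intro continuous_intros cont)
    from IVT'[of "\<lambda>x. \<sigma> * f x", OF le ge t(2) this]
    obtain x where "t \<le> x" "x \<le> \<delta>" "\<sigma> * f x = 0" by blast
    then show False using nzero[of x] t \<sigma> by auto
  qed
  have fe: "f (- t) = f t" for t by (simp add: f_def)
  show thesis
  proof (rule that[of \<sigma> \<delta>])
    fix t :: real assume "0 < \<bar>t\<bar>" "\<bar>t\<bar> \<le> \<delta>"
    then have "0 < \<sigma> * f \<bar>t\<bar>" by (rule pos)
    then show "0 < \<sigma> * f t" by (simp add: abs_if fe split: if_splits)
  qed (use \<delta> \<sigma> in auto)
qed

section \<open>The characteristic function away from 0, and injectivity of the pairing on even
  functions\<close>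

context symm_walk
begin

lemma phi_0 [simp]: "phi 0 = 1"
  by (simp add: phi_def)

text \<open>Modulus one forces \<open>cos (t * z)\<close> to be constantly \<open>e\<close> on the
  support. For \<open>e = 1\<close> the integers with cosine one form a subgroup containing the
  support, hence containing 1, so \<open>t\<close> would be 0. For \<open>e = -1\<close> the
  position reveals the parity of the number of steps, so returns to 0 would need even times, against
  the gcd condition.\<close>

lemma phi_lt_1:
  assumes t: "0 < \<bar>t\<bar>" "\<bar>t\<bar> \<le> pi"
  shows "\<bar>phi t\<bar> < 1"
proof (rule ccontr)
  assume "\<not> \<bar>phi t\<bar> < 1"
  then obtain e :: real where e: "e = 1 \<or> e = -1" "phi t = e"
    using phi_abs_le[of t] by (metis abs_le_iff abs_minus_commute abs_of_nonneg leI linorder_not_less minus_equation_iff not_less order_antisym abs_if)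
  have int: "integrable (measure_pmf q) (\<lambda>z. 1 - e * cos (t * real_of_int z))"
  proof (rule pmf_integrable_bounded[where B = 2])
    fix z :: int
    have "- 1 \<le> cos (t * real_of_int z)" "cos (t * real_of_int z) \<le> 1" by simp_all
    with e(1) show "\<bar>1 - e * cos (t * real_of_int z)\<bar> \<le> 2" by (elim disjE) (simp_all only: abs_le_iff, linarith+)
  qed
  have "measure_pmf.expectation q (\<lambda>z. 1 - e * cos (t * real_of_int z)) = 1 - e * phi t"
    unfolding phi_def
    by (subst Bochner_Integration.integral_diff)
       (use e(1) in \<open>auto intro!: pmf_integrable_bounded[where B = 1] simp: abs_mult\<close>)
  also have "\<dots> = 0" using e by auto
  finally have "AE z in measure_pmf q. 1 - e * cos (t * real_of_int z) = 0"
    by (subst integral_nonneg_eq_0_iff_AE[OF int, symmetric]) (use e in auto)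
  then have cosq: "cos (t * real_of_int z) = e" if "z \<in> set_pmf q" for z
    using that e by (auto simp: AE_measure_pmf_iff)
  have sin0: "sin x = 0" if "cos x = 1 \<or> cos x = -1" for x :: real
    using that sin_squared_eq[of x] by auto
  from e(1) show False
  proof
    assume e1: "e = 1"
    define H where "H = {z::int. cos (t * of_int z) = 1}"
    have "int_subgroup_generated (set_pmf q) \<subseteq> H"
      unfolding int_subgroup_generated_def
      by (intro Inter_lower) (auto simp: H_def ring_distribs cos_add sin0 cosq e1)
    then have "1 \<in> H" using standing by (auto simp: standing_assms_def)
    then have "cos \<bar>t\<bar> = cos 0" by (simp add: H_def)
    then have "\<bar>t\<bar> = 0" using t by (intro cos_inj_pi[OF _ _ _ _ \<open>cos \<bar>t\<bar> = cos 0\<close>]) auto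
    with t show False by simp
  next
    assume e1: "e = -1"
    have *: "\<forall>z\<in>set_pmf (conv_pow q n). cos (t * of_int z) = (-1) ^ n" for n
    proof (induction n)
      case (Suc n)
      have "cos (t * real_of_int x) = 1 \<or> cos (t * real_of_int x) = - 1" if "x \<in> set_pmf (conv_pow q n)" for x
        using Suc that by (cases "even n") auto
      then show ?case
        using Suc by (auto simp: ring_distribs cos_add sin0 cosq e1)
    qed auto
    have "2 dvd n" if "0 < p n 0" for n
    proof -
      have "0 \<in> set_pmf (conv_pow q n)" using that by (simp add: set_pmf_iff)
      then have "(-1 :: real) ^ n = 1" using * by fastforce
      then show ?thesis by (auto simp: minus_one_power_iff split: if_splits)
    qed
    then have "2 dvd Gcd {n::nat. n \<ge> 1 \<and> p n 0 > 0}"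
      by (intro Gcd_greatest) auto
    then show False using standing by (simp add: standing_assms_def)
  qed
qed

lemma phi_bound_away:
  assumes "0 < \<delta>"
  obtains \<rho> where "0 \<le> \<rho>" "\<rho> < 1" "\<And>t. \<delta> \<le> \<bar>t\<bar> \<Longrightarrow> \<bar>t\<bar> \<le> pi \<Longrightarrow> \<bar>phi t\<bar> \<le> \<rho>"
proof (cases "\<delta> \<le> pi")
  case True
  have "continuous_on {\<delta>..pi} (\<lambda>t. \<bar>phi t\<bar>)"
    by (intro continuous_intros) (auto simp: continuous_on_eq_continuous_at isCont_phi intro: continuous_at_imp_continuous_on)
  then obtain x where x: "x \<in> {\<delta>..pi}" "\<And>t. t \<in> {\<delta>..pi} \<Longrightarrow> \<bar>phi t\<bar> \<le> \<bar>phi x\<bar>"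
    using continuous_attains_sup[of "{\<delta>..pi}" "\<lambda>t. \<bar>phi t\<bar>"] True by auto
  have "\<bar>phi t\<bar> \<le> \<bar>phi x\<bar>" if "\<delta> \<le> \<bar>t\<bar>" "\<bar>t\<bar> \<le> pi" for t
    using x(2)[of "\<bar>t\<bar>"] that by (auto simp: abs_if phi_minus split: if_splits)
  moreover have "\<bar>phi x\<bar> < 1" using x(1) assms by (intro phi_lt_1) auto
  ultimately show ?thesis by (intro that[of "\<bar>phi x\<bar>"]) auto
next
  case False
  then show ?thesis by (intro that[of 0]) auto
qed

text \<open>If the even part is not zero, its Fourier transform \<open>f\<close> has constant sign
  near 0. Under integration against high even powers of \<open>phi\<close> the neighbourhood of 0
  dominates, so the integrals cannot all vanish. Only the even part is visible because
  \<open>p g\<close> is even.\<close>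

lemma fourier_pairing_determines:
  fixes h :: "int \<Rightarrow> real" and L :: nat
  assumes supp: "\<And>d. h d \<noteq> 0 \<Longrightarrow> d \<in> {-int L..int L}"
    and zero: "\<And>g. g \<ge> 1 \<Longrightarrow> (\<Sum>d\<in>{-int L..int L}. p g d * h d) = 0"
  shows "h d + h (- d) = 0"
proof (rule ccontr)
  assume nz: "h d + h (- d) \<noteq> 0"
  define k where "k = (\<lambda>d. h d + h (- d))"
  define f where "f = (\<lambda>t. \<Sum>d\<in>{-int L..int L}. k d * cos (t * of_int d))"
  have k0: "d \<in> {-int L..int L}" if "k d \<noteq> 0" for d
  proof (rule ccontr)
    assume d: "d \<notin> {-int L..int L}"
    then have "- d \<notin> {-int L..int L}" by auto
    with d have "h d = 0" "h (- d) = 0" using supp by blast+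
    with that show False by (simp add: k_def)
  qed
  obtain \<sigma> \<delta> where \<sigma>: "\<sigma> = 1 \<or> \<sigma> = -1" and \<delta>: "0 < \<delta>" "\<delta> < pi"
    and pos: "\<And>t. 0 < \<bar>t\<bar> \<Longrightarrow> \<bar>t\<bar> \<le> \<delta> \<Longrightarrow> 0 < \<sigma> * f t"
    using trig_sum_sign_near_0[of k d L] nz k0 unfolding f_def k_def by (auto simp: add.commute)
  have [measurable]: "f \<in> borel_measurable borel" unfolding f_def by measurable
  define B where "B = (\<Sum>d\<in>{-int L..int L}. \<bar>k d\<bar>)"
  have fB: "\<bar>f t\<bar> \<le> B" for t
    unfolding f_def B_def by (intro order_trans[OF sum_abs] sum_mono) (auto simp: abs_mult mult_left_le)
  have B0: "0 \<le> B" unfolding B_def by (rule sum_nonneg) auto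
  have int0: "integral\<^sup>L circ (\<lambda>t. phi t ^ g * (\<sigma> * f t)) = 0" if g: "g \<ge> 1" for g
  proof -
    have i: "integrable circ (\<lambda>t. phi t ^ g * cos (t * of_int d))" for d
      by (rule circ_integrable[where B = 1]) (auto simp: abs_mult power_abs phi_abs_le intro!: mult_le_one power_le_one)
    have "integral\<^sup>L circ (\<lambda>t. phi t ^ g * (\<sigma> * f t))
        = integral\<^sup>L circ (\<lambda>t. \<Sum>d\<in>{-int L..int L}. (\<sigma> * k d) * (phi t ^ g * cos (t * of_int d)))"
      by (intro Bochner_Integration.integral_cong refl) (simp add: f_def sum_distrib_left mult_ac)
    also have "\<dots> = (\<Sum>d\<in>{-int L..int L}. (\<sigma> * k d) * p g d)"
      by (subst Bochner_Integration.integral_sum) (auto simp: i p_fourier)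
    also have "\<dots> = \<sigma> * ((\<Sum>d\<in>{-int L..int L}. p g d * h d) + (\<Sum>d\<in>{-int L..int L}. p g d * h (- d)))"
      by (simp add: k_def sum_distrib_left sum.distrib[symmetric] algebra_simps)
    also have "(\<Sum>d\<in>{-int L..int L}. p g d * h (- d)) = (\<Sum>d\<in>{-int L..int L}. p g d * h d)"
      by (rule sum.reindex_bij_witness[where i = uminus and j = uminus]) (auto simp: p_uminus)
    finally show ?thesis using zero[OF g] by simp
  qed
  obtain \<rho> where \<rho>: "0 \<le> \<rho>" "\<rho> < 1" "\<And>t. \<delta> \<le> \<bar>t\<bar> \<Longrightarrow> \<bar>t\<bar> \<le> pi \<Longrightarrow> \<bar>phi t\<bar> \<le> \<rho>"
    using phi_bound_away[OF \<delta>(1)] by blast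
  \<comment> \<open>\<open>r\<close> lies strictly between the bound \<rho> away from 0 and
    \<open>phi 0 = 1\<close>; the ratio of \<rho> to \<open>r\<close>, being below one, decides the
    comparison at the end.\<close>
  define r where "r = (1 + \<rho>) / 2"
  have r: "\<rho> < r" "r < 1" "0 < r" using \<rho> by (auto simp: r_def)
  have "\<forall>\<^sub>F t in at 0. r < phi t"
    using isCont_phi[of 0] r by (intro order_tendstoD(1)) (auto simp: isCont_def)
  then obtain \<eta> where \<eta>: "0 < \<eta>" "\<And>t. t \<noteq> 0 \<Longrightarrow> \<bar>t\<bar> < \<eta> \<Longrightarrow> r < phi t"
    by (auto simp: eventually_at dist_real_def)
  define \<tau> where "\<tau> = min \<delta> (\<eta> / 2)"
  have \<tau>: "0 < \<tau>" "\<tau> \<le> \<delta>" "\<tau> < \<eta>" using \<delta> \<eta> by (auto simp: \<tau>_def)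
  \<comment> \<open>The interval stays off 0, where \<open>f\<close> may vanish, so
    \<open>\<sigma> * f\<close> has a positive minimum \<open>m\<close> on it.\<close>
  have "continuous_on {\<tau>/2..\<tau>} (\<lambda>t. \<sigma> * f t)"
    unfolding f_def by (intro continuous_intros)
  then obtain x where x: "x \<in> {\<tau>/2..\<tau>}" "\<And>t. t \<in> {\<tau>/2..\<tau>} \<Longrightarrow> \<sigma> * f x \<le> \<sigma> * f t"
    using continuous_attains_inf[of "{\<tau>/2..\<tau>}" "\<lambda>t. \<sigma> * f t"] \<tau> by auto
  define m where "m = \<sigma> * f x"
  have m: "0 < m" unfolding m_def using x \<tau> by (intro pos) auto
  \<comment> \<open>\<open>\<tau> / (4 * pi)\<close> is the \<open>circ\<close> measure of this
    interval of length \<open>\<tau> / 2\<close>, so \<open>c\<close> bounds the integral of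
    \<open>\<sigma> * f\<close> over it from below.\<close>
  define c where "c = m * (\<tau> / (4 * pi))"
  have c: "0 < c" using m \<tau> by (simp add: c_def)
  have key: "r ^ (2 * j) * c \<le> \<rho> ^ (2 * j) * B" if j: "j \<ge> 1" for j
  proof -
    \<comment> \<open>Even exponents make \<open>phi t ^ g\<close> nonnegative, so the other points
      with \<open>|t| \<le> \<delta>\<close> cannot cancel the gain.\<close>
    define g where "g = 2 * j"
    have ev: "0 \<le> phi t ^ g" for t by (simp add: g_def)
    have int_ind: "integral\<^sup>L circ (indicator {\<tau>/2..\<tau>} :: real \<Rightarrow> real) = \<tau> / (4 * pi)"
      using \<tau> \<delta> by (simp add: circ_measure_Icc field_simps)
    have "r ^ g * c - \<rho> ^ g * B
        = integral\<^sup>L circ (\<lambda>t. r ^ g * m * indicator {\<tau>/2..\<tau>} t - \<rho> ^ g * B)"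
    proof (subst Bochner_Integration.integral_diff)
      show "integrable circ (\<lambda>t. r ^ g * m * indicat_real {\<tau>/2..\<tau>} t)"
        by (rule circ_integrable[where B = "\<bar>r ^ g * m\<bar>"]) (auto split: split_indicator)
      show "r ^ g * c - \<rho> ^ g * B = integral\<^sup>L circ (\<lambda>t. r ^ g * m * indicat_real {\<tau>/2..\<tau>} t)
          - integral\<^sup>L circ (\<lambda>t. \<rho> ^ g * B)"
        unfolding integral_mult_right_zero int_ind by (simp add: c_def circ.prob_space[simplified])
    qed simp
    also have "\<dots> \<le> integral\<^sup>L circ (\<lambda>t. phi t ^ g * (\<sigma> * f t))"
    proof (rule integral_mono_AE)
      show "integrable circ (\<lambda>t. r ^ g * m * indicat_real {\<tau> / 2..\<tau>} t - \<rho> ^ g * B)"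
        by (rule circ_integrable[where B = "\<bar>r ^ g * m\<bar> + \<bar>\<rho> ^ g * B\<bar>"]) (auto split: split_indicator)
      show "integrable circ (\<lambda>t. phi t ^ g * (\<sigma> * f t))"
        by (rule circ_integrable[where B = B])
           (use \<sigma> fB B0 in \<open>auto simp: abs_mult power_abs phi_abs_le intro!: mult_left_le_one_le power_le_one
              order_trans[OF mult_left_le_one_le]\<close>)
      show "AE t in circ. r ^ g * m * indicat_real {\<tau> / 2..\<tau>} t - \<rho> ^ g * B \<le> phi t ^ g * (\<sigma> * f t)"
        using AE_circ
      proof eventually_elim
        fix t assume t: "t \<in> {-pi..pi}"
        consider "t \<in> {\<tau>/2..\<tau>}" | "t \<notin> {\<tau>/2..\<tau>}" "0 < \<bar>t\<bar>" "\<bar>t\<bar> \<le> \<delta>" | "t = 0" | "t \<notin> {\<tau>/2..\<tau>}" "\<delta> \<le> \<bar>t\<bar>" by force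
        then show "r ^ g * m * indicat_real {\<tau> / 2..\<tau>} t - \<rho> ^ g * B \<le> phi t ^ g * (\<sigma> * f t)"
        proof cases
          case 1
          have "r ^ g * m \<le> phi t ^ g * (\<sigma> * f t)"
            using 1 \<eta>(2)[of t] \<tau> r m x(2)[OF 1] by (intro mult_mono power_mono) (auto simp: m_def)
          moreover have "0 \<le> \<rho> ^ g * B" using \<rho> B0 by simp
          ultimately show ?thesis using 1 by simp
        next
          case 2
          have "0 \<le> \<rho> ^ g * B" using \<rho> B0 by simp
          moreover have "0 \<le> phi t ^ g * (\<sigma> * f t)" using pos[OF 2(2,3)] ev[of t] by simp
          ultimately show ?thesis using 2 by simp
        next
          case 3
          \<comment> \<open>The sign information excludes 0 itself; there it is obtained as a limit
            along points tending to 0.\<close>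
          have "0 \<le> \<sigma> * f 0"
          proof (rule tendsto_lowerbound[of "\<lambda>n. \<sigma> * f (\<delta> / real (Suc n))" _ sequentially])
            have "isCont (\<lambda>t. \<sigma> * f t) 0" unfolding f_def by (intro continuous_intros)
            moreover have "(\<lambda>n. \<delta> / real (Suc n)) \<longlonglongrightarrow> 0"
              by (rule LIMSEQ_Suc[OF lim_const_over_n])
            ultimately show "(\<lambda>n. \<sigma> * f (\<delta> / real (Suc n))) \<longlonglongrightarrow> \<sigma> * f 0"
              by (rule isCont_tendsto_compose)
            show "\<forall>\<^sub>F n in sequentially. 0 \<le> \<sigma> * f (\<delta> / real (Suc n))"
            proof (intro always_eventually allI)
              fix n
              have "\<delta> * 1 \<le> \<delta> * real (Suc n)" using \<delta> by (intro mult_left_mono) auto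
              then have "\<bar>\<delta> / real (Suc n)\<bar> \<le> \<delta>" using \<delta> by (simp add: divide_le_eq)
              moreover have "0 < \<bar>\<delta> / real (Suc n)\<bar>" using \<delta> by simp
              ultimately show "0 \<le> \<sigma> * f (\<delta> / real (Suc n))" by (intro less_imp_le[OF pos])
            qed
          qed auto
          then have "0 \<le> phi t ^ g * (\<sigma> * f t)" using 3 by simp
          moreover have "0 \<le> \<rho> ^ g * B" using \<rho> B0 by simp
          ultimately show ?thesis using 3 \<tau> by simp
        next
          case 4
          have "\<bar>phi t ^ g * (\<sigma> * f t)\<bar> \<le> \<rho> ^ g * B"
            using 4 t \<rho> \<sigma> fB B0 by (auto simp: abs_mult power_abs intro!: mult_mono power_mono)
          then show ?thesis using 4 by simp
        qed
      qed
    qed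
    finally show ?thesis using int0[of g] j by (simp add: g_def)
  qed
  have "(\<lambda>j. (\<rho>\<^sup>2 / r\<^sup>2) ^ j * B) \<longlonglongrightarrow> 0 * B"
    using \<rho> r by (intro tendsto_mult LIMSEQ_power_zero tendsto_const) (auto simp: power_strict_mono)
  then have "\<forall>\<^sub>F j in sequentially. (\<rho>\<^sup>2 / r\<^sup>2) ^ j * B < c"
    using c by (intro order_tendstoD(2)) auto
  then obtain j where j: "j \<ge> 1" "(\<rho>\<^sup>2 / r\<^sup>2) ^ j * B < c"
    by (metis (mono_tags, lifting) eventually_sequentially nat_le_linear)
  have "\<rho> ^ (2 * j) * B < r ^ (2 * j) * c"
  proof -
    have "(\<rho>\<^sup>2) ^ j / (r\<^sup>2) ^ j * B < c" using j by (simp only: power_divide)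
    moreover have "0 < (r\<^sup>2) ^ j" using r by simp
    ultimately show ?thesis unfolding power_mult
      by (simp only: times_divide_eq_left pos_divide_less_eq mult.commute[of "(r\<^sup>2) ^ j" c])
  qed
  with key[OF j(1)] show False by simp
qed

end

section \<open>Truncated Green functions\<close>

lemma sum_pairs_eq:
  fixes g :: "nat \<Rightarrow> real"
  shows "(\<Sum>m<2 * k. g (2 * (m div 2))) = 2 * (\<Sum>j<k. g (2 * j))"
proof (induction k)
  case (Suc k)
  have "(\<Sum>m<2 * Suc k. g (2 * (m div 2))) = (\<Sum>m<2 * k. g (2 * (m div 2))) + g (2 * k) + g (2 * k)"
    by simp
  then show ?case using Suc by simp
qed simp

lemma cos_ge_quadratic: "1 - y\<^sup>2 / 2 \<le> cos y" for y :: real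
proof -
  have "1 - cos y = 2 * (sin (y / 2))\<^sup>2"
    using cos_double_sin[of "y / 2"] by simp
  also have "(sin (y / 2))\<^sup>2 \<le> (y / 2)\<^sup>2"
    using abs_sin_x_le_abs_x[of "y / 2"] abs_le_square_iff by blast
  finally show ?thesis by (simp add: power_divide)
qed

context symm_walk
begin

definition green :: "nat \<Rightarrow> int \<Rightarrow> real" where
  "green n x = (\<Sum>m\<le>n. p m x)"

abbreviation gnorm :: "nat \<Rightarrow> real" where
  "gnorm n \<equiv> green n 0"

lemma green_nonneg: "0 \<le> green n x"
  unfolding green_def by (rule sum_nonneg) auto

lemma gnorm_ge_1: "1 \<le> gnorm n"
proof -
  have "p 0 0 \<le> green n 0" unfolding green_def by (rule member_le_sum) auto
  then show ?thesis by simp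
qed

lemma sum_even_times_le: "(\<Sum>j\<le>n div 2. p (2 * j) 0) \<le> gnorm n"
proof -
  have "(\<Sum>j\<le>n div 2. p (2 * j) 0) = (\<Sum>m\<in>(*) 2 ` {..n div 2}. p m 0)"
    by (subst sum.reindex) (auto intro: inj_onI)
  also have "\<dots> \<le> gnorm n"
    unfolding green_def by (rule sum_mono2) auto
  finally show ?thesis .
qed

text \<open>Rounding \<open>m\<close> down to an even number hits each even time at most twice: the
  source of the factor 2 here and in \<open>green_le\<close>.\<close>

lemma sum_rounded_times_le: "(\<Sum>m\<le>n. p (2 * (m div 2)) 0) \<le> 2 * gnorm n"
proof -
  have "(\<Sum>m\<le>n. p (2 * (m div 2)) 0) \<le> (\<Sum>m<2 * Suc (n div 2). p (2 * (m div 2)) 0)"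
    by (rule sum_mono2) auto
  also have "\<dots> = 2 * (\<Sum>j\<le>n div 2. p (2 * j) 0)"
    by (subst sum_pairs_eq) (simp add: lessThan_Suc_atMost)
  also have "\<dots> \<le> 2 * gnorm n"
    using sum_even_times_le[of n] by simp
  finally show ?thesis .
qed

lemma phi_even_power: "phi t ^ (2 * m) = \<bar>phi t\<bar> ^ (2 * m)"
  by (simp add: power_mult)

text \<open>Rounding the exponent down to an even number removes the absolute value, so that the
  bound integrates to a return probability.\<close>

lemma phi_power_abs_le: "\<bar>phi t\<bar> ^ n \<le> phi t ^ (2 * (n div 2))"
  unfolding phi_even_power by (rule power_decreasing) (auto simp: phi_abs_le)

lemma integrable_phi_power: "integrable circ (\<lambda>t. phi t ^ n)"
  by (rule circ_integrable[where B = 1]) (auto simp: power_abs phi_abs_le intro!: power_le_one)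

lemma p_0_eq: "p n 0 = integral\<^sup>L circ (\<lambda>t. phi t ^ n)"
  by (simp add: p_fourier)

lemma integrable_phi_cos: "integrable circ (\<lambda>t. phi t ^ n * cos (t * of_int x))"
  by (rule circ_integrable[where B = 1]) (auto simp: abs_mult power_abs phi_abs_le intro!: mult_le_one power_le_one)

lemma p_le_rounded: "p n x \<le> p (2 * (n div 2)) 0"
  unfolding p_0_eq p_fourier[of n x]
proof (rule integral_mono[OF integrable_phi_cos integrable_phi_power])
  fix t
  have "phi t ^ n * cos (t * real_of_int x) \<le> \<bar>phi t\<bar> ^ n * 1"
    by (rule order_trans[OF abs_ge_self]) (auto simp: abs_mult power_abs intro!: mult_left_le)
  then show "phi t ^ n * cos (t * real_of_int x) \<le> phi t ^ (2 * (n div 2))"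
    using phi_power_abs_le[of t n] by simp
qed

lemma green_le: "green n x \<le> 2 * gnorm n"
proof -
  have "green n x \<le> (\<Sum>m\<le>n. p (2 * (m div 2)) 0)"
    unfolding green_def by (rule sum_mono) (rule p_le_rounded)
  then show ?thesis using sum_rounded_times_le[of n] by simp
qed

text \<open>The difference has Fourier weight \<open>1 - cos (t * x)\<close>. It is at most
  \<open>\<epsilon>\<close> for \<open>t\<close> close to 0, uniformly in
  \<open>|x| \<le> R\<close>, and elsewhere the powers of \<open>phi\<close> decay
  geometrically.\<close>

lemma p_diff_le:
  assumes "0 < \<epsilon>"
  obtains \<rho> where "0 \<le> \<rho>" "\<rho> < 1"
    "\<And>n x. \<bar>x\<bar> \<le> int R \<Longrightarrow> \<bar>p n 0 - p n x\<bar> \<le> \<epsilon> * p (2 * (n div 2)) 0 + 2 * \<rho> ^ n"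
proof -
  have "isCont (\<lambda>s::real. s\<^sup>2 * (real R)\<^sup>2) 0" by (intro continuous_intros)
  then have "\<forall>\<^sub>F s in at (0::real). s\<^sup>2 * (real R)\<^sup>2 < \<epsilon>"
    using assms by (intro order_tendstoD(2)) (auto simp: isCont_def)
  then obtain \<delta> where \<delta>: "0 < \<delta>" "\<And>s::real. s \<noteq> 0 \<Longrightarrow> \<bar>s\<bar> < \<delta> \<Longrightarrow> s\<^sup>2 * (real R)\<^sup>2 < \<epsilon>"
    by (auto simp: eventually_at dist_real_def)
  obtain \<rho> where \<rho>: "0 \<le> \<rho>" "\<rho> < 1" "\<And>t. \<delta> \<le> \<bar>t\<bar> \<Longrightarrow> \<bar>t\<bar> \<le> pi \<Longrightarrow> \<bar>phi t\<bar> \<le> \<rho>"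
    using phi_bound_away[OF \<delta>(1)] by blast
  show thesis
  proof (rule that[OF \<rho>(1,2)])
    fix n :: nat and x :: int assume x: "\<bar>x\<bar> \<le> int R"
    define D where "D = (\<lambda>t. phi t ^ n - phi t ^ n * cos (t * of_int x))"
    have intD: "integrable circ D"
      unfolding D_def by (intro Bochner_Integration.integrable_diff integrable_phi_power integrable_phi_cos)
    have "p n 0 - p n x = integral\<^sup>L circ D"
      unfolding D_def p_0_eq p_fourier[of n x]
      by (subst Bochner_Integration.integral_diff) (auto simp: integrable_phi_power integrable_phi_cos)
    then have "\<bar>p n 0 - p n x\<bar> \<le> integral\<^sup>L circ (\<lambda>t. \<bar>D t\<bar>)" by (simp add: integral_abs_bound)
    also have "\<dots> \<le> integral\<^sup>L circ (\<lambda>t. \<epsilon> * phi t ^ (2 * (n div 2)) + 2 * \<rho> ^ n)"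
    proof (rule integral_mono_AE)
      show "integrable circ (\<lambda>t. \<bar>D t\<bar>)" using intD by simp
      show "integrable circ (\<lambda>t. \<epsilon> * phi t ^ (2 * (n div 2)) + 2 * \<rho> ^ n)"
        by (intro Bochner_Integration.integrable_add integrable_mult_right integrable_phi_power) simp
      show "AE t in circ. \<bar>D t\<bar> \<le> \<epsilon> * phi t ^ (2 * (n div 2)) + 2 * \<rho> ^ n"
        using AE_circ
      proof eventually_elim
        fix t assume t: "t \<in> {-pi..pi}"
        have D: "\<bar>D t\<bar> = \<bar>phi t\<bar> ^ n * (1 - cos (t * of_int x))"
          by (simp add: D_def abs_mult power_abs right_diff_distrib[of "phi t ^ n" 1, simplified, symmetric])
        have pe: "0 \<le> phi t ^ (2 * (n div 2))" by simp
        show "\<bar>D t\<bar> \<le> \<epsilon> * phi t ^ (2 * (n div 2)) + 2 * \<rho> ^ n"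
        proof (cases "\<bar>t\<bar> < \<delta>")
          case True
          have "1 - cos (t * of_int x) \<le> \<epsilon>"
          proof (cases "t = 0")
            case False
            have "1 - cos y \<le> y\<^sup>2" for y :: real
              using cos_ge_quadratic[of y] zero_le_power2[of y] by linarith
            then have "1 - cos (t * of_int x) \<le> t\<^sup>2 * (of_int x)\<^sup>2"
              by (simp add: power_mult_distrib[symmetric])
            also have "\<dots> \<le> t\<^sup>2 * (real R)\<^sup>2"
              using x by (intro mult_left_mono) (auto simp: abs_le_square_iff[symmetric])
            also have "\<dots> \<le> \<epsilon>" using \<delta>(2)[OF False True] by simp
            finally show ?thesis .
          qed (use assms in simp)
          then have "\<bar>D t\<bar> \<le> phi t ^ (2 * (n div 2)) * \<epsilon>"
            unfolding D by (intro mult_mono phi_power_abs_le pe) auto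
          moreover have "0 \<le> 2 * \<rho> ^ n" using \<rho> by simp
          ultimately show ?thesis by (simp add: mult.commute)
        next
          case False
          have "- 1 \<le> cos (t * of_int x)" by simp
          then have "\<bar>D t\<bar> \<le> \<rho> ^ n * 2"
            unfolding D using False t \<rho>(1) \<rho>(3)[of t] by (intro mult_mono power_mono) auto
          moreover have "0 \<le> \<epsilon> * phi t ^ (2 * (n div 2))" using assms pe by simp
          ultimately show ?thesis by (simp add: mult.commute)
        qed
      qed
    qed
    also have "\<dots> = \<epsilon> * p (2 * (n div 2)) 0 + 2 * \<rho> ^ n"
      unfolding p_0_eq
      by (subst Bochner_Integration.integral_add) (auto simp: integrable_phi_power circ.prob_space[simplified] simp del: power_mult)
    finally show "\<bar>p n 0 - p n x\<bar> \<le> \<epsilon> * p (2 * (n div 2)) 0 + 2 * \<rho> ^ n" .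
  qed
qed

text \<open>Summed over time the geometric terms stay bounded, so sites at bounded distance have the
  same Green function to leading order. The halved \<open>\<epsilon>\<close> pays for counting even
  times twice.\<close>

lemma green_diff_le:
  assumes "0 < \<epsilon>"
  obtains C where "0 \<le> C" "\<And>n x. \<bar>x\<bar> \<le> int R \<Longrightarrow> \<bar>gnorm n - green n x\<bar> \<le> \<epsilon> * gnorm n + C"
proof -
  have "0 < \<epsilon> / 2" using assms by simp
  from p_diff_le[OF this] obtain \<rho> where \<rho>: "0 \<le> \<rho>" "\<rho> < 1"
    "\<And>n x. \<bar>x\<bar> \<le> int R \<Longrightarrow> \<bar>p n 0 - p n x\<bar> \<le> \<epsilon> / 2 * p (2 * (n div 2)) 0 + 2 * \<rho> ^ n"
    by blast
  show thesis
  proof (rule that[of "2 * (1 / (1 - \<rho>))"])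
    show "0 \<le> 2 * (1 / (1 - \<rho>))" using \<rho> by simp
    fix n and x :: int assume x: "\<bar>x\<bar> \<le> int R"
    have "\<bar>gnorm n - green n x\<bar> \<le> (\<Sum>m\<le>n. \<epsilon> / 2 * p (2 * (m div 2)) 0 + 2 * \<rho> ^ m)"
      unfolding green_def sum_subtractf[symmetric]
      by (rule order_trans[OF sum_abs]) (rule sum_mono, rule \<rho>(3)[OF x])
    also have "\<dots> = \<epsilon> / 2 * (\<Sum>m\<le>n. p (2 * (m div 2)) 0) + 2 * (\<Sum>m\<le>n. \<rho> ^ m)"
      by (simp add: sum.distrib sum_distrib_left)
    also have "\<dots> \<le> \<epsilon> / 2 * (2 * gnorm n) + 2 * (1 / (1 - \<rho>))"
    proof (intro add_mono mult_left_mono sum_rounded_times_le)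
      have "(\<Sum>m\<le>n. \<rho> ^ m) \<le> (\<Sum>m. \<rho> ^ m)"
        using \<rho> by (intro sum_le_suminf summable_geometric) auto
      then show "(\<Sum>m\<le>n. \<rho> ^ m) \<le> 1 / (1 - \<rho>)"
        using \<rho> by (simp add: suminf_geometric)
    qed (use assms in auto)
    finally show "\<bar>gnorm n - green n x\<bar> \<le> \<epsilon> * gnorm n + 2 * (1 / (1 - \<rho>))" by simp
  qed
qed

lemma integrable_square: "integrable (measure_pmf q) (\<lambda>z. (real_of_int z)\<^sup>2)"
proof -
  have "(\<lambda>z. (real_of_int z)\<^sup>2 * pmf q z) summable_on UNIV"
    using standing by (simp add: standing_assms_def)
  then have "Infinite_Sum.abs_summable_on (\<lambda>z. (real_of_int z)\<^sup>2 * pmf q z) UNIV"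
    by (rule summable_on_iff_abs_summable_on_real[THEN iffD1])
  then have "Infinite_Set_Sum.abs_summable_on (\<lambda>z. (real_of_int z)\<^sup>2 * pmf q z) UNIV"
    by (rule abs_summable_equivalent[THEN iffD1])
  then have "integrable (count_space UNIV) (\<lambda>z. pmf q z *\<^sub>R (real_of_int z)\<^sup>2)"
    by (simp add: Infinite_Set_Sum.abs_summable_on_def mult.commute)
  then show ?thesis
    unfolding measure_pmf_eq_density by (subst integrable_density) auto
qed

text \<open>The finite second moment gives \<open>phi t\<close> at least
  \<open>1 - s * t^2 / 2\<close>, so up to time \<open>n\<close> the even powers of
  \<open>phi\<close> stay above 1/2 on a window of size \<open>1 / sqrt (s * n)\<close>. Each even
  time then contributes at least order \<open>1 / sqrt n\<close> to the Green function, in total at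
  least order \<open>sqrt n\<close>.\<close>

lemma le_gnorm_square: obtains C where "0 < C" "\<And>n. real n \<le> C * (gnorm n)\<^sup>2"
proof -
  \<comment> \<open>The maximum with 1 ensures \<open>\<tau> \<le> 1\<close> below, so the window
    fits into the circle.\<close>
  define s where "s = max 1 (measure_pmf.expectation q (\<lambda>z. (real_of_int z)\<^sup>2))"
  have s: "1 \<le> s" by (simp add: s_def)
  have phi_ge: "1 - s * t\<^sup>2 / 2 \<le> phi t" for t
  proof -
    have "1 - t\<^sup>2 / 2 * measure_pmf.expectation q (\<lambda>z. (real_of_int z)\<^sup>2)
        = measure_pmf.expectation q (\<lambda>z. 1 - t\<^sup>2 / 2 * (real_of_int z)\<^sup>2)"
      by (subst Bochner_Integration.integral_diff) (simp_all only: integral_mult_right_zero integrable_mult_right[OF integrable_square], simp_all)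
    also have "\<dots> \<le> phi t"
      unfolding phi_def
    proof (rule integral_mono)
      show "integrable (measure_pmf q) (\<lambda>z. 1 - t\<^sup>2 / 2 * (real_of_int z)\<^sup>2)"
        by (intro Bochner_Integration.integrable_diff integrable_mult_right integrable_square) simp
      show "integrable (measure_pmf q) (\<lambda>z. cos (t * real_of_int z))"
        by (rule pmf_integrable_bounded[where B = 1]) simp
      fix z :: int
      show "1 - t\<^sup>2 / 2 * (real_of_int z)\<^sup>2 \<le> cos (t * real_of_int z)"
        using cos_ge_quadratic[of "t * real_of_int z"] by (simp add: power_mult_distrib)
    qed
    finally have "1 - t\<^sup>2 / 2 * measure_pmf.expectation q (\<lambda>z. (real_of_int z)\<^sup>2) \<le> phi t" .
    moreover have "t\<^sup>2 / 2 * measure_pmf.expectation q (\<lambda>z. (real_of_int z)\<^sup>2) \<le> t\<^sup>2 / 2 * s"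
      by (rule mult_left_mono) (auto simp: s_def)
    ultimately show ?thesis by (simp add: mult.commute)
  qed
  show thesis
  \<comment> \<open>At least \<open>n / 2\<close> even times, each worth
    \<open>\<tau> / (2 * pi)\<close> with \<open>\<tau>^2 = 1 / (s * n)\<close>: the square of the
    total is \<open>n / (16 * pi^2 * s)\<close>.\<close>
  proof (rule that[of "16 * pi\<^sup>2 * s"])
    show "0 < 16 * pi\<^sup>2 * s" using s by simp
    fix n :: nat
    show "real n \<le> 16 * pi\<^sup>2 * s * (gnorm n)\<^sup>2"
    proof (cases "n = 0")
      case False
      define \<tau> where "\<tau> = 1 / sqrt (s * n)"
      have sn: "1 \<le> s * n" using s False mult_mono[of 1 s 1 "real n"] by simp
      have "1 \<le> sqrt (s * n)" using sn by simp
      then have "\<tau> \<le> 1" unfolding \<tau>_def by simp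
      then have \<tau>: "0 < \<tau>" "\<tau> \<le> pi" "\<tau>\<^sup>2 = 1 / (s * n)"
        using sn pi_ge_two by (linarith | simp add: \<tau>_def power_divide)+
      have low: "\<tau> / (2 * pi) \<le> p (2 * j) 0" if j: "2 * j \<le> n" for j
      proof -
        have "\<tau> / (2 * pi) = integral\<^sup>L circ (\<lambda>t. 1/2 * indicator {-\<tau>..\<tau>} t)"
          unfolding integral_mult_right_zero using \<tau> by (simp add: circ_measure_Icc)
        also have "\<dots> \<le> p (2 * j) 0"
          unfolding p_0_eq
        proof (rule integral_mono[OF _ integrable_phi_power])
          show "integrable circ (\<lambda>t. 1/2 * indicat_real {-\<tau>..\<tau>} t)"
            by (rule circ_integrable[where B = 1]) (auto split: split_indicator)
          fix t :: real
          show "1/2 * indicat_real {-\<tau>..\<tau>} t \<le> phi t ^ (2 * j)"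
          proof (cases "t \<in> {-\<tau>..\<tau>}")
            case True
            then have "\<bar>t\<bar> \<le> \<bar>\<tau>\<bar>" using \<tau> by auto
            then have "t\<^sup>2 \<le> \<tau>\<^sup>2" by (simp add: abs_le_square_iff)
            then have "s * t\<^sup>2 \<le> s * \<tau>\<^sup>2" using s by (intro mult_left_mono) auto
            also have "\<dots> = 1 / n" using s \<tau> by simp
            finally have phi: "1 - 1 / (2 * n) \<le> phi t"
              using phi_ge[of t] by (simp add: field_simps)
            have b: "0 \<le> 1 - 1 / real (2 * n)" "1 - 1 / real (2 * n) \<le> 1" using False by (auto simp: field_simps)
            \<comment> \<open>Bernoulli's inequality at exponent \<open>n\<close>; since
              \<open>2 * j \<le> n\<close> and the base is at most 1, passing to the exponent
              \<open>2 * j\<close> only increases the power.\<close>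
            have "1 / 2 = 1 + real n * (- (1 / (2 * n)))" using False by simp
            also have "\<dots> \<le> (1 + - (1 / (2 * n))) ^ n"
              by (rule Bernoulli_inequality) (use b in simp)
            also have "\<dots> \<le> (1 - 1 / (2 * n)) ^ (2 * j)"
              using power_decreasing[OF j b] by simp
            also have "\<dots> \<le> phi t ^ (2 * j)"
              by (rule power_mono[OF phi b(1)])
            finally show ?thesis using True by simp
          qed simp
        qed
        finally show ?thesis .
      qed
      have "real n / 2 * (\<tau> / (2 * pi)) \<le> real (Suc (n div 2)) * (\<tau> / (2 * pi))"
        using \<tau> by (intro mult_right_mono) auto
      also have "\<dots> = (\<Sum>j\<le>n div 2. \<tau> / (2 * pi))" by simp
      also have "\<dots> \<le> (\<Sum>j\<le>n div 2. p (2 * j) 0)"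
        by (intro sum_mono low) auto
      also have "\<dots> \<le> gnorm n" by (rule sum_even_times_le)
      finally have "(real n / 2 * (\<tau> / (2 * pi)))\<^sup>2 \<le> (gnorm n)\<^sup>2"
        using \<tau> by (intro power_mono) auto
      moreover have "(real n / 2 * (\<tau> / (2 * pi)))\<^sup>2 = (real n)\<^sup>2 * \<tau>\<^sup>2 / (16 * pi\<^sup>2)"
        by (simp add: power_mult_distrib power_divide)
      moreover have "(real n)\<^sup>2 * \<tau>\<^sup>2 = real n / s"
        using False s unfolding \<tau>(3) by (simp add: power2_eq_square)
      ultimately have "real n / s / (16 * pi\<^sup>2) \<le> (gnorm n)\<^sup>2" by simp
      then show ?thesis
        using s by (simp add: divide_le_eq mult_ac)
    qed (use s in simp)
  qed
qed

lemma gnorm_at_top: "filterlim gnorm at_top sequentially"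
proof -
  obtain C where C: "0 < C" "\<And>n. real n \<le> C * (gnorm n)\<^sup>2" using le_gnorm_square by blast
  show ?thesis
  proof (rule filterlim_at_top_mono)
    show "filterlim (\<lambda>n. sqrt (real n / C)) at_top sequentially"
      using filterlim_tendsto_pos_mult_at_top[OF tendsto_const, of "1 / C" real sequentially] C(1)
      by (intro filterlim_compose[OF sqrt_at_top]) (simp add: filterlim_real_sequentially)
    show "\<forall>\<^sub>F n in sequentially. sqrt (real n / C) \<le> gnorm n"
    proof (intro always_eventually allI)
      fix n
      have "real n / C \<le> (gnorm n)\<^sup>2" using C by (simp add: divide_le_eq mult.commute)
      then show "sqrt (real n / C) \<le> gnorm n"
        using green_nonneg[of n 0] by (rule real_le_lsqrt[rotated])
    qed
  qed
qed

text \<open>The shift by \<open>c\<close> absorbs the delay caused by the length of a pattern.\<close>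
lemma green_ratio:
  assumes "0 < \<epsilon>"
  obtains n0 where "n0 \<ge> c" "\<And>n x. n \<ge> n0 \<Longrightarrow> \<bar>x\<bar> \<le> int R \<Longrightarrow>
    \<bar>(\<Sum>m=1..n - c. p m x) - gnorm n\<bar> \<le> \<epsilon> * gnorm n"
proof -
  have "0 < \<epsilon> / 2" using assms by simp
  from green_diff_le[OF this] obtain C where C: "0 \<le> C"
    "\<And>n x. \<bar>x\<bar> \<le> int R \<Longrightarrow> \<bar>gnorm n - green n x\<bar> \<le> \<epsilon> / 2 * gnorm n + C" by blast
  have "\<forall>\<^sub>F n in sequentially. (C + c + 1) * (2 / \<epsilon>) \<le> gnorm n"
    using gnorm_at_top by (simp add: filterlim_at_top)
  then obtain n1 where n1: "\<And>n. n \<ge> n1 \<Longrightarrow> (C + c + 1) * (2 / \<epsilon>) \<le> gnorm n"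
    by (auto simp: eventually_sequentially)
  show thesis
  proof (rule that[of "max c n1"])
    fix n and x :: int assume n: "n \<ge> max c n1" and x: "\<bar>x\<bar> \<le> int R"
    \<comment> \<open>Time 0 and the last \<open>c\<close> times are left out: at most
      \<open>c + 1\<close> terms, each at most 1, absorbed together with \<open>C\<close> by the
      second half of \<open>\<epsilon> * gnorm n\<close>.\<close>
    have split: "{..n} = {1..n - c} \<union> ({0} \<union> {n - c<..n})" using n by auto
    have "green n x = (\<Sum>m=1..n - c. p m x) + (\<Sum>m\<in>{0} \<union> {n - c<..n}. p m x)"
      unfolding green_def split by (rule sum.union_disjoint) auto
    moreover have "(\<Sum>m\<in>{0} \<union> {n - c<..n}. p m x) \<le> (\<Sum>m\<in>{0} \<union> {n - c<..n}. 1)"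
      by (rule sum_mono) (auto intro: pmf_le_1)
    moreover have "(\<Sum>m\<in>{0} \<union> {n - c<..n}. 1 :: real) \<le> c + 1"
    proof -
      have "card ({0} \<union> {n - c<..n}) \<le> 1 + c"
        by (rule order_trans[OF card_Un_le]) (use n in auto)
      then show ?thesis by simp
    qed
    moreover have "0 \<le> (\<Sum>m\<in>{0} \<union> {n - c<..n}. p m x)" by (rule sum_nonneg) auto
    moreover have "\<bar>gnorm n - green n x\<bar> \<le> \<epsilon> / 2 * gnorm n + C" by (rule C(2)[OF x])
    moreover have "C + c + 1 \<le> \<epsilon> / 2 * gnorm n"
      using n1[of n] n assms by (simp add: field_simps)
    ultimately show "\<bar>(\<Sum>m=1..n - c. p m x) - gnorm n\<bar> \<le> \<epsilon> * gnorm n" by linarith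
  qed simp
qed

end

section \<open>Four-point correlations determine the biases\<close>

text \<open>The equation at \<open>(x, D - y)\<close> plus the one at \<open>(x, y)\<close> gives
  \<open>s x * s y\<close> for the even parts, and minus it gives \<open>w x * w y\<close> for the
  odd parts. Such products determine \<open>s\<close> and \<open>w\<close> up to one sign each;
  positivity fixes the sign of \<open>s\<close>, and flipping that of \<open>w\<close> is the
  reflection.\<close>

lemma reflection_dichotomy:
  fixes U U' :: "int \<Rightarrow> real"
  assumes D: "0 \<le> D" and U0: "0 < U 0" "0 \<le> U D" "0 < U' 0" "0 \<le> U' D"
    and eq: "\<And>x y. x \<in> {0..D} \<Longrightarrow> y \<in> {0..D} \<Longrightarrow>
      U x * U (D - y) + U (D - x) * U y = U' x * U' (D - y) + U' (D - x) * U' y"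
  shows "(\<forall>x\<in>{0..D}. U x = U' x) \<or> (\<forall>x\<in>{0..D}. U x = U' (D - x))"
proof -
  define s w s' w' where "s = (\<lambda>x. U x + U (D - x))" and "w = (\<lambda>x. U x - U (D - x))"
    and "s' = (\<lambda>x. U' x + U' (D - x))" and "w' = (\<lambda>x. U' x - U' (D - x))"
  note defs = s_def w_def s'_def w'_def
  have ss: "s x * s y = s' x * s' y" and ww: "w x * w y = w' x * w' y"
    if "x \<in> {0..D}" "y \<in> {0..D}" for x y
    using eq[of x y] eq[of x "D - y"] that by (simp_all add: defs algebra_simps)
  have pos: "0 < s 0" "0 < s' 0" using U0 by (auto simp: defs)
  have "(s 0)\<^sup>2 = (s' 0)\<^sup>2" using ss[of 0 0] D by (simp add: power2_eq_square)
  then have "s 0 = s' 0" using pos by (simp add: power2_eq_iff_nonneg)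
  then have s: "s y = s' y" if "y \<in> {0..D}" for y
    using ss[of 0 y] that pos by simp
  have "(\<forall>x\<in>{0..D}. w x = w' x) \<or> (\<forall>x\<in>{0..D}. w x = - w' x)"
  proof (cases "\<forall>x\<in>{0..D}. w x = 0")
    case True
    then have "w' x = 0" if "x \<in> {0..D}" for x using ww[OF that that] that by simp
    with True show ?thesis by simp
  next
    case False
    then obtain x where x: "x \<in> {0..D}" "w x \<noteq> 0" by blast
    have "(w x)\<^sup>2 = (w' x)\<^sup>2" using ww[of x x] x by (simp add: power2_eq_square)
    then consider "w x = w' x" | "w x = - w' x" by (auto simp: power2_eq_iff)
    then show ?thesis
    proof cases
      case 1
      then have "w y = w' y" if "y \<in> {0..D}" for y using ww[OF x(1) that] x by simp
      then show ?thesis by simp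
    next
      case 2
      have "w y = - w' y" if "y \<in> {0..D}" for y
      proof -
        have "w x * (w y + w' y) = 0" using ww[OF x(1) that] 2 by (simp add: distrib_left)
        then show ?thesis using x(2) by simp
      qed
      then show ?thesis by simp
    qed
  qed
  then show ?thesis
  proof
    assume "\<forall>x\<in>{0..D}. w x = w' x"
    then have "U x = U' x" if "x \<in> {0..D}" for x
      using s[OF that] that unfolding defs by fastforce
    then show ?thesis by simp
  next
    assume "\<forall>x\<in>{0..D}. w x = - w' x"
    then have "U x = U' (D - x)" if "x \<in> {0..D}" for x
      using s[OF that] that unfolding defs by fastforce
    then show ?thesis by simp
  qed
qed

text \<open>Restricting \<open>z\<close> to the support makes the sum over all integers a finite one
  for the biases considered, without changing its value.\<close>

definition corr4 :: "(int \<Rightarrow> real) \<Rightarrow> int \<Rightarrow> int \<Rightarrow> int \<Rightarrow> real" where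
  "corr4 \<theta> d1 d2 d3 = (\<Sum>z | \<theta> z \<noteq> 0. \<theta> z * \<theta> (z + d1) * \<theta> (z + d1 + d2) * \<theta> (z + d1 + d2 + d3))"

text \<open>Pairing with even transition probabilities in each of the three increments reveals this
  symmetrization and nothing more.\<close>

definition symm_corr4 :: "(int \<Rightarrow> real) \<Rightarrow> int \<Rightarrow> int \<Rightarrow> int \<Rightarrow> real" where
  "symm_corr4 \<theta> d1 d2 d3 = (\<Sum>e1\<in>{1, -1}. \<Sum>e2\<in>{1, -1}. \<Sum>e3\<in>{1, -1}. corr4 \<theta> (e1 * d1) (e2 * d2) (e3 * d3))"

lemma corr4_eq_0:
  assumes "\<And>z. \<theta> z = 0 \<or> \<theta> (z + d1) = 0 \<or> \<theta> (z + d1 + d2) = 0 \<or> \<theta> (z + d1 + d2 + d3) = 0"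
  shows "corr4 \<theta> d1 d2 d3 = 0"
  unfolding corr4_def using assms by (intro sum.neutral) auto

lemma corr4_extreme:
  assumes fin: "finite {z. \<theta> z \<noteq> 0}"
    and only: "\<And>z. \<theta> z \<noteq> 0 \<Longrightarrow> \<theta> (z + d) \<noteq> 0 \<Longrightarrow> z = u"
  shows "corr4 \<theta> x d y = \<theta> (u - x) * (\<theta> u * \<theta> (u + d)) * \<theta> (u + d + y)"
proof -
  have "corr4 \<theta> x d y = (\<Sum>z\<in>{u - x} \<inter> {z. \<theta> z \<noteq> 0}. \<theta> z * \<theta> (z + x) * \<theta> (z + x + d) * \<theta> (z + x + d + y))"
    unfolding corr4_def
  proof (rule sum.mono_neutral_right[OF fin])
    show "\<forall>z\<in>{z. \<theta> z \<noteq> 0} - {u - x} \<inter> {z. \<theta> z \<noteq> 0}. \<theta> z * \<theta> (z + x) * \<theta> (z + x + d) * \<theta> (z + x + d + y) = 0"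
      using only by force
  qed auto
  also have "\<dots> = \<theta> (u - x) * (\<theta> u * \<theta> (u + d)) * \<theta> (u + d + y)"
    by (cases "\<theta> (u - x) = 0") (auto simp: Int_insert_left)
  finally show ?thesis .
qed

text \<open>Inside the support an increment \<open>b - a\<close> can only lead from \<open>a\<close>
  to \<open>b\<close>, and its negative only from \<open>b\<close> to \<open>a\<close>. Both middle
  sites are then known, and the sums over the signs of the outer increments factor.\<close>

lemma symm_corr4_width:
  fixes \<theta> :: "int \<Rightarrow> real"
  assumes fin: "finite {z. \<theta> z \<noteq> 0}"
  defines "a \<equiv> Min {z. \<theta> z \<noteq> 0}" and "b \<equiv> Max {z. \<theta> z \<noteq> 0}"
  shows "symm_corr4 \<theta> x (b - a) y = \<theta> a * \<theta> b *
    ((\<theta> (a + x) + \<theta> (a - x)) * (\<theta> (b - y) + \<theta> (b + y)) + (\<theta> (b - x) + \<theta> (b + x)) * (\<theta> (a + y) + \<theta> (a - y)))"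
proof -
  have ab: "a \<le> z" "z \<le> b" if "\<theta> z \<noteq> 0" for z
    using fin that by (auto simp: a_def b_def)
  have 1: "corr4 \<theta> x (b - a) y = \<theta> (a - x) * (\<theta> a * \<theta> b) * \<theta> (b + y)" for x y
  proof -
    have "z = a" if "\<theta> z \<noteq> 0" "\<theta> (z + (b - a)) \<noteq> 0" for z
      using ab(1)[OF that(1)] ab(2)[OF that(2)] by linarith
    from corr4_extreme[OF fin this] show ?thesis by simp
  qed
  have 2: "corr4 \<theta> x (a - b) y = \<theta> (b - x) * (\<theta> b * \<theta> a) * \<theta> (a + y)" for x y
  proof -
    have "z = b" if "\<theta> z \<noteq> 0" "\<theta> (z + (a - b)) \<noteq> 0" for z
      using ab(2)[OF that(1)] ab(1)[OF that(2)] by linarith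
    from corr4_extreme[OF fin this] show ?thesis by simp
  qed
  show ?thesis
    by (simp add: symm_corr4_def 1 2 algebra_simps)
qed

lemma symm_corr4_determines:
  fixes \<theta> \<theta>' :: "int \<Rightarrow> real"
  assumes fin: "finite {z. \<theta> z \<noteq> 0}" and nn: "\<And>z. 0 \<le> \<theta> z"
    and fin': "finite {z. \<theta>' z \<noteq> 0}" and nn': "\<And>z. 0 \<le> \<theta>' z"
    and eq: "\<And>x d y. symm_corr4 \<theta> x d y = symm_corr4 \<theta>' x d y"
  shows "\<exists>c. \<exists>s\<in>{1, -1}. \<forall>z. \<theta>' z = \<theta> (s * z + c)"
proof -
  \<comment> \<open>With outer increments 0 the value at the width of \<open>\<theta>\<close> is
    positive, so the support of \<open>\<theta>'\<close> has two sites at that distance. Used in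
    both directions this equates the widths.\<close>
  have width_le: "{z. \<theta>' z \<noteq> 0} \<noteq> {} \<and> Max {z. \<theta> z \<noteq> 0} - Min {z. \<theta> z \<noteq> 0} \<le> Max {z. \<theta>' z \<noteq> 0} - Min {z. \<theta>' z \<noteq> 0}"
    if fin: "finite {z. \<theta> z \<noteq> 0}" and nn: "\<And>z. 0 \<le> \<theta> z" and fin': "finite {z. \<theta>' z \<noteq> 0}" and ne: "{z. \<theta> z \<noteq> 0} \<noteq> {}"
      and eq: "\<And>x d y. symm_corr4 \<theta> x d y = symm_corr4 \<theta>' x d y" for \<theta> \<theta>' :: "int \<Rightarrow> real"
  proof -
    define a b where "a = Min {z. \<theta> z \<noteq> 0}" and "b = Max {z. \<theta> z \<noteq> 0}"
    have "a \<in> {z. \<theta> z \<noteq> 0}" "b \<in> {z. \<theta> z \<noteq> 0}" using fin ne unfolding a_def b_def by (intro Min_in Max_in; simp)+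
    then have pos: "0 < \<theta> a" "0 < \<theta> b" using nn by (auto simp: less_le)
    have "0 < symm_corr4 \<theta> 0 (b - a) 0"
      using symm_corr4_width[OF fin, of 0 0, folded a_def b_def] pos by (simp add: add_pos_pos)
    then have "symm_corr4 \<theta>' 0 (b - a) 0 \<noteq> 0" using eq by simp
    then have "corr4 \<theta>' 0 (b - a) 0 \<noteq> 0 \<or> corr4 \<theta>' 0 (a - b) 0 \<noteq> 0"
      by (auto simp: symm_corr4_def)
    then obtain z where "\<theta>' z \<noteq> 0 \<and> (\<theta>' (z + (b - a)) \<noteq> 0 \<or> \<theta>' (z + (a - b)) \<noteq> 0)"
      using corr4_eq_0[of \<theta>' 0 "b - a" 0] corr4_eq_0[of \<theta>' 0 "a - b" 0] by auto
    then obtain y z where yz: "\<theta>' y \<noteq> 0" "\<theta>' z \<noteq> 0" "b - a = z - y"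
      by (metis add.commute add_diff_cancel_left' diff_add_cancel minus_diff_eq)
    have "z \<le> Max {z. \<theta>' z \<noteq> 0}" "Min {z. \<theta>' z \<noteq> 0} \<le> y" using fin' yz by auto
    then show ?thesis using yz unfolding a_def b_def by auto
  qed
  show ?thesis
  proof (cases "{z. \<theta> z \<noteq> 0} = {}")
    case True
    have "{z. \<theta>' z \<noteq> 0} = {}"
    proof (rule ccontr)
      assume "{z. \<theta>' z \<noteq> 0} \<noteq> {}"
      from width_le[OF fin' nn' fin this eq[symmetric]] True show False by simp
    qed
    with True show ?thesis by (intro exI[of _ 0] bexI[of _ 1]) auto
  next
    case False
    then have ne: "{z. \<theta> z \<noteq> 0} \<noteq> {}" .
    note w = width_le[OF fin nn fin' ne eq]
    then have ne': "{z. \<theta>' z \<noteq> 0} \<noteq> {}" by blast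
    note w' = width_le[OF fin' nn' fin ne' eq[symmetric]]
    define a b a' b' where "a = Min {z. \<theta> z \<noteq> 0}" and "b = Max {z. \<theta> z \<noteq> 0}"
      and "a' = Min {z. \<theta>' z \<noteq> 0}" and "b' = Max {z. \<theta>' z \<noteq> 0}"
    note ab_defs = a_def b_def a'_def b'_def
    define D where "D = b - a"
    have D': "D = b' - a'" using w w' unfolding D_def ab_defs by linarith
    have b: "b = a + D" "b' = a' + D" using D' by (auto simp: D_def)
    have "a \<in> {z. \<theta> z \<noteq> 0}" "b \<in> {z. \<theta> z \<noteq> 0}" using fin ne unfolding ab_defs by (intro Min_in Max_in; simp)+
    then have pos: "0 < \<theta> a" "0 < \<theta> b" using nn by (auto simp: less_le)
    have "a' \<in> {z. \<theta>' z \<noteq> 0}" "b' \<in> {z. \<theta>' z \<noteq> 0}" using fin' ne' unfolding ab_defs by (intro Min_in Max_in; simp)+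
    then have pos': "0 < \<theta>' a'" "0 < \<theta>' b'" using nn' by (auto simp: less_le)
    have out: "\<theta> z = 0" if "z < a \<or> b < z" for z
    proof (rule ccontr)
      assume "\<theta> z \<noteq> 0"
      then have "a \<le> z" "z \<le> b" using fin by (auto simp: ab_defs)
      with that show False by linarith
    qed
    have out': "\<theta>' z = 0" if "z < a' \<or> b' < z" for z
    proof (rule ccontr)
      assume "\<theta>' z \<noteq> 0"
      then have "a' \<le> z" "z \<le> b'" using fin' by (auto simp: ab_defs)
      with that show False by linarith
    qed
    have D0: "0 \<le> D" using out[of b] pos unfolding D_def by force
    define U U' where "U = (\<lambda>x. \<theta> (a + x))" and "U' = (\<lambda>x. \<theta>' (a' + x))"
    define A A' where "A = \<theta> a * \<theta> b" and "A' = \<theta>' a' * \<theta>' b'"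
    \<comment> \<open>For \<open>x > 0\<close> the site \<open>a - x\<close> lies outside the
      support and one term survives; for \<open>x = 0\<close> both terms are the same site, hence
      the factor 2.\<close>
    define k :: "int \<Rightarrow> real" where "k = (\<lambda>x. if x = 0 then 2 else 1)"
    have k: "k x \<noteq> 0" for x by (simp add: k_def)
    have edge: "\<theta> (a + x) + \<theta> (a - x) = k x * U x" "\<theta> (b - x) + \<theta> (b + x) = k x * U (D - x)"
       "\<theta>' (a' + x) + \<theta>' (a' - x) = k x * U' x" "\<theta>' (b' - x) + \<theta>' (b' + x) = k x * U' (D - x)"
      if "0 \<le> x" for x
      using that out[of "a - x"] out[of "b + x"] out'[of "a' - x"] out'[of "b' + x"]
      by (auto simp: k_def U_def U'_def b algebra_simps)
    have P: "A * (U x * U (D - y) + U (D - x) * U y) = A' * (U' x * U' (D - y) + U' (D - x) * U' y)"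
      if "x \<in> {0..D}" "y \<in> {0..D}" for x y
    proof -
      have "symm_corr4 \<theta> x D y = A * (k x * U x * (k y * U (D - y)) + k x * U (D - x) * (k y * U y))"
        using symm_corr4_width[OF fin, of x y] that edge unfolding ab_defs[symmetric] D_def A_def by simp
      moreover have "symm_corr4 \<theta>' x D y = A' * (k x * U' x * (k y * U' (D - y)) + k x * U' (D - x) * (k y * U' y))"
        using symm_corr4_width[OF fin', of x y] that edge unfolding ab_defs[symmetric] D' A'_def by simp
      ultimately have "k x * k y * (A * (U x * U (D - y) + U (D - x) * U y))
          = k x * k y * (A' * (U' x * U' (D - y) + U' (D - x) * U' y))"
        using eq[of x D y] by (simp add: algebra_simps)
      then show ?thesis using k by simp
    qed
    have A: "0 < A" "0 < A'" using pos pos' by (auto simp: A_def A'_def)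
    \<comment> \<open>The unknown prefactor is itself the product of the two end values, so the
      identity at \<open>x = y = 0\<close> reads \<open>2 * A\<^sup>2 = 2 * A'\<^sup>2\<close>, and
      positivity yields \<open>A = A'\<close>.\<close>
    have "U 0 * U D = A" "U' 0 * U' D = A'" by (auto simp: U_def U'_def A_def A'_def b)
    then have "A\<^sup>2 = A'\<^sup>2" using P[of 0 0] D0 by (simp add: power2_eq_square algebra_simps)
    then have "A = A'" using A by (simp add: power2_eq_iff_nonneg)
    then have P': "U x * U (D - y) + U (D - x) * U y = U' x * U' (D - y) + U' (D - x) * U' y"
      if "x \<in> {0..D}" "y \<in> {0..D}" for x y using P[OF that] A by simp
    have "(\<forall>x\<in>{0..D}. U x = U' x) \<or> (\<forall>x\<in>{0..D}. U x = U' (D - x))"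
      by (rule reflection_dichotomy[of D U U', OF D0 _ _ _ _ P']) (use pos pos' nn nn' in \<open>auto simp: U_def U'_def\<close>)
    then show ?thesis
    proof
      assume *: "\<forall>x\<in>{0..D}. U x = U' x"
      have "\<theta>' z = \<theta> (1 * z + (a - a'))" for z
      proof (cases "z \<in> {a'..b'}")
        case True
        then have "U (z - a') = U' (z - a')" using * by (auto simp: b)
        then show ?thesis by (simp add: U_def U'_def algebra_simps)
      next
        case False
        then show ?thesis using out[of "z + (a - a')"] out'[of z] by (auto simp: b)
      qed
      then show ?thesis by blast
    next
      assume *: "\<forall>x\<in>{0..D}. U x = U' (D - x)"
      have "\<theta>' z = \<theta> ((-1) * z + (a + b'))" for z
      proof (cases "z \<in> {a'..b'}")
        case True
        then have "U (b' - z) = U' (D - (b' - z))" using * by (auto simp: b)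
        then show ?thesis by (simp add: U_def U'_def D' algebra_simps)
      next
        case False
        then show ?thesis using out[of "(-1) * z + (a + b')"] out'[of z] by (auto simp: b)
      qed
      then show ?thesis by blast
    qed
  qed
qed

section \<open>From moments to symmetrized correlations\<close>

context symm_walk
begin

text \<open>Expected product of biases along a walk started at \<open>z\<close> and observed at time \<open>0\<close> and
  after each of the gaps \<open>gs\<close>, weighted with \<open>f\<close> at the last observed site.\<close>
primrec chain :: "(int \<Rightarrow> real) \<Rightarrow> nat list \<Rightarrow> (int \<Rightarrow> real) \<Rightarrow> int \<Rightarrow> real" where
  "chain \<theta> [] f z = \<theta> z * f z"
| "chain \<theta> (g # gs) f z = \<theta> z * (\<Sum>w | \<theta> w \<noteq> 0. p g (w - z) * chain \<theta> gs f w)"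

text \<open>The first observed site carries counting measure, which is invariant for the walk: the
  expected occupation time of any fixed site, divided by \<open>gnorm n\<close>, tends to 1.\<close>

definition moment :: "(int \<Rightarrow> real) \<Rightarrow> nat list \<Rightarrow> real" where
  "moment \<theta> gs = (\<Sum>z | \<theta> z \<noteq> 0. chain \<theta> gs (\<lambda>_. 1) z)"

lemma chain_eq_0: "\<theta> z = 0 \<Longrightarrow> chain \<theta> gs f z = 0"
  by (cases gs) auto

lemma sum_chain_superset:
  assumes "finite I" "{z. \<theta> z \<noteq> 0} \<subseteq> I"
  shows "(\<Sum>w | \<theta> w \<noteq> 0. k w * chain \<theta> gs f w) = (\<Sum>w\<in>I. k w * chain \<theta> gs f w)"
  using assms by (intro sum.mono_neutral_left) (auto simp: chain_eq_0)

text \<open>Passing from sites to increments makes the weights independent of the position, so that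
  the sum over starting points can be moved inside.\<close>

lemma chain_Cons_increment:
  assumes "{z. \<theta> z \<noteq> 0} \<subseteq> {-int N..int N}"
  shows "chain \<theta> (g # gs) f z = \<theta> z * (\<Sum>d\<in>{-int (2 * N)..int (2 * N)}. p g d * chain \<theta> gs f (z + d))"
proof (cases "\<theta> z = 0")
  case False
  then have z: "z \<in> {-int N..int N}" using assms by auto
  have "(\<Sum>w | \<theta> w \<noteq> 0. p g (w - z) * chain \<theta> gs f w)
      = (\<Sum>w\<in>(+) z ` {-int (2 * N)..int (2 * N)}. p g (w - z) * chain \<theta> gs f w)"
  proof (rule sum_chain_superset)
    show "{z. \<theta> z \<noteq> 0} \<subseteq> (+) z ` {- int (2 * N)..int (2 * N)}"
      using assms z by (force simp: image_iff intro: bexI[of _ "_ - z"])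
  qed simp
  also have "\<dots> = (\<Sum>d\<in>{-int (2 * N)..int (2 * N)}. p g d * chain \<theta> gs f (z + d))"
    by (subst sum.reindex) auto
  finally show ?thesis by simp
qed simp

lemma moment_corr4:
  assumes "{z. \<theta> z \<noteq> 0} \<subseteq> {-int N..int N}"
  defines "J \<equiv> {-int (2 * N)..int (2 * N)}"
  shows "moment \<theta> [g1, g2, g3] = (\<Sum>d1\<in>J. p g1 d1 * (\<Sum>d2\<in>J. p g2 d2 * (\<Sum>d3\<in>J. p g3 d3 * corr4 \<theta> d1 d2 d3)))"
proof -
  let ?S = "{z. \<theta> z \<noteq> 0}"
  have "moment \<theta> [g1, g2, g3] = (\<Sum>z\<in>?S. \<theta> z * (\<Sum>d1\<in>J. p g1 d1 * (\<theta> (z + d1) * (\<Sum>d2\<in>J. p g2 d2 *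
      (\<theta> (z + d1 + d2) * (\<Sum>d3\<in>J. p g3 d3 * \<theta> (z + d1 + d2 + d3)))))))"
    unfolding moment_def J_def
    by (rule sum.cong[OF refl]) (simp only: chain_Cons_increment[OF assms(1)] chain.simps(1) mult_1_right)
  also have "\<dots> = (\<Sum>z\<in>?S. \<Sum>d1\<in>J. \<Sum>d2\<in>J. \<Sum>d3\<in>J. p g1 d1 * (p g2 d2 * (p g3 d3 *
      (\<theta> z * \<theta> (z + d1) * \<theta> (z + d1 + d2) * \<theta> (z + d1 + d2 + d3)))))"
    by (simp only: sum_distrib_left mult_ac)
  also have "\<dots> = (\<Sum>d1\<in>J. \<Sum>z\<in>?S. \<Sum>d2\<in>J. \<Sum>d3\<in>J. p g1 d1 * (p g2 d2 * (p g3 d3 *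
      (\<theta> z * \<theta> (z + d1) * \<theta> (z + d1 + d2) * \<theta> (z + d1 + d2 + d3)))))"
    by (rule sum.swap)
  also have "\<dots> = (\<Sum>d1\<in>J. \<Sum>d2\<in>J. \<Sum>z\<in>?S. \<Sum>d3\<in>J. p g1 d1 * (p g2 d2 * (p g3 d3 *
      (\<theta> z * \<theta> (z + d1) * \<theta> (z + d1 + d2) * \<theta> (z + d1 + d2 + d3)))))"
    by (rule sum.cong[OF refl], rule sum.swap)
  also have "\<dots> = (\<Sum>d1\<in>J. \<Sum>d2\<in>J. \<Sum>d3\<in>J. \<Sum>z\<in>?S. p g1 d1 * (p g2 d2 * (p g3 d3 *
      (\<theta> z * \<theta> (z + d1) * \<theta> (z + d1 + d2) * \<theta> (z + d1 + d2 + d3)))))"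
    by (rule sum.cong[OF refl], rule sum.cong[OF refl], rule sum.swap)
  finally show ?thesis
    by (simp only: corr4_def sum_distrib_left)
qed

text \<open>The one-variable result is applied to one increment at a time: with the other gaps
  fixed, the inner sums form a finitely supported function of that increment. Each round replaces
  \<open>e\<close> by its symmetrization in one more variable.\<close>

lemma fourier_pairing3_determines:
  fixes e :: "int \<Rightarrow> int \<Rightarrow> int \<Rightarrow> real" and L :: nat
  defines "J \<equiv> {-int L..int L}"
  assumes supp: "\<And>d1 d2 d3. e d1 d2 d3 \<noteq> 0 \<Longrightarrow> d1 \<in> J \<and> d2 \<in> J \<and> d3 \<in> J"
    and zero: "\<And>g1 g2 g3. g1 \<ge> 1 \<Longrightarrow> g2 \<ge> 1 \<Longrightarrow> g3 \<ge> 1 \<Longrightarrow>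
      (\<Sum>d1\<in>J. p g1 d1 * (\<Sum>d2\<in>J. p g2 d2 * (\<Sum>d3\<in>J. p g3 d3 * e d1 d2 d3))) = 0"
  shows "(\<Sum>e1\<in>{1, -1}. \<Sum>e2\<in>{1, -1}. \<Sum>e3\<in>{1, -1}. e (e1 * d1) (e2 * d2) (e3 * d3)) = 0"
proof -
  define e1 where "e1 = (\<lambda>d1 d2 d3. e d1 d2 d3 + e (- d1) d2 d3)"
  define e2 where "e2 = (\<lambda>d1 d2 d3. e1 d1 d2 d3 + e1 d1 (- d2) d3)"
  have supp0: "e d1 d2 d3 = 0" if "d1 \<notin> J \<or> d2 \<notin> J \<or> d3 \<notin> J" for d1 d2 d3
    using supp that by blast
  have neg: "- d \<in> J \<longleftrightarrow> d \<in> J" for d by (auto simp: J_def)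
  have supp1: "e1 d1 d2 d3 = 0" if "d2 \<notin> J \<or> d3 \<notin> J" for d1 d2 d3
    using supp0 that by (auto simp: e1_def)
  have supp2: "e2 d1 d2 d3 = 0" if "d3 \<notin> J" for d1 d2 d3
    using supp1 that by (auto simp: e2_def)
  have s1: "(\<Sum>d2\<in>J. p g2 d2 * (\<Sum>d3\<in>J. p g3 d3 * e1 d1 d2 d3)) = 0" if g: "g2 \<ge> 1" "g3 \<ge> 1" for g2 g3 d1
  proof -
    let ?h = "\<lambda>d1. \<Sum>d2\<in>J. p g2 d2 * (\<Sum>d3\<in>J. p g3 d3 * e d1 d2 d3)"
    have "?h d1 + ?h (- d1) = 0"
    proof (rule fourier_pairing_determines[of ?h L])
      fix d assume ne: "?h d \<noteq> 0"
      show "d \<in> {- int L..int L}" by (rule ccontr) (use ne supp0 in \<open>simp add: J_def[symmetric]\<close>)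
    qed (use zero g in \<open>auto simp: J_def[symmetric]\<close>)
    then show ?thesis by (simp add: e1_def distrib_left sum.distrib)
  qed
  have s2: "(\<Sum>d3\<in>J. p g3 d3 * e2 d1 d2 d3) = 0" if g: "g3 \<ge> 1" for g3 d1 d2
  proof -
    let ?h = "\<lambda>d2. \<Sum>d3\<in>J. p g3 d3 * e1 d1 d2 d3"
    have "?h d2 + ?h (- d2) = 0"
    proof (rule fourier_pairing_determines[of ?h L])
      fix d assume ne: "?h d \<noteq> 0"
      show "d \<in> {- int L..int L}" by (rule ccontr) (use ne supp1 in \<open>simp add: J_def[symmetric]\<close>)
    qed (use s1 g in \<open>auto simp: J_def[symmetric]\<close>)
    then show ?thesis by (simp add: e2_def distrib_left sum.distrib)
  qed
  have "e2 d1 d2 d3 + e2 d1 d2 (- d3) = 0"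
  proof (rule fourier_pairing_determines[of "e2 d1 d2" L])
    fix d assume "e2 d1 d2 d \<noteq> 0"
    then show "d \<in> {- int L..int L}" using supp2[of d] by (auto simp: J_def[symmetric])
  qed (use s2 in \<open>auto simp: J_def[symmetric]\<close>)
  then show ?thesis by (simp add: e2_def e1_def)
qed

text \<open>Moments are linear in the correlations, so the pairing argument applies to the
  difference of the two correlation functions. Increments between sites of -N..N have size at most
  \<open>2 * N\<close>, which gives the common window.\<close>

lemma moments_determine:
  assumes fin: "finite {z. \<theta> z \<noteq> 0}" and nn: "\<And>z. 0 \<le> \<theta> z"
    and fin': "finite {z. \<theta>' z \<noteq> 0}" and nn': "\<And>z. 0 \<le> \<theta>' z"
    and eq: "\<And>g1 g2 g3. g1 \<ge> 1 \<Longrightarrow> g2 \<ge> 1 \<Longrightarrow> g3 \<ge> 1 \<Longrightarrow> moment \<theta> [g1, g2, g3] = moment \<theta>' [g1, g2, g3]"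
  shows "\<exists>c. \<exists>s\<in>{1, -1}. \<forall>z. \<theta>' z = \<theta> (s * z + c)"
proof (rule symm_corr4_determines[OF fin nn fin' nn'])
  fix x d y
  have "finite ({z. \<theta> z \<noteq> 0} \<union> {z. \<theta>' z \<noteq> 0})" using fin fin' by simp
  then obtain N where N: "\<forall>z\<in>{z. \<theta> z \<noteq> 0} \<union> {z. \<theta>' z \<noteq> 0}. nat \<bar>z\<bar> \<le> N"
    using finite_nat_set_iff_bounded_le[of "(\<lambda>z. nat \<bar>z\<bar>) ` ({z. \<theta> z \<noteq> 0} \<union> {z. \<theta>' z \<noteq> 0})"] by auto
  have S: "{z. \<theta> z \<noteq> 0} \<subseteq> {-int N..int N}" "{z. \<theta>' z \<noteq> 0} \<subseteq> {-int N..int N}" using N by force+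
  let ?e = "\<lambda>d1 d2 d3. corr4 \<theta> d1 d2 d3 - corr4 \<theta>' d1 d2 d3"
  have c0: "corr4 \<theta> d1 d2 d3 = 0"
    if S: "{z. \<theta> z \<noteq> 0} \<subseteq> {-int N..int N}"
      and d: "d1 \<notin> {-int (2*N)..int (2*N)} \<or> d2 \<notin> {-int (2*N)..int (2*N)} \<or> d3 \<notin> {-int (2*N)..int (2*N)}" for \<theta> d1 d2 d3
  proof (rule corr4_eq_0, rule ccontr)
    fix z assume "\<not> (\<theta> z = 0 \<or> \<theta> (z + d1) = 0 \<or> \<theta> (z + d1 + d2) = 0 \<or> \<theta> (z + d1 + d2 + d3) = 0)"
    then have "{z, z + d1, z + d1 + d2, z + d1 + d2 + d3} \<subseteq> {-int N..int N}" using S by auto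
    then show False using d by auto
  qed
  have "(\<Sum>e1\<in>{1, -1}. \<Sum>e2\<in>{1, -1}. \<Sum>e3\<in>{1, -1}. ?e (e1 * x) (e2 * d) (e3 * y)) = 0"
  proof (rule fourier_pairing3_determines[of ?e "2 * N"])
    fix d1 d2 d3 assume "?e d1 d2 d3 \<noteq> 0"
    then show "d1 \<in> {-int (2*N)..int (2*N)} \<and> d2 \<in> {-int (2*N)..int (2*N)} \<and> d3 \<in> {-int (2*N)..int (2*N)}"
      using c0[OF S(1), of d1 d2 d3] c0[OF S(2), of d1 d2 d3] by argo
  next
    fix g1 g2 g3 :: nat assume g: "g1 \<ge> 1" "g2 \<ge> 1" "g3 \<ge> 1"
    show "(\<Sum>d1\<in>{-int (2*N)..int (2*N)}. p g1 d1 * (\<Sum>d2\<in>{-int (2*N)..int (2*N)}. p g2 d2 *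
        (\<Sum>d3\<in>{-int (2*N)..int (2*N)}. p g3 d3 * ?e d1 d2 d3))) = 0"
      using eq[OF g] unfolding moment_corr4[OF S(1)] moment_corr4[OF S(2)]
      by (simp only: right_diff_distrib sum_subtractf)
  qed
  then show "symm_corr4 \<theta> x d y = symm_corr4 \<theta>' x d y"
    unfolding symm_corr4_def by (simp only: sum_subtractf)
qed

end

section \<open>Patterns of coin tosses\<close>

text \<open>\<open>True\<close> marks a time whose toss enters the product, \<open>False\<close> a
  time to skip. Coding patterns as lists makes first-step analysis of the walk a recursion over the
  list.\<close>

primrec toss_prod :: "bool list \<Rightarrow> (nat \<Rightarrow> int) \<Rightarrow> real" where
  "toss_prod [] x = 1"
| "toss_prod (b # bs) x = (if b then of_int (x 0) else 1) * toss_prod bs (\<lambda>i. x (Suc i))"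

lemma toss_prod_append: "toss_prod (bs @ cs) x = toss_prod bs x * toss_prod cs (\<lambda>i. x (length bs + i))"
  by (induction bs arbitrary: x) (auto simp: mult.assoc)

lemma toss_prod_abs_le: "(\<And>i. \<bar>x i\<bar> = 1) \<Longrightarrow> \<bar>toss_prod bs x\<bar> \<le> 1"
  by (induction bs arbitrary: x) (auto simp: abs_mult simp flip: of_int_abs)

lemma toss_prod_cong: "(\<And>i. i < length bs \<Longrightarrow> x i = y i) \<Longrightarrow> toss_prod bs x = toss_prod bs y"
proof (induction bs arbitrary: x y)
  case (Cons b bs)
  have "toss_prod bs (\<lambda>i. x (Suc i)) = toss_prod bs (\<lambda>i. y (Suc i))"
    by (rule Cons.IH) (use Cons.prems in auto)
  then show ?case using Cons.prems[of 0] by simp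
qed simp

text \<open>A gap \<open>g\<close> becomes \<open>g - 1\<close> skipped times between two marked
  ones. Gap 0 would be coded like gap 1, which is why positive gaps are assumed later.\<close>

primrec word :: "nat list \<Rightarrow> bool list" where
  "word [] = [True]"
| "word (g # gs) = True # replicate (g - 1) False @ word gs"

lemma word_append: "word (gs @ k # hs) = word gs @ replicate (k - 1) False @ word hs"
  by (induction gs) auto

lemma length_word: "(\<And>g. g \<in> set gs \<Longrightarrow> g \<ge> 1) \<Longrightarrow> length (word gs) = Suc (sum_list gs)"
  by (induction gs) (auto simp: Suc_le_eq)

lemma coin_abs: "\<bar>coin \<theta> \<omega> n\<bar> = 1"
  by (simp add: coin_def)

lemma walk_case_nat: "walk (case_nat s \<omega>) (Suc n) = fst s + walk \<omega> n"
  by (simp add: walk_def sum.lessThan_Suc_shift del: sum.lessThan_Suc)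

lemma coin_case_nat_0: "coin \<theta> (case_nat s \<omega>) 0 = (if snd s \<le> (1 + \<theta> 0) / 2 then 1 else -1)"
  by (simp add: coin_def walk_def)

lemma coin_case_nat_Suc: "coin \<theta> (case_nat s \<omega>) (Suc n) = coin (\<lambda>z. \<theta> (fst s + z)) \<omega> n"
  by (simp add: coin_def walk_case_nat)

text \<open>Splits off the first step instead of the last, to match the recursion over patterns,
  which starts at time 0.\<close>

lemma conv_pow_Suc_left: "conv_pow q (Suc n) = bind_pmf q (\<lambda>y. map_pmf ((+) y) (conv_pow q n))"
  unfolding conv_pow.simps map_pmf_def
  by (subst bind_commute_pmf) (simp add: add.commute)

section \<open>The probability space and the first-step recursion for pattern means\<close>

abbreviation step_space :: "int pmf \<Rightarrow> (int \<times> real) measure" where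
  "step_space q \<equiv> measure_pmf q \<Otimes>\<^sub>M uniform_measure lborel {0..1}"

lemma prob_space_uniform01: "prob_space (uniform_measure lborel {0..1::real})"
  by (rule prob_space_uniform_measure) auto

lemma prob_space_step: "prob_space (step_space q)"
  by (intro prob_space_pair measure_pmf.prob_space_axioms prob_space_uniform01)

lemma sequence_space_step: "sequence_space (step_space q)"
proof -
  interpret prob_space "step_space q" by (rule prob_space_step)
  show ?thesis by unfold_locales
qed

lemma prob_space_walk_space: "prob_space (walk_space q)"
  unfolding walk_space_def by (intro prob_space_PiM prob_space_step)

lemma measurable_step_component [measurable]: "(\<lambda>\<omega>. \<omega> i) \<in> measurable (walk_space q) (step_space q)"
  unfolding walk_space_def by (rule measurable_component_singleton) simp

lemma measurable_walk [measurable]: "(\<lambda>\<omega>. walk \<omega> n) \<in> measurable (walk_space q) (count_space UNIV)"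
proof (induction n)
  case (Suc n)
  have "(\<lambda>\<omega>. fst (\<omega> n)) \<in> measurable (walk_space q) (measure_pmf q)" by measurable
  then have fst: "(\<lambda>\<omega>. fst (\<omega> n)) \<in> measurable (walk_space q) (count_space UNIV)"
    by simp
  have "(\<lambda>\<omega>. walk \<omega> n + fst (\<omega> n)) \<in> measurable (walk_space q) (count_space UNIV)"
    by (rule measurable_compose_countable[OF _ Suc]) (rule measurable_compose[OF fst], simp)
  then show ?case by (simp add: walk_def)
qed (simp add: walk_def)

lemma measurable_coin [measurable]: "(\<lambda>\<omega>. coin \<theta> \<omega> n) \<in> measurable (walk_space q) (count_space UNIV)"
proof -
  have [measurable]: "(\<lambda>\<omega>. \<theta> (walk \<omega> n)) \<in> borel_measurable (walk_space q)"
    by (rule measurable_compose[OF measurable_walk]) simp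
  have "(\<lambda>\<omega>. snd (\<omega> n)) \<in> measurable (walk_space q) (uniform_measure lborel {0..1})" by measurable
  then have [measurable]: "(\<lambda>\<omega>. snd (\<omega> n)) \<in> borel_measurable (walk_space q)"
    by (simp cong: measurable_cong_sets)
  show ?thesis unfolding coin_def by measurable
qed

lemma measurable_toss_prod_shift:
  "(\<lambda>\<omega>. toss_prod bs (\<lambda>i. coin \<theta> \<omega> (k + i))) \<in> borel_measurable (walk_space q)"
proof (induction bs arbitrary: k)
  case (Cons b bs)
  have [measurable]: "(\<lambda>\<omega>. real_of_int (coin \<theta> \<omega> k)) \<in> borel_measurable (walk_space q)"
    by (rule measurable_compose[OF measurable_coin]) simp
  have [measurable]: "(\<lambda>\<omega>. toss_prod bs (\<lambda>i. coin \<theta> \<omega> (Suc (k + i)))) \<in> borel_measurable (walk_space q)"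
    using Cons[of "Suc k"] by simp
  show ?case by (cases b) simp_all
qed simp

lemma measurable_toss_prod [measurable]:
  "(\<lambda>\<omega>. toss_prod bs (coin \<theta> \<omega>)) \<in> borel_measurable (walk_space q)"
  using measurable_toss_prod_shift[of bs \<theta> 0] by simp

text \<open>The walk starts at 0; other starting points are obtained by shifting \<theta>.\<close>

definition pattern_mean :: "int pmf \<Rightarrow> (int \<Rightarrow> real) \<Rightarrow> bool list \<Rightarrow> real" where
  "pattern_mean q \<theta> bs = integral\<^sup>L (walk_space q) (\<lambda>\<omega>. toss_prod bs (coin \<theta> \<omega>))"

lemma integrable_toss_prod: "integrable (walk_space q) (\<lambda>\<omega>. toss_prod bs (coin \<theta> \<omega>))"
proof -
  interpret prob_space "walk_space q" by (rule prob_space_walk_space)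
  show ?thesis
    by (rule integrable_const_bound[where B = 1]) (auto simp: toss_prod_abs_le coin_abs)
qed

lemma pattern_mean_Nil [simp]: "pattern_mean q \<theta> [] = 1"
proof -
  interpret prob_space "walk_space q" by (rule prob_space_walk_space)
  show ?thesis by (simp add: pattern_mean_def prob_space)
qed

lemma pattern_mean_abs_le: "\<bar>pattern_mean q \<theta> bs\<bar> \<le> 1"
proof -
  interpret prob_space "walk_space q" by (rule prob_space_walk_space)
  have "\<bar>pattern_mean q \<theta> bs\<bar> \<le> integral\<^sup>L (walk_space q) (\<lambda>\<omega>. \<bar>toss_prod bs (coin \<theta> \<omega>)\<bar>)"
    unfolding pattern_mean_def by (rule integral_abs_bound)
  also have "\<dots> \<le> integral\<^sup>L (walk_space q) (\<lambda>\<omega>. 1)"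
    by (rule integral_mono) (auto simp: integrable_toss_prod toss_prod_abs_le coin_abs)
  finally show ?thesis by (simp add: prob_space)
qed

lemma uniform01_toss_mean:
  assumes "0 \<le> t" "t \<le> (1::real)"
  shows "integral\<^sup>L (uniform_measure lborel {0..1}) (\<lambda>u. if u \<le> (1 + t) / 2 then 1 else -1 :: real) = t"
proof -
  interpret prob_space "uniform_measure lborel {0..1::real}" by (rule prob_space_uniform01)
  have "{0..1} \<inter> {..(1 + t) / 2} = {0..(1 + t) / 2}" using assms by auto
  then have m: "measure (uniform_measure lborel {0..1}) {..(1 + t) / 2} = (1 + t) / 2"
    using assms by (subst measure_uniform_measure) auto
  have ind: "integral\<^sup>L (uniform_measure lborel {0..1}) (indicat_real {..(1 + t) / 2}) = (1 + t) / 2"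
    using m by (simp del: measure_uniform_measure)
  have const: "integral\<^sup>L (uniform_measure lborel {0..1}) (\<lambda>u :: real. 1 :: real) = 1"
    using prob_space by (simp del: measure_uniform_measure)
  have "integral\<^sup>L (uniform_measure lborel {0..1}) (\<lambda>u. if u \<le> (1 + t) / 2 then 1 else -1 :: real)
      = integral\<^sup>L (uniform_measure lborel {0..1}) (\<lambda>u. 2 * indicator {..(1 + t) / 2} u - 1)"
    by (rule Bochner_Integration.integral_cong) (auto split: split_indicator)
  also have "\<dots> = 2 * ((1 + t) / 2) - 1"
  proof (subst Bochner_Integration.integral_diff)
    show "integrable (uniform_measure lborel {0..1}) (\<lambda>u. 2 * indicat_real {..(1 + t) / 2} u)"
      by (rule integrable_const_bound[where B = 2]) (auto split: split_indicator)
    show "integral\<^sup>L (uniform_measure lborel {0..1}) (\<lambda>u. 2 * indicat_real {..(1 + t) / 2} u)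
        - integral\<^sup>L (uniform_measure lborel {0..1}) (\<lambda>u :: real. 1) = 2 * ((1 + t) / 2) - 1"
      unfolding integral_mult_right_zero ind const ..
  qed simp
  finally show ?thesis by (simp add: add_divide_distrib)
qed

text \<open>First-step analysis. The coordinate at time 0 carries both the uniform variable of the
  toss at site 0 and the increment to the next site. These are independent, and the remaining
  coordinates form the same product space, so the mean factors.\<close>

lemma pattern_mean_Cons:
  assumes \<theta>: "0 \<le> \<theta> 0" "\<theta> 0 \<le> 1"
  shows "pattern_mean q \<theta> (b # bs) = (if b then \<theta> 0 else 1)
    * measure_pmf.expectation q (\<lambda>y. pattern_mean q (\<lambda>z. \<theta> (y + z)) bs)"
proof -
  let ?U = "uniform_measure lborel {0..1::real}" and ?W = "walk_space q"
  define A where "A = (\<lambda>u. if b then (if u \<le> (1 + \<theta> 0) / 2 then 1 else -1) else 1 :: real)"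
  define F where "F = (\<lambda>s \<omega>. toss_prod (b # bs) (coin \<theta> (case_nat s \<omega>)))"
  have F: "F s \<omega> = A (snd s) * toss_prod bs (coin (\<lambda>z. \<theta> (fst s + z)) \<omega>)" for s \<omega>
    by (simp add: F_def A_def coin_case_nat_0 coin_case_nat_Suc)
  interpret S: sequence_space "step_space q" by (rule sequence_space_step)
  interpret W: prob_space ?W by (rule prob_space_walk_space)
  interpret U: prob_space ?U by (rule prob_space_uniform01)
  interpret SW: prob_space "step_space q \<Otimes>\<^sub>M ?W" by (intro prob_space_pair prob_space_step prob_space_walk_space)
  interpret P1: pair_sigma_finite "step_space q" ?W ..
  interpret P2: pair_sigma_finite "measure_pmf q" ?U ..
  have iter: "distr (step_space q \<Otimes>\<^sub>M ?W) ?W (\<lambda>(s, \<omega>). case_nat s \<omega>) = ?W"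
    unfolding walk_space_def by (rule S.PiM_iter)
  have meas_cn: "(\<lambda>(s, \<omega>). case_nat s \<omega>) \<in> measurable (step_space q \<Otimes>\<^sub>M ?W) ?W"
    unfolding walk_space_def by measurable
  have absF: "\<bar>F s \<omega>\<bar> \<le> 1" for s \<omega>
    unfolding F_def by (rule toss_prod_abs_le) (rule coin_abs)
  have measF: "(\<lambda>(s, \<omega>). F s \<omega>) \<in> borel_measurable (step_space q \<Otimes>\<^sub>M ?W)"
    using measurable_compose[OF meas_cn measurable_toss_prod] by (simp add: F_def split_beta' del: toss_prod.simps)
  define G where "G = (\<lambda>y. pattern_mean q (\<lambda>z. \<theta> (y + z)) bs)"
  have "pattern_mean q \<theta> (b # bs)
      = integral\<^sup>L (distr (step_space q \<Otimes>\<^sub>M ?W) ?W (\<lambda>(s, \<omega>). case_nat s \<omega>)) (\<lambda>\<omega>. toss_prod (b # bs) (coin \<theta> \<omega>))"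
    unfolding pattern_mean_def iter ..
  also have "\<dots> = integral\<^sup>L (step_space q \<Otimes>\<^sub>M ?W) (\<lambda>(s, \<omega>). F s \<omega>)"
    by (subst integral_distr[OF meas_cn]) (simp_all add: F_def split_beta' del: toss_prod.simps)
  also have "\<dots> = (\<integral>s. (\<integral>\<omega>. F s \<omega> \<partial>?W) \<partial>step_space q)"
    by (subst P1.integral_fst'[symmetric])
       (use measF absF in \<open>auto intro!: SW.integrable_const_bound[where B = 1]\<close>)
  also have "\<dots> = (\<integral>s. (case s of (y, u) \<Rightarrow> A u * G y) \<partial>step_space q)"
    by (intro Bochner_Integration.integral_cong refl) (simp add: F G_def pattern_mean_def split_beta')
  also have "\<dots> = (\<integral>y. (\<integral>u. A u * G y \<partial>?U) \<partial>measure_pmf q)"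
  proof (subst P2.integral_fst'[symmetric])
    have [measurable]: "A \<in> borel_measurable ?U" unfolding A_def by (cases b) simp_all
    have [measurable]: "G \<in> borel_measurable (measure_pmf q)" by simp
    have absA: "\<bar>A u\<bar> \<le> 1" for u by (simp add: A_def)
    have absG: "\<bar>G y\<bar> \<le> 1" for y unfolding G_def by (rule pattern_mean_abs_le)
    have "\<bar>A u * G y\<bar> \<le> 1" for u y
      unfolding abs_mult by (intro mult_le_one absA absG) auto
    then show "integrable (step_space q) (\<lambda>(y, u). A u * G y)"
      by (intro finite_measure.integrable_const_bound[OF prob_space.finite_measure[OF prob_space_step], where B = 1] AE_I2) (auto simp: split_beta')
  qed simp
  also have "\<dots> = (\<integral>u. A u \<partial>?U) * (\<integral>y. G y \<partial>measure_pmf q)"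
    by simp
  also have "(\<integral>u. A u \<partial>?U) = (if b then \<theta> 0 else 1)"
    using uniform01_toss_mean[OF \<theta>] U.prob_space by (simp add: A_def)
  finally show ?thesis unfolding G_def .
qed

lemma pattern_mean_replicate:
  assumes \<theta>: "\<And>z. 0 \<le> \<theta> z" "\<And>z. \<theta> z \<le> 1"
  shows "pattern_mean q \<theta> (replicate k False @ bs)
    = measure_pmf.expectation (conv_pow q k) (\<lambda>y. pattern_mean q (\<lambda>z. \<theta> (y + z)) bs)"
  using assms
proof (induction k arbitrary: \<theta>)
  case 0
  then show ?case by simp
next
  case (Suc k)
  have "pattern_mean q \<theta> (replicate (Suc k) False @ bs) = measure_pmf.expectation q
      (\<lambda>y. measure_pmf.expectation (conv_pow q k) (\<lambda>y'. pattern_mean q (\<lambda>z. \<theta> (y + (y' + z))) bs))"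
    using Suc by (simp add: pattern_mean_Cons)
  also have "\<dots> = measure_pmf.expectation (conv_pow q (Suc k)) (\<lambda>y. pattern_mean q (\<lambda>z. \<theta> (y + z)) bs)"
    unfolding conv_pow_Suc_left
    by (subst pmf_expectation_bind_bounded[where B = 1]) (auto simp: pattern_mean_abs_le add.assoc)
  finally show ?case .
qed

section \<open>Pattern means expressed as chains\<close>

context symm_walk
begin

lemma expectation_conv_pow_supp:
  assumes "finite {z. \<theta> z \<noteq> 0}"
  shows "measure_pmf.expectation (conv_pow q k) (\<lambda>y. chain \<theta> gs f (x + y))
    = (\<Sum>w | \<theta> w \<noteq> 0. p k (w - x) * chain \<theta> gs f w)"
proof -
  have "measure_pmf.expectation (conv_pow q k) (\<lambda>y. chain \<theta> gs f (x + y))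
      = (\<Sum>y\<in>(\<lambda>w. w - x) ` {w. \<theta> w \<noteq> 0}. chain \<theta> gs f (x + y) * p k y)"
  proof (rule integral_measure_pmf_real)
    fix y assume "chain \<theta> gs f (x + y) \<noteq> 0"
    then have "\<theta> (x + y) \<noteq> 0" using chain_eq_0 by blast
    then show "y \<in> (\<lambda>w. w - x) ` {w. \<theta> w \<noteq> 0}" by (intro image_eqI[of _ _ "x + y"]) auto
  qed (use assms in simp)
  also have "\<dots> = (\<Sum>w | \<theta> w \<noteq> 0. p k (w - x) * chain \<theta> gs f w)"
    by (subst sum.reindex) (auto intro!: inj_onI simp: mult.commute)
  finally show ?thesis .
qed

lemma chain_append: "chain \<theta> (gs @ k # hs) f z
    = chain \<theta> gs (\<lambda>w. \<Sum>w' | \<theta> w' \<noteq> 0. p k (w' - w) * chain \<theta> hs f w') z"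
  by (induction gs arbitrary: z) auto

lemma pattern_mean_word_shift:
  assumes \<theta>: "\<And>z. 0 \<le> \<theta> z" "\<And>z. \<theta> z \<le> 1" and fin: "finite {z. \<theta> z \<noteq> 0}"
    and gs: "\<And>g. g \<in> set gs \<Longrightarrow> g \<ge> 1"
  shows "pattern_mean q (\<lambda>z. \<theta> (x + z)) (word gs) = chain \<theta> gs (\<lambda>_. 1) x"
  using gs
proof (induction gs arbitrary: x)
  case Nil
  then show ?case using \<theta> by (simp add: pattern_mean_Cons)
next
  case (Cons g gs)
  \<comment> \<open>A marked time contributes its bias and otherwise acts like a skipped one, so the
    whole gap becomes \<open>g\<close> skipped times.\<close>
  have "pattern_mean q (\<lambda>z. \<theta> (x + z)) (word (g # gs))
      = \<theta> x * pattern_mean q (\<lambda>z. \<theta> (x + z)) (False # replicate (g - 1) False @ word gs)"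
    using \<theta> by (simp add: pattern_mean_Cons)
  also have "False # replicate (g - 1) False @ word gs = replicate g False @ word gs"
    using Cons.prems[of g] by (cases g) auto
  also have "pattern_mean q (\<lambda>z. \<theta> (x + z)) (replicate g False @ word gs)
      = measure_pmf.expectation (conv_pow q g) (\<lambda>y. chain \<theta> gs (\<lambda>_. 1) (x + y))"
    using \<theta> Cons by (simp add: pattern_mean_replicate add.assoc[symmetric])
  finally show ?case by (simp add: expectation_conv_pow_supp[OF fin])
qed

lemma pattern_mean_delayed_word:
  assumes \<theta>: "\<And>z. 0 \<le> \<theta> z" "\<And>z. \<theta> z \<le> 1" and fin: "finite {z. \<theta> z \<noteq> 0}"
    and gs: "\<And>g. g \<in> set gs \<Longrightarrow> g \<ge> 1"
  shows "pattern_mean q \<theta> (replicate m False @ word gs) = (\<Sum>z | \<theta> z \<noteq> 0. p m z * chain \<theta> gs (\<lambda>_. 1) z)"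
  using expectation_conv_pow_supp[OF fin, of m gs "\<lambda>_. 1" 0] assms
  by (simp add: pattern_mean_replicate pattern_mean_word_shift)

end

section \<open>Statistics of patterns\<close>

text \<open>A fixed window makes the later bounds uniform in \<theta>: sums over the support have at
  most \<open>2 * N + 1\<close> terms.\<close>

definition bias_on :: "nat \<Rightarrow> (int \<Rightarrow> real) \<Rightarrow> bool" where
  "bias_on N \<theta> \<longleftrightarrow> (\<forall>z. 0 \<le> \<theta> z \<and> \<theta> z \<le> 1) \<and> (\<forall>z. \<theta> z \<noteq> 0 \<longrightarrow> \<bar>z\<bar> \<le> int N)"

lemma bias_onD:
  assumes "bias_on N \<theta>"
  shows "0 \<le> \<theta> z" "\<theta> z \<le> 1" "\<theta> z \<noteq> 0 \<Longrightarrow> \<bar>z\<bar> \<le> int N"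
    "finite {z. \<theta> z \<noteq> 0}" "card {z. \<theta> z \<noteq> 0} \<le> 2 * N + 1"
proof -
  have sub: "{z. \<theta> z \<noteq> 0} \<subseteq> {-int N..int N}"
    using assms by (auto simp: bias_on_def abs_le_iff)
  show "finite {z. \<theta> z \<noteq> 0}" by (rule finite_subset[OF sub]) simp
  show "card {z. \<theta> z \<noteq> 0} \<le> 2 * N + 1"
    using card_mono[OF _ sub] by simp
qed (use assms in \<open>auto simp: bias_on_def\<close>)

text \<open>A class closed under the arithmetic below, so that integrability never needs a separate
  argument.\<close>

definition bdd_rv :: "int pmf \<Rightarrow> ((nat \<Rightarrow> int \<times> real) \<Rightarrow> real) \<Rightarrow> bool" where
  "bdd_rv q f \<longleftrightarrow> f \<in> borel_measurable (walk_space q) \<and> (\<exists>B. \<forall>\<omega>. \<bar>f \<omega>\<bar> \<le> B)"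

lemma bdd_rv_const: "bdd_rv q (\<lambda>_. c)"
  by (auto simp: bdd_rv_def)

lemma bdd_rv_add:
  assumes "bdd_rv q f" "bdd_rv q g"
  shows "bdd_rv q (\<lambda>\<omega>. f \<omega> + g \<omega>)"
proof -
  obtain B C where "\<And>\<omega>. \<bar>f \<omega>\<bar> \<le> B" "\<And>\<omega>. \<bar>g \<omega>\<bar> \<le> C" using assms unfolding bdd_rv_def by metis
  then have "\<bar>f \<omega> + g \<omega>\<bar> \<le> B + C" for \<omega> by (meson abs_triangle_ineq add_mono order_trans)
  then show ?thesis using assms by (auto simp: bdd_rv_def)
qed

lemma bdd_rv_mult:
  assumes "bdd_rv q f" "bdd_rv q g"
  shows "bdd_rv q (\<lambda>\<omega>. f \<omega> * g \<omega>)"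
proof -
  obtain B C where BC: "\<And>\<omega>. \<bar>f \<omega>\<bar> \<le> B" "\<And>\<omega>. \<bar>g \<omega>\<bar> \<le> C" using assms unfolding bdd_rv_def by metis
  then have "0 \<le> B" by (meson abs_ge_zero order_trans)
  then have "\<bar>f \<omega> * g \<omega>\<bar> \<le> B * C" for \<omega> unfolding abs_mult by (intro mult_mono BC) auto
  then show ?thesis using assms by (auto simp: bdd_rv_def)
qed

lemma bdd_rv_diff:
  assumes "bdd_rv q f" "bdd_rv q g"
  shows "bdd_rv q (\<lambda>\<omega>. f \<omega> - g \<omega>)"
  using bdd_rv_add[OF assms(1) bdd_rv_mult[OF bdd_rv_const[of q "-1"] assms(2)]] by simp

lemma bdd_rv_sum: "(\<And>i. i \<in> A \<Longrightarrow> bdd_rv q (f i)) \<Longrightarrow> bdd_rv q (\<lambda>\<omega>. \<Sum>i\<in>A. f i \<omega>)"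
  by (induction A rule: infinite_finite_induct) (auto intro: bdd_rv_const bdd_rv_add)

lemma bdd_rv_sum_list: "(\<And>i. i \<in> set xs \<Longrightarrow> bdd_rv q (f i)) \<Longrightarrow> bdd_rv q (\<lambda>\<omega>. \<Sum>i\<leftarrow>xs. f i \<omega>)"
  by (induction xs) (auto intro: bdd_rv_const bdd_rv_add)

lemma bdd_rv_power2: "bdd_rv q f \<Longrightarrow> bdd_rv q (\<lambda>\<omega>. (f \<omega>)\<^sup>2)"
  unfolding power2_eq_square by (rule bdd_rv_mult)

lemma bdd_rv_integrable: "bdd_rv q f \<Longrightarrow> integrable (walk_space q) f"
proof -
  interpret prob_space "walk_space q" by (rule prob_space_walk_space)
  assume "bdd_rv q f"
  then obtain B where "f \<in> borel_measurable (walk_space q)" "\<And>\<omega>. \<bar>f \<omega>\<bar> \<le> B"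
    unfolding bdd_rv_def by blast
  then show ?thesis by (intro integrable_const_bound[where B = B]) auto
qed

lemma bdd_rv_toss_prod: "bdd_rv q (\<lambda>\<omega>. toss_prod bs (coin \<theta> \<omega>))"
  unfolding bdd_rv_def by (auto intro!: exI[of _ 1] toss_prod_abs_le coin_abs)

lemmas bdd_rv_intros = bdd_rv_const bdd_rv_add bdd_rv_mult bdd_rv_diff bdd_rv_sum bdd_rv_sum_list
  bdd_rv_power2 bdd_rv_toss_prod

abbreviation walk_E :: "int pmf \<Rightarrow> ((nat \<Rightarrow> int \<times> real) \<Rightarrow> real) \<Rightarrow> real" where
  "walk_E q f \<equiv> integral\<^sup>L (walk_space q) f"

lemma walk_E_add: "bdd_rv q f \<Longrightarrow> bdd_rv q g \<Longrightarrow> walk_E q (\<lambda>\<omega>. f \<omega> + g \<omega>) = walk_E q f + walk_E q g"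
  by (intro Bochner_Integration.integral_add bdd_rv_integrable)

lemma walk_E_diff: "bdd_rv q f \<Longrightarrow> bdd_rv q g \<Longrightarrow> walk_E q (\<lambda>\<omega>. f \<omega> - g \<omega>) = walk_E q f - walk_E q g"
  by (intro Bochner_Integration.integral_diff bdd_rv_integrable)

lemma walk_E_sum: "(\<And>i. i \<in> A \<Longrightarrow> bdd_rv q (f i)) \<Longrightarrow> walk_E q (\<lambda>\<omega>. \<Sum>i\<in>A. f i \<omega>) = (\<Sum>i\<in>A. walk_E q (f i))"
  by (intro Bochner_Integration.integral_sum bdd_rv_integrable)

lemma walk_E_const: "walk_E q (\<lambda>_. c) = c"
proof -
  interpret prob_space "walk_space q" by (rule prob_space_walk_space)
  show ?thesis by (simp add: prob_space)
qed

lemma walk_E_mono: "bdd_rv q f \<Longrightarrow> bdd_rv q g \<Longrightarrow> (\<And>\<omega>. f \<omega> \<le> g \<omega>) \<Longrightarrow> walk_E q f \<le> walk_E q g"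
  by (intro integral_mono bdd_rv_integrable)

section \<open>Means and second moments of the normalised pattern sums\<close>

context symm_walk
begin

lemma sum_p_le_1:
  assumes "finite A"
  shows "(\<Sum>w\<in>A. p k (w - z)) \<le> 1"
proof -
  have "(\<Sum>w\<in>A. p k (w - z)) = sum (p k) ((\<lambda>w. w - z) ` A)"
    by (subst sum.reindex) (auto intro: inj_onI)
  also have "\<dots> = measure (conv_pow q k) ((\<lambda>w. w - z) ` A)"
    by (rule measure_measure_pmf_finite[symmetric]) (use assms in simp)
  also have "\<dots> \<le> 1" by (rule measure_pmf.prob_le_1)
  finally show ?thesis .
qed

lemma chain_diff: "chain \<theta> gs (\<lambda>w. f w - f' w) z = chain \<theta> gs f z - chain \<theta> gs f' z"
  by (induction gs arbitrary: z) (auto simp: right_diff_distrib sum_subtractf)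

lemma chain_cmult: "chain \<theta> gs (\<lambda>w. c * f w) z = c * chain \<theta> gs f z"
  by (induction gs arbitrary: z) (auto simp: sum_distrib_left mult_ac)

lemma chain_sum: "chain \<theta> gs (\<lambda>w. \<Sum>i\<in>A. f i w) z = (\<Sum>i\<in>A. chain \<theta> gs (f i) z)"
proof (induction gs arbitrary: z)
  case (Cons g gs)
  show ?case by (simp add: Cons sum_distrib_left sum_distrib_right sum.swap[of _ A])
qed (simp add: sum_distrib_left)

text \<open>Biases are at most 1 and transition probabilities sum to at most 1, so every link of the
  chain is a contraction in the supremum norm.\<close>

lemma chain_abs_le:
  assumes \<theta>: "bias_on N \<theta>" and B: "0 \<le> B" "\<And>w. \<theta> w \<noteq> 0 \<Longrightarrow> \<bar>f w\<bar> \<le> B"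
  shows "\<bar>chain \<theta> gs f z\<bar> \<le> B"
proof (induction gs arbitrary: z)
  case Nil
  show ?case
  proof (cases "\<theta> z = 0")
    case False
    then have "\<bar>\<theta> z\<bar> * \<bar>f z\<bar> \<le> 1 * B" using bias_onD[OF \<theta>] B by (intro mult_mono) auto
    then show ?thesis by (simp add: abs_mult)
  qed (use B in simp)
next
  case (Cons g gs)
  have "\<bar>\<Sum>w | \<theta> w \<noteq> 0. p g (w - z) * chain \<theta> gs f w\<bar> \<le> (\<Sum>w | \<theta> w \<noteq> 0. p g (w - z) * B)"
    by (rule order_trans[OF sum_abs]) (auto simp: abs_mult intro!: sum_mono mult_left_mono Cons)
  also have "\<dots> = (\<Sum>w | \<theta> w \<noteq> 0. p g (w - z)) * B" by (simp add: sum_distrib_right)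
  also have "\<dots> \<le> 1 * B" by (intro mult_right_mono sum_p_le_1 bias_onD[OF \<theta>] B)
  finally have "\<bar>\<theta> z\<bar> * \<bar>\<Sum>w | \<theta> w \<noteq> 0. p g (w - z) * chain \<theta> gs f w\<bar> \<le> 1 * B"
    using bias_onD[OF \<theta>] by (intro mult_mono) auto
  then show ?case by (simp add: abs_mult)
qed

lemma chain_nonneg:
  assumes \<theta>: "bias_on N \<theta>" and "\<And>w. 0 \<le> f w"
  shows "0 \<le> chain \<theta> gs f z"
  by (induction gs arbitrary: z) (auto intro!: mult_nonneg_nonneg sum_nonneg simp: assms bias_onD[OF \<theta>])

abbreviation chain1 :: "(int \<Rightarrow> real) \<Rightarrow> nat list \<Rightarrow> int \<Rightarrow> real" where
  "chain1 \<theta> gs \<equiv> chain \<theta> gs (\<lambda>_. 1)"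

lemma chain1_bounds:
  assumes "bias_on N \<theta>"
  shows "0 \<le> chain1 \<theta> gs z" "chain1 \<theta> gs z \<le> 1"
  using chain_nonneg[OF assms, of "\<lambda>_. 1" gs z] chain_abs_le[OF assms, of 1 "\<lambda>_. 1" gs z] by auto

lemma sum_supp_le:
  assumes \<theta>: "bias_on N \<theta>" and B: "0 \<le> B" "\<And>w. \<theta> w \<noteq> 0 \<Longrightarrow> f w \<le> B"
  shows "(\<Sum>w | \<theta> w \<noteq> 0. f w) \<le> (2 * real N + 1) * B"
proof -
  have "(\<Sum>w | \<theta> w \<noteq> 0. f w) \<le> real (card {w. \<theta> w \<noteq> 0}) * B"
    by (rule sum_bounded_above) (use B in auto)
  also have "\<dots> \<le> (2 * real N + 1) * B"
    using bias_onD(5)[OF \<theta>] B by (intro mult_right_mono) auto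
  finally show ?thesis .
qed

lemma moment_bounds:
  assumes "bias_on N \<theta>"
  shows "0 \<le> moment \<theta> gs" "moment \<theta> gs \<le> 2 * real N + 1"
  unfolding moment_def using sum_supp_le[OF assms, of 1 "chain1 \<theta> gs"] chain1_bounds[OF assms]
  by (auto intro: sum_nonneg)

definition obs :: "nat list \<Rightarrow> nat \<Rightarrow> (nat \<Rightarrow> int) \<Rightarrow> real" where
  "obs gs m x = toss_prod (replicate m False @ word gs) x"

text \<open>The sum starts at time 1 because the toss at time 0 is not observed.\<close>

definition stat :: "nat list \<Rightarrow> nat \<Rightarrow> (nat \<Rightarrow> int) \<Rightarrow> real" where
  "stat gs n x = (\<Sum>m=1..n. obs gs m x) * (1 / gnorm n)"

lemma bdd_rv_obs: "bdd_rv q (\<lambda>\<omega>. obs gs m (coin \<theta> \<omega>))"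
  unfolding obs_def by (rule bdd_rv_toss_prod)

lemma bdd_rv_stat: "bdd_rv q (\<lambda>\<omega>. stat gs m (coin \<theta> \<omega>))"
  unfolding stat_def by (intro bdd_rv_intros bdd_rv_obs)

lemmas rv_intros = bdd_rv_intros bdd_rv_obs bdd_rv_stat

lemma obs_shift: "obs gs m x = toss_prod (word gs) (\<lambda>i. x (m + i))"
proof -
  have "toss_prod (replicate m False) x = 1" for x by (induction m arbitrary: x) auto
  then show ?thesis by (simp add: obs_def toss_prod_append)
qed

lemma obs_abs_le: "\<bar>obs gs m (coin \<theta> \<omega>)\<bar> \<le> 1"
  unfolding obs_def by (intro toss_prod_abs_le coin_abs)

context
  fixes gs :: "nat list"
  assumes gs: "\<And>g. g \<in> set gs \<Longrightarrow> g \<ge> 1"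
begin

lemma E_obs:
  assumes \<theta>: "bias_on N \<theta>"
  shows "walk_E q (\<lambda>\<omega>. obs gs m (coin \<theta> \<omega>)) = (\<Sum>z | \<theta> z \<noteq> 0. p m z * chain1 \<theta> gs z)"
  using pattern_mean_delayed_word[of \<theta> gs m] bias_onD[OF \<theta>] gs by (simp add: pattern_mean_def obs_def)

text \<open>Mean of a fresh pattern whose first toss comes \<open>k\<close> steps after the walk was
  at \<open>w\<close>.\<close>

definition return_mean :: "(int \<Rightarrow> real) \<Rightarrow> nat \<Rightarrow> int \<Rightarrow> real" where
  "return_mean \<theta> k w = (\<Sum>w' | \<theta> w' \<noteq> 0. p k (w' - w) * chain1 \<theta> gs w')"

definition pair_mean :: "(int \<Rightarrow> real) \<Rightarrow> nat \<Rightarrow> nat \<Rightarrow> real" where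
  "pair_mean \<theta> m k = (\<Sum>z | \<theta> z \<noteq> 0. p m z * chain \<theta> gs (return_mean \<theta> k) z)"

text \<open>Two disjoint patterns, the second starting \<open>k\<close> steps after the last toss of
  the first, form the single pattern \<open>gs @ k # gs\<close>, whose chain is then cut at the link
  \<open>k\<close>.\<close>

lemma E_obs_obs:
  assumes \<theta>: "bias_on N \<theta>" and k: "k \<ge> 1"
  shows "walk_E q (\<lambda>\<omega>. obs gs m (coin \<theta> \<omega>) * obs gs (m + sum_list gs + k) (coin \<theta> \<omega>)) = pair_mean \<theta> m k"
proof -
  have eq: "obs gs m x * obs gs (m + sum_list gs + k) x = obs (gs @ k # gs) m x" for x
  proof -
    have "toss_prod (replicate n False) x = 1" for n x by (induction n arbitrary: x) auto
    moreover have "length (word gs) + (k - 1) = sum_list gs + k" using k length_word[OF gs] by simp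
    ultimately show ?thesis
      by (simp add: obs_shift word_append toss_prod_append add.assoc)
        (simp add: add.assoc[symmetric])
  qed
  have "walk_E q (\<lambda>\<omega>. obs (gs @ k # gs) m (coin \<theta> \<omega>)) = (\<Sum>z | \<theta> z \<noteq> 0. p m z * chain1 \<theta> (gs @ k # gs) z)"
    using pattern_mean_delayed_word[of \<theta> "gs @ k # gs" m] bias_onD[OF \<theta>] gs k
    by (auto simp: pattern_mean_def obs_def)
  then show ?thesis
    unfolding eq chain_append pair_mean_def return_mean_def[abs_def] .
qed

lemma return_mean_nonneg: "bias_on N \<theta> \<Longrightarrow> 0 \<le> return_mean \<theta> k w"
  unfolding return_mean_def by (intro sum_nonneg mult_nonneg_nonneg chain1_bounds) auto

lemma pair_mean_nonneg: "bias_on N \<theta> \<Longrightarrow> 0 \<le> pair_mean \<theta> m k"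
  unfolding pair_mean_def
  by (intro sum_nonneg mult_nonneg_nonneg chain_nonneg return_mean_nonneg) auto

lemma sum_return_mean: "(\<Sum>k\<in>A. return_mean \<theta> k w) = (\<Sum>w' | \<theta> w' \<noteq> 0. (\<Sum>k\<in>A. p k (w' - w)) * chain1 \<theta> gs w')"
  unfolding return_mean_def by (subst sum.swap) (simp add: sum_distrib_right)

lemma sum_pair_mean: "(\<Sum>k\<in>A. pair_mean \<theta> m k) = (\<Sum>z | \<theta> z \<noteq> 0. p m z * chain \<theta> gs (\<lambda>w. \<Sum>k\<in>A. return_mean \<theta> k w) z)"
  unfolding pair_mean_def by (subst sum.swap) (simp add: chain_sum sum_distrib_left)

lemma sum_p_le_green: "(\<Sum>k=1..n. p k x) \<le> 2 * gnorm n"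
proof -
  have "(\<Sum>k=1..n. p k x) \<le> green n x"
    unfolding green_def by (rule sum_mono2) auto
  then show ?thesis using green_le[of n x] by simp
qed

text \<open>By linearity the mean is a sum over support sites of partial Green functions times
  chains, and each partial Green function is \<open>gnorm n\<close> up to a relative error. Dividing
  that error by \<open>K\<close>, a bound for the number of sites, makes the result uniform in
  \<theta>.\<close>

lemma E_stat_tendsto:
  assumes \<epsilon>: "0 < \<epsilon>"
  shows "\<exists>n0. \<forall>n\<ge>n0. \<forall>\<theta>. bias_on N \<theta> \<longrightarrow> \<bar>walk_E q (\<lambda>\<omega>. stat gs n (coin \<theta> \<omega>)) - moment \<theta> gs\<bar> \<le> \<epsilon>"
proof -
  define K where "K = 2 * real N + 1"
  have K: "0 < K" by (simp add: K_def)
  have "0 < \<epsilon> / K" using \<epsilon> K by simp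
  from green_ratio[OF this, of 0 N] obtain n0 where
    n0: "\<And>n x. n \<ge> n0 \<Longrightarrow> \<bar>x\<bar> \<le> int N \<Longrightarrow> \<bar>(\<Sum>m=1..n. p m x) - gnorm n\<bar> \<le> \<epsilon> / K * gnorm n"
    by (metis diff_zero)
  show ?thesis
  proof (intro exI[of _ n0] allI impI)
    fix n \<theta> assume n: "n0 \<le> n" and \<theta>: "bias_on N \<theta>"
    have g: "0 < gnorm n" using gnorm_ge_1[of n] by linarith
    have "walk_E q (\<lambda>\<omega>. stat gs n (coin \<theta> \<omega>)) = (\<Sum>m=1..n. walk_E q (\<lambda>\<omega>. obs gs m (coin \<theta> \<omega>))) * (1 / gnorm n)"
      unfolding stat_def by (subst walk_E_sum[symmetric]) (auto intro: rv_intros)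
    also have "(\<Sum>m=1..n. walk_E q (\<lambda>\<omega>. obs gs m (coin \<theta> \<omega>)))
        = (\<Sum>z | \<theta> z \<noteq> 0. (\<Sum>m=1..n. p m z) * chain1 \<theta> gs z)"
      unfolding E_obs[OF \<theta>] by (subst sum.swap) (simp add: sum_distrib_right)
    finally have "walk_E q (\<lambda>\<omega>. stat gs n (coin \<theta> \<omega>)) - moment \<theta> gs
        = (\<Sum>z | \<theta> z \<noteq> 0. ((\<Sum>m=1..n. p m z) - gnorm n) * chain1 \<theta> gs z) * (1 / gnorm n)"
      using g by (simp add: moment_def left_diff_distrib sum_subtractf sum_distrib_left[symmetric] field_simps)
    also have "\<bar>\<dots>\<bar> \<le> (K * (\<epsilon> / K * gnorm n)) * (1 / gnorm n)"
      unfolding abs_mult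
    proof (intro mult_mono)
      show "\<bar>\<Sum>z | \<theta> z \<noteq> 0. ((\<Sum>m=1..n. p m z) - gnorm n) * chain1 \<theta> gs z\<bar> \<le> K * (\<epsilon> / K * gnorm n)"
        unfolding K_def
      proof (rule order_trans[OF sum_abs], rule sum_supp_le[OF \<theta>])
        fix z assume "\<theta> z \<noteq> 0"
        then have "\<bar>(\<Sum>m=1..n. p m z) - gnorm n\<bar> * chain1 \<theta> gs z \<le> (\<epsilon> / K * gnorm n) * 1"
          by (intro mult_mono n0[OF n] bias_onD[OF \<theta>] chain1_bounds[OF \<theta>]) (use \<epsilon> K g in auto)
        then show "\<bar>((\<Sum>m=1..n. p m z) - gnorm n) * chain1 \<theta> gs z\<bar> \<le> \<epsilon> / (2 * real N + 1) * gnorm n"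
          using chain1_bounds[OF \<theta>] by (simp add: abs_mult K_def)
      qed (use \<epsilon> g in auto)
    qed (use \<epsilon> K g in auto)
    also have "\<dots> = \<epsilon>" using K g by simp
    finally show "\<bar>walk_E q (\<lambda>\<omega>. stat gs n (coin \<theta> \<omega>)) - moment \<theta> gs\<bar> \<le> \<epsilon>" .
  qed
qed

text \<open>Given the first pattern, the expected sum of the later ones is \<open>gnorm n\<close>
  times the moment up to a small relative error, wherever the walk happens to be. So the centred
  statistic is nearly orthogonal to an observation at a fixed time.\<close>

lemma E_obs_stat_tendsto:
  assumes \<epsilon>: "0 < \<epsilon>"
  shows "\<exists>n0. \<forall>n\<ge>n0. \<forall>\<theta>. bias_on N \<theta> \<longrightarrow>
    \<bar>walk_E q (\<lambda>\<omega>. obs gs m (coin \<theta> \<omega>) * (stat gs n (coin \<theta> \<omega>) - moment \<theta> gs))\<bar> \<le> \<epsilon>"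
proof -
  define K where "K = 2 * real N + 1"
  \<comment> \<open>The time of the last toss in the observation at \<open>m\<close>. The
    \<open>c\<close> observations started up to then may overlap with it or precede it; they are
    bounded trivially.\<close>
  define c where "c = m + sum_list gs"
  have K: "0 < K" by (simp add: K_def)
  define \<eta> where "\<eta> = \<epsilon> / 2 / K"
  have \<eta>: "0 < \<eta>" using \<epsilon> K by (simp add: \<eta>_def)
  \<comment> \<open>Two sites of the window differ by at most \<open>2 * N\<close>, and
    \<open>n - c\<close> later starting times remain.\<close>
  from green_ratio[OF \<eta>, of c "2 * N"] obtain n1 where n1: "n1 \<ge> c"
    "\<And>n x. n \<ge> n1 \<Longrightarrow> \<bar>x\<bar> \<le> int (2 * N) \<Longrightarrow> \<bar>(\<Sum>m=1..n - c. p m x) - gnorm n\<bar> \<le> \<eta> * gnorm n"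
    by metis
  have "\<forall>\<^sub>F n in sequentially. c * (2 / \<epsilon>) \<le> gnorm n"
    using gnorm_at_top by (simp add: filterlim_at_top)
  then obtain n2 where n2: "\<And>n. n \<ge> n2 \<Longrightarrow> c * (2 / \<epsilon>) \<le> gnorm n"
    by (auto simp: eventually_sequentially)
  show ?thesis
  proof (intro exI[of _ "max n1 n2"] allI impI)
    fix n \<theta> assume n: "max n1 n2 \<le> n" and \<theta>: "bias_on N \<theta>"
    have g: "0 < gnorm n" using gnorm_ge_1[of n] by linarith
    let ?M = "moment \<theta> gs"
    let ?Y = "\<lambda>m \<omega>. obs gs m (coin \<theta> \<omega>)"
    define e where "e = (\<lambda>m'. walk_E q (\<lambda>\<omega>. ?Y m \<omega> * ?Y m' \<omega>))"
    have e_le: "\<bar>e m'\<bar> \<le> 1" for m'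
    proof -
      have "\<bar>e m'\<bar> \<le> walk_E q (\<lambda>\<omega>. \<bar>?Y m \<omega> * ?Y m' \<omega>\<bar>)" unfolding e_def by (rule integral_abs_bound)
      also have "\<dots> \<le> walk_E q (\<lambda>\<omega>. 1)"
        by (intro integral_mono integrable_abs bdd_rv_integrable rv_intros)
           (auto simp: abs_mult intro!: mult_le_one obs_abs_le)
      finally show ?thesis unfolding walk_E_const .
    qed
    \<comment> \<open>\<open>G w\<close> is the expected sum of the later observations, seen from
      the site \<open>w\<close> of the last toss of the first pattern.\<close>
    define G where "G = (\<lambda>w. \<Sum>k=1..n - c. return_mean \<theta> k w)"
    have G: "\<bar>G w - gnorm n * ?M\<bar> \<le> K * (\<eta> * gnorm n)" if w: "\<theta> w \<noteq> 0" for w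
    proof -
      have "G w - gnorm n * ?M = (\<Sum>w' | \<theta> w' \<noteq> 0. ((\<Sum>k=1..n - c. p k (w' - w)) - gnorm n) * chain1 \<theta> gs w')"
        by (simp add: G_def sum_return_mean moment_def left_diff_distrib sum_subtractf sum_distrib_left)
      also have "\<bar>\<dots>\<bar> \<le> K * (\<eta> * gnorm n)"
        unfolding K_def
      proof (rule order_trans[OF sum_abs], rule sum_supp_le[OF \<theta>])
        fix w' assume w': "\<theta> w' \<noteq> 0"
        have "\<bar>w' - w\<bar> \<le> int (2 * N)" using bias_onD(3)[OF \<theta> w] bias_onD(3)[OF \<theta> w'] by simp
        then have "\<bar>(\<Sum>k=1..n - c. p k (w' - w)) - gnorm n\<bar> * chain1 \<theta> gs w' \<le> (\<eta> * gnorm n) * 1"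
          by (intro mult_mono n1 chain1_bounds[OF \<theta>]) (use \<eta> n g in auto)
        then show "\<bar>((\<Sum>k=1..n - c. p k (w' - w)) - gnorm n) * chain1 \<theta> gs w'\<bar> \<le> \<eta> * gnorm n"
          using chain1_bounds[OF \<theta>] by (simp add: abs_mult)
      qed (use \<eta> g in auto)
      finally show ?thesis .
    qed
    have far: "(\<Sum>k=1..n - c. e (c + k)) = (\<Sum>z | \<theta> z \<noteq> 0. p m z * chain \<theta> gs G z)"
    proof -
      have "(\<Sum>k=1..n - c. e (c + k)) = (\<Sum>k=1..n - c. pair_mean \<theta> m k)"
        by (rule sum.cong) (auto simp: e_def c_def E_obs_obs[OF \<theta>])
      then show ?thesis by (simp add: sum_pair_mean G_def)
    qed
    have split: "(\<Sum>m'=1..n. e m') = (\<Sum>m'=1..c. e m') + (\<Sum>k=1..n - c. e (c + k))"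
    proof -
      have "{1..n} = {1..c} \<union> {c + 1..n}" using n n1(1) by auto
      then have "(\<Sum>m'=1..n. e m') = (\<Sum>m'=1..c. e m') + (\<Sum>m'=c+1..n. e m')"
        by (simp add: sum.union_disjoint)
      also have "(\<Sum>m'=c+1..n. e m') = (\<Sum>k=1..n - c. e (c + k))"
        by (rule sum.reindex_bij_witness[where i = "\<lambda>k. c + k" and j = "\<lambda>m'. m' - c"]) auto
      finally show ?thesis .
    qed
    have EY: "walk_E q (?Y m) = (\<Sum>z | \<theta> z \<noteq> 0. p m z * chain1 \<theta> gs z)" by (rule E_obs[OF \<theta>])
    have diff: "(\<Sum>k=1..n - c. e (c + k)) - gnorm n * ?M * walk_E q (?Y m)
        = (\<Sum>z | \<theta> z \<noteq> 0. p m z * chain \<theta> gs (\<lambda>w. G w - (gnorm n * ?M) * 1) z)"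
      unfolding far EY chain_diff chain_cmult
      by (simp add: right_diff_distrib sum_subtractf sum_distrib_left mult_ac)
    have "\<bar>(\<Sum>k=1..n - c. e (c + k)) - gnorm n * ?M * walk_E q (?Y m)\<bar>
        \<le> (\<Sum>z | \<theta> z \<noteq> 0. p m z * (K * (\<eta> * gnorm n)))"
      unfolding diff
    proof (rule order_trans[OF sum_abs], rule sum_mono)
      fix z
      have "\<bar>chain \<theta> gs (\<lambda>w. G w - (gnorm n * ?M) * 1) z\<bar> \<le> K * (\<eta> * gnorm n)"
        by (rule chain_abs_le[OF \<theta>]) (use K \<eta> g G in auto)
      then show "\<bar>p m z * chain \<theta> gs (\<lambda>w. G w - (gnorm n * ?M) * 1) z\<bar> \<le> p m z * (K * (\<eta> * gnorm n))"
        by (simp add: abs_mult mult_left_mono)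
    qed
    also have "\<dots> = (\<Sum>z | \<theta> z \<noteq> 0. p m (z - 0)) * (K * (\<eta> * gnorm n))"
      by (simp add: sum_distrib_right)
    also have "\<dots> \<le> 1 * (K * (\<eta> * gnorm n))"
      by (intro mult_right_mono sum_p_le_1 bias_onD[OF \<theta>]) (use K \<eta> g in auto)
    also have "\<dots> = \<epsilon> / 2 * gnorm n" using K by (simp add: \<eta>_def)
    finally have d1: "\<bar>(\<Sum>k=1..n - c. e (c + k)) - gnorm n * ?M * walk_E q (?Y m)\<bar> \<le> \<epsilon> / 2 * gnorm n" .
    have "\<bar>\<Sum>m'=1..c. e m'\<bar> \<le> (\<Sum>m'=1..c. 1)"
      by (rule order_trans[OF sum_abs]) (rule sum_mono, rule e_le)
    also have "\<dots> \<le> \<epsilon> / 2 * gnorm n" using n2[of n] n \<epsilon> by (simp add: field_simps)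
    finally have d2: "\<bar>(\<Sum>m'=1..n. e m') - gnorm n * ?M * walk_E q (?Y m)\<bar> \<le> \<epsilon> * gnorm n"
      using d1 unfolding split by linarith
    have "walk_E q (\<lambda>\<omega>. ?Y m \<omega> * (stat gs n (coin \<theta> \<omega>) - ?M))
        = walk_E q (\<lambda>\<omega>. (\<Sum>m'=1..n. ?Y m \<omega> * ?Y m' \<omega>) * (1 / gnorm n) - ?Y m \<omega> * ?M)"
      by (simp add: stat_def right_diff_distrib sum_distrib_left)
    also have "\<dots> = walk_E q (\<lambda>\<omega>. \<Sum>m'=1..n. ?Y m \<omega> * ?Y m' \<omega>) * (1 / gnorm n) - walk_E q (?Y m) * ?M"
      by (subst walk_E_diff) (intro rv_intros | simp)+
    also have "walk_E q (\<lambda>\<omega>. \<Sum>m'=1..n. ?Y m \<omega> * ?Y m' \<omega>) = (\<Sum>m'=1..n. e m')"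
      unfolding e_def by (rule walk_E_sum) (intro rv_intros)
    also have "(\<Sum>m'=1..n. e m') * (1 / gnorm n) - walk_E q (?Y m) * ?M
        = ((\<Sum>m'=1..n. e m') - gnorm n * ?M * walk_E q (?Y m)) / gnorm n"
      using g by (simp add: field_simps)
    also have "\<bar>\<dots>\<bar> \<le> \<epsilon>" using d2 g by (simp add: divide_le_eq)
    finally show "\<bar>walk_E q (\<lambda>\<omega>. ?Y m \<omega> * (stat gs n (coin \<theta> \<omega>) - ?M))\<bar> \<le> \<epsilon>" .
  qed
qed

text \<open>Pairs of overlapping patterns are bounded by 1 and number order \<open>n\<close>, which
  \<open>le_gnorm_square\<close> turns into order \<open>(gnorm n)\<^sup>2\<close>. For the other
  pairs the chain is cut between the patterns, and summing over both times gives a product of two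
  Green functions.\<close>

lemma E_stat_square_bounded:
  "\<exists>C. \<forall>n \<theta>. bias_on N \<theta> \<longrightarrow> walk_E q (\<lambda>\<omega>. (stat gs n (coin \<theta> \<omega>))\<^sup>2) \<le> C"
proof -
  define K where "K = 2 * real N + 1"
  define l where "l = sum_list gs"
  have K: "0 < K" by (simp add: K_def)
  obtain C0 where C0: "0 < C0" "\<And>n. real n \<le> C0 * (gnorm n)\<^sup>2" using le_gnorm_square by blast
  show ?thesis
  proof (intro exI[of _ "2 * ((real l + 1) * C0 + (K * 2) * (K * 2))"] allI impI)
    fix n \<theta> assume \<theta>: "bias_on N \<theta>"
    have g: "0 < gnorm n" using gnorm_ge_1[of n] by linarith
    let ?Y = "\<lambda>m \<omega>. obs gs m (coin \<theta> \<omega>)"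
    define e where "e = (\<lambda>m m'. walk_E q (\<lambda>\<omega>. ?Y m \<omega> * ?Y m' \<omega>))"
    have e_sym: "e m m' = e m' m" for m m' by (simp add: e_def mult.commute)
    have e_le: "e m m' \<le> 1" for m m'
    proof -
      have "e m m' \<le> walk_E q (\<lambda>\<omega>. 1)"
        unfolding e_def
      proof (intro walk_E_mono rv_intros)
        fix \<omega>
        have "\<bar>?Y m \<omega> * ?Y m' \<omega>\<bar> \<le> 1" unfolding abs_mult by (intro mult_le_one obs_abs_le) auto
        then show "?Y m \<omega> * ?Y m' \<omega> \<le> 1" by linarith
      qed
      then show ?thesis unfolding walk_E_const .
    qed
    \<comment> \<open>A majorant for the ordered pairs \<open>m \<le> m'\<close> only, so that
      \<open>e m m'\<close> is at most \<open>u m m' + u m' m\<close>; counting the diagonal twice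
      is harmless.\<close>
    define u where "u = (\<lambda>m m'. if m \<le> m' then (if m' \<le> m + l then 1 else pair_mean \<theta> m (m' - m - l)) else 0)"
    have u0: "0 \<le> u m m'" for m m' using pair_mean_nonneg[OF \<theta>] by (simp add: u_def)
    have eu1: "e m m' \<le> u m m'" if "m \<le> m'" for m m'
    proof (cases "m' \<le> m + l")
      case False
      then have "m' = m + l + (m' - m - l)" "m' - m - l \<ge> 1" by auto
      then have "e m m' = pair_mean \<theta> m (m' - m - l)"
        unfolding e_def l_def using E_obs_obs[OF \<theta>, of "m' - m - sum_list gs" m] by metis
      then show ?thesis using that False by (simp add: u_def)
    qed (use that e_le in \<open>simp add: u_def\<close>)
    have eu: "e m m' \<le> u m m' + u m' m" for m m'
      using eu1[of m m'] eu1[of m' m] u0[of m m'] u0[of m' m] e_sym[of m m'] by (cases "m \<le> m'") auto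
    have row: "(\<Sum>m'=1..n. u m m') \<le> (real l + 1) + (\<Sum>z | \<theta> z \<noteq> 0. p m z) * (K * (2 * gnorm n))" if m: "m \<in> {1..n}" for m
    proof -
      have "(\<Sum>m'=1..n. u m m') = (\<Sum>m'\<in>{1..n} \<inter> {m..m + l}. 1) + (\<Sum>m'\<in>{m + l + 1..n}. pair_mean \<theta> m (m' - m - l))"
      proof -
        have "(\<Sum>m'=1..n. u m m') = (\<Sum>m'\<in>({1..n} \<inter> {m..m + l}) \<union> {m + l + 1..n}. u m m')"
          by (rule sum.mono_neutral_right) (use m in \<open>auto simp: u_def\<close>)
        also have "\<dots> = (\<Sum>m'\<in>{1..n} \<inter> {m..m + l}. u m m') + (\<Sum>m'\<in>{m + l + 1..n}. u m m')"
          by (rule sum.union_disjoint) auto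
        also have "(\<Sum>m'\<in>{1..n} \<inter> {m..m + l}. u m m') = (\<Sum>m'\<in>{1..n} \<inter> {m..m + l}. 1)"
          by (rule sum.cong) (auto simp: u_def)
        also have "(\<Sum>m'\<in>{m + l + 1..n}. u m m') = (\<Sum>m'\<in>{m + l + 1..n}. pair_mean \<theta> m (m' - m - l))"
          by (rule sum.cong) (auto simp: u_def)
        finally show ?thesis .
      qed
      also have "(\<Sum>m'\<in>{1..n} \<inter> {m..m + l}. 1) \<le> real l + 1"
        using card_mono[of "{m..m + l}" "{1..n} \<inter> {m..m + l}"] by simp
      also have "(\<Sum>m'\<in>{m + l + 1..n}. pair_mean \<theta> m (m' - m - l)) = (\<Sum>k\<in>{1..n - (m + l)}. pair_mean \<theta> m k)"
        by (rule sum.reindex_bij_witness[where i = "\<lambda>k. m + l + k" and j = "\<lambda>m'. m' - m - l"]) auto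
      also have "\<dots> \<le> (\<Sum>k=1..n. pair_mean \<theta> m k)"
        by (rule sum_mono2) (auto intro: pair_mean_nonneg[OF \<theta>])
      also have "\<dots> = (\<Sum>z | \<theta> z \<noteq> 0. p m z * chain \<theta> gs (\<lambda>w. \<Sum>k=1..n. return_mean \<theta> k w) z)"
        by (rule sum_pair_mean)
      also have "\<dots> \<le> (\<Sum>z | \<theta> z \<noteq> 0. p m z * (K * (2 * gnorm n)))"
      proof (rule sum_mono, rule mult_left_mono)
        fix z
        have "\<bar>\<Sum>k=1..n. return_mean \<theta> k w\<bar> \<le> K * (2 * gnorm n)" for w
        proof -
          have "(\<Sum>k=1..n. return_mean \<theta> k w) \<le> K * (2 * gnorm n)"
            unfolding sum_return_mean K_def
          proof (rule sum_supp_le[OF \<theta>])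
            fix w'
            have "(\<Sum>k=1..n. p k (w' - w)) * chain1 \<theta> gs w' \<le> 2 * gnorm n * 1"
              by (intro mult_mono sum_p_le_green chain1_bounds[OF \<theta>]) (use g in auto)
            then show "(\<Sum>k=1..n. p k (w' - w)) * chain1 \<theta> gs w' \<le> 2 * gnorm n" by simp
          qed (use g in auto)
          moreover have "0 \<le> (\<Sum>k=1..n. return_mean \<theta> k w)"
            by (intro sum_nonneg return_mean_nonneg[OF \<theta>])
          ultimately show ?thesis by simp
        qed
        then have "\<bar>chain \<theta> gs (\<lambda>w. \<Sum>k=1..n. return_mean \<theta> k w) z\<bar> \<le> K * (2 * gnorm n)"
          by (intro chain_abs_le[OF \<theta>]) (use K g in auto)
        then show "chain \<theta> gs (\<lambda>w. \<Sum>k=1..n. return_mean \<theta> k w) z \<le> K * (2 * gnorm n)" by linarith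
      qed simp
      finally show ?thesis by (simp add: sum_distrib_right)
    qed
    have "walk_E q (\<lambda>\<omega>. (\<Sum>m=1..n. ?Y m \<omega>)\<^sup>2) = (\<Sum>m=1..n. \<Sum>m'=1..n. e m m')"
      unfolding e_def power2_eq_square sum_product
      by (subst walk_E_sum, intro rv_intros, rule sum.cong[OF refl], subst walk_E_sum) (auto intro: rv_intros)
    also have "\<dots> \<le> (\<Sum>m=1..n. \<Sum>m'=1..n. u m m' + u m' m)"
      by (intro sum_mono eu)
    also have "\<dots> = 2 * (\<Sum>m=1..n. \<Sum>m'=1..n. u m m')"
      using sum.swap[of "\<lambda>m m'. u m' m" "{1..n}" "{1..n}"] by (simp add: sum.distrib)
    also have "\<dots> \<le> 2 * (\<Sum>m=1..n. (real l + 1) + (\<Sum>z | \<theta> z \<noteq> 0. p m z) * (K * (2 * gnorm n)))"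
      by (intro mult_left_mono sum_mono row) auto
    also have "\<dots> = 2 * ((real l + 1) * n + (\<Sum>z | \<theta> z \<noteq> 0. \<Sum>m=1..n. p m z) * (K * (2 * gnorm n)))"
      unfolding sum.distrib sum_distrib_right[symmetric] sum.swap[of "\<lambda>m z. p m z" "{z. \<theta> z \<noteq> 0}" "{1..n}"] by (simp add: algebra_simps)
    also have "\<dots> \<le> 2 * ((real l + 1) * (C0 * (gnorm n)\<^sup>2) + (K * (2 * gnorm n)) * (K * (2 * gnorm n)))"
      unfolding K_def
      by (intro mult_left_mono add_mono mult_right_mono C0 sum_supp_le[OF \<theta>] sum_p_le_green) (use g in auto)
    also have "\<dots> = 2 * ((real l + 1) * C0 + (K * 2) * (K * 2)) * (gnorm n)\<^sup>2"
      by (simp add: power2_eq_square algebra_simps)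
    finally have *: "walk_E q (\<lambda>\<omega>. (\<Sum>m=1..n. ?Y m \<omega>)\<^sup>2) \<le> 2 * ((real l + 1) * C0 + (K * 2) * (K * 2)) * (gnorm n)\<^sup>2" .
    have "walk_E q (\<lambda>\<omega>. (stat gs n (coin \<theta> \<omega>))\<^sup>2) = walk_E q (\<lambda>\<omega>. (\<Sum>m=1..n. ?Y m \<omega>)\<^sup>2) * (1 / gnorm n)\<^sup>2"
      by (simp only: stat_def power_mult_distrib integral_mult_left_zero)
    also have "\<dots> \<le> 2 * ((real l + 1) * C0 + (K * 2) * (K * 2)) * (gnorm n)\<^sup>2 * (1 / gnorm n)\<^sup>2"
      by (rule mult_right_mono[OF *]) simp
    also have "\<dots> = 2 * ((real l + 1) * C0 + (K * 2) * (K * 2))"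
      using g by (simp add: power_divide)
    finally show "walk_E q (\<lambda>\<omega>. (stat gs n (coin \<theta> \<omega>))\<^sup>2) \<le> 2 * ((real l + 1) * C0 + (K * 2) * (K * 2))" .
  qed
qed

end

end

lemma walk_E_sum_list:
  "(\<And>i. i \<in> set xs \<Longrightarrow> bdd_rv q (f i)) \<Longrightarrow> walk_E q (\<lambda>\<omega>. \<Sum>i\<leftarrow>xs. f i \<omega>) = (\<Sum>i\<leftarrow>xs. walk_E q (f i))"
proof (induction xs)
  case (Cons a xs)
  have "walk_E q (\<lambda>\<omega>. f a \<omega> + (\<Sum>i\<leftarrow>xs. f i \<omega>)) = walk_E q (f a) + walk_E q (\<lambda>\<omega>. \<Sum>i\<leftarrow>xs. f i \<omega>)"
    by (rule walk_E_add) (use Cons.prems in \<open>auto intro: bdd_rv_sum_list\<close>)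
  then show ?case using Cons by simp
qed simp

section \<open>Averaging along sparse times\<close>

context symm_walk
begin

context
  fixes gs :: "nat list"
  assumes gs: "\<And>g. g \<in> set gs \<Longrightarrow> g \<ge> 1"
begin

text \<open>For fixed \<open>i\<close> the earlier statistic is a finite combination of
  observations, each nearly orthogonal to the centred statistic at \<open>n\<close>; its centring
  constant is handled by the convergence of the means.\<close>

lemma E_stat_stat_tendsto:
  assumes \<eta>: "0 < \<eta>"
  shows "\<exists>n0. \<forall>n\<ge>n0. \<forall>\<theta>. bias_on N \<theta> \<longrightarrow>
    \<bar>walk_E q (\<lambda>\<omega>. (stat gs i (coin \<theta> \<omega>) - moment \<theta> gs) * (stat gs n (coin \<theta> \<omega>) - moment \<theta> gs))\<bar> \<le> \<eta>"
proof -
  \<comment> \<open>Half of the error is shared by the \<open>i\<close> observations; the other half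
    goes to the constant term, a moment of size at most \<open>K\<close>.\<close>
  define \<eta>1 where "\<eta>1 = \<eta> / 2 / (real i + 1)"
  define K where "K = 2 * real N + 1"
  have K: "0 < K" by (simp add: K_def)
  define \<eta>2 where "\<eta>2 = \<eta> / 2 / K"
  have pos: "0 < \<eta>1" "0 < \<eta>2" using \<eta> K by (simp_all add: \<eta>1_def \<eta>2_def)
  have "\<forall>m. \<exists>n0. \<forall>n\<ge>n0. \<forall>\<theta>. bias_on N \<theta> \<longrightarrow>
    \<bar>walk_E q (\<lambda>\<omega>. obs gs m (coin \<theta> \<omega>) * (stat gs n (coin \<theta> \<omega>) - moment \<theta> gs))\<bar> \<le> \<eta>1"
    by (rule allI, rule E_obs_stat_tendsto[OF gs pos(1)])
  from choice[OF this] obtain f where f: "\<And>m n \<theta>. n \<ge> f m \<Longrightarrow> bias_on N \<theta> \<Longrightarrow>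
    \<bar>walk_E q (\<lambda>\<omega>. obs gs m (coin \<theta> \<omega>) * (stat gs n (coin \<theta> \<omega>) - moment \<theta> gs))\<bar> \<le> \<eta>1"
    by blast
  obtain n1 where n1: "\<And>n \<theta>. n \<ge> n1 \<Longrightarrow> bias_on N \<theta> \<Longrightarrow> \<bar>walk_E q (\<lambda>\<omega>. stat gs n (coin \<theta> \<omega>)) - moment \<theta> gs\<bar> \<le> \<eta>2"
    using E_stat_tendsto[OF gs pos(2)] by blast
  show ?thesis
  proof (intro exI[of _ "n1 + (\<Sum>m=1..i. f m)"] allI impI)
    fix n \<theta> assume n: "n1 + (\<Sum>m=1..i. f m) \<le> n" and \<theta>: "bias_on N \<theta>"
    have fn: "f m \<le> n" if "m \<in> {1..i}" for m
      using member_le_sum[OF that, of f] n by simp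
    let ?M = "moment \<theta> gs"
    define d where "d = (\<lambda>\<omega>. stat gs n (coin \<theta> \<omega>) - ?M)"
    have rvd: "bdd_rv q d" unfolding d_def by (intro rv_intros)
    have gi: "0 < 1 / gnorm i" "1 / gnorm i \<le> 1" using gnorm_ge_1[of i] by auto
    have "walk_E q (\<lambda>\<omega>. (stat gs i (coin \<theta> \<omega>) - ?M) * d \<omega>)
        = walk_E q (\<lambda>\<omega>. (\<Sum>m=1..i. obs gs m (coin \<theta> \<omega>) * d \<omega>) * (1 / gnorm i) - d \<omega> * ?M)"
    proof -
      have "(stat gs i x - ?M) * D = (\<Sum>m=1..i. obs gs m x * D) * (1 / gnorm i) - D * ?M" for x D
        unfolding stat_def sum_distrib_right[symmetric] by (simp only: algebra_simps)
      then show ?thesis by (simp only:)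
    qed
    also have "\<dots> = walk_E q (\<lambda>\<omega>. (\<Sum>m=1..i. obs gs m (coin \<theta> \<omega>) * d \<omega>)) * (1 / gnorm i) - walk_E q d * ?M"
      by (subst walk_E_diff) (intro rv_intros rvd | simp)+
    also have "walk_E q (\<lambda>\<omega>. (\<Sum>m=1..i. obs gs m (coin \<theta> \<omega>) * d \<omega>)) = (\<Sum>m=1..i. walk_E q (\<lambda>\<omega>. obs gs m (coin \<theta> \<omega>) * d \<omega>))"
      by (rule walk_E_sum) (intro rv_intros rvd)
    also have "walk_E q d = walk_E q (\<lambda>\<omega>. stat gs n (coin \<theta> \<omega>)) - ?M"
      unfolding d_def by (subst walk_E_diff) (auto intro: rv_intros simp: walk_E_const simp del: lebesgue_integral_const)
    finally have eq: "walk_E q (\<lambda>\<omega>. (stat gs i (coin \<theta> \<omega>) - ?M) * d \<omega>)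
      = (\<Sum>m=1..i. walk_E q (\<lambda>\<omega>. obs gs m (coin \<theta> \<omega>) * d \<omega>)) * (1 / gnorm i) - (walk_E q (\<lambda>\<omega>. stat gs n (coin \<theta> \<omega>)) - ?M) * ?M" .
    have "\<bar>\<Sum>m=1..i. walk_E q (\<lambda>\<omega>. obs gs m (coin \<theta> \<omega>) * d \<omega>)\<bar> \<le> (\<Sum>m=1..i. \<eta>1)"
      unfolding d_def by (rule order_trans[OF sum_abs]) (intro sum_mono f fn \<theta>)
    also have "\<dots> \<le> \<eta> / 2" using \<eta> by (simp add: \<eta>1_def field_simps)
    finally have "\<bar>\<Sum>m=1..i. walk_E q (\<lambda>\<omega>. obs gs m (coin \<theta> \<omega>) * d \<omega>)\<bar> * (1 / gnorm i) \<le> \<eta> / 2 * 1"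
      by (intro mult_mono) (use gi in auto)
    then have 1: "\<bar>(\<Sum>m=1..i. walk_E q (\<lambda>\<omega>. obs gs m (coin \<theta> \<omega>) * d \<omega>)) * (1 / gnorm i)\<bar> \<le> \<eta> / 2"
      by (simp only: abs_mult abs_of_pos[OF gi(1)])
    have "\<bar>walk_E q (\<lambda>\<omega>. stat gs n (coin \<theta> \<omega>)) - ?M\<bar> * ?M \<le> \<eta>2 * K"
      unfolding K_def using n pos by (intro mult_mono n1 \<theta> moment_bounds[OF \<theta>]) auto
    also have "\<dots> = \<eta> / 2" using K by (simp add: \<eta>2_def)
    finally have 2: "\<bar>(walk_E q (\<lambda>\<omega>. stat gs n (coin \<theta> \<omega>)) - ?M) * ?M\<bar> \<le> \<eta> / 2"
      using moment_bounds[OF \<theta>] by (simp add: abs_mult)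
    show "\<bar>walk_E q (\<lambda>\<omega>. (stat gs i (coin \<theta> \<omega>) - ?M) * (stat gs n (coin \<theta> \<omega>) - ?M))\<bar> \<le> \<eta>"
      using eq 1 2 unfolding d_def by linarith
  qed
qed

lemma E_stat_centred_square_bounded:
  "\<exists>C\<ge>0. \<forall>n \<theta>. bias_on N \<theta> \<longrightarrow> walk_E q (\<lambda>\<omega>. (stat gs n (coin \<theta> \<omega>) - moment \<theta> gs)\<^sup>2) \<le> C"
proof -
  obtain C where C: "\<And>n \<theta>. bias_on N \<theta> \<Longrightarrow> walk_E q (\<lambda>\<omega>. (stat gs n (coin \<theta> \<omega>))\<^sup>2) \<le> C"
    using E_stat_square_bounded[OF gs] by blast
  define K where "K = 2 * real N + 1"
  have "walk_E q (\<lambda>\<omega>. (stat gs n (coin \<theta> \<omega>) - moment \<theta> gs)\<^sup>2) \<le> 2 * \<bar>C\<bar> + 2 * K\<^sup>2"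
    if \<theta>: "bias_on N \<theta>" for n \<theta>
  proof -
    let ?s = "\<lambda>\<omega>. stat gs n (coin \<theta> \<omega>)" and ?M = "moment \<theta> gs"
    have "walk_E q (\<lambda>\<omega>. (?s \<omega> - ?M)\<^sup>2) \<le> walk_E q (\<lambda>\<omega>. 2 * (?s \<omega>)\<^sup>2 + 2 * K\<^sup>2)"
    proof (intro walk_E_mono rv_intros)
      fix \<omega>
      have "?M\<^sup>2 \<le> K\<^sup>2" using moment_bounds[OF \<theta>] by (intro power_mono) (auto simp: K_def)
      moreover have "(?s \<omega> - ?M)\<^sup>2 \<le> 2 * (?s \<omega>)\<^sup>2 + 2 * ?M\<^sup>2"
        using zero_le_power2[of "?s \<omega> + ?M"] by (simp add: power2_sum power2_diff)
      ultimately show "(?s \<omega> - ?M)\<^sup>2 \<le> 2 * (?s \<omega>)\<^sup>2 + 2 * K\<^sup>2" by linarith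
    qed
    also have "\<dots> = 2 * walk_E q (\<lambda>\<omega>. (?s \<omega>)\<^sup>2) + 2 * K\<^sup>2"
      by (subst walk_E_add) (auto intro!: rv_intros simp: walk_E_const simp del: lebesgue_integral_const)
    also have "\<dots> \<le> 2 * \<bar>C\<bar> + 2 * K\<^sup>2" using C[OF \<theta>, of n] by linarith
    finally show ?thesis .
  qed
  then show ?thesis by (intro exI[of _ "2 * \<bar>C\<bar> + 2 * K\<^sup>2"]) auto
qed

text \<open>Each new time is chosen so late that its covariances with the earlier ones are
  negligible; the second moment of the sum then grows linearly, not quadratically, in the number of
  times.\<close>

lemma almost_uncorrelated_times:
  assumes C: "\<And>n \<theta>. bias_on N \<theta> \<Longrightarrow> walk_E q (\<lambda>\<omega>. (stat gs n (coin \<theta> \<omega>) - moment \<theta> gs)\<^sup>2) \<le> C"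
  shows "\<exists>ns. length ns = L \<and> (\<forall>\<theta>. bias_on N \<theta> \<longrightarrow>
    walk_E q (\<lambda>\<omega>. (\<Sum>n\<leftarrow>ns. stat gs n (coin \<theta> \<omega>) - moment \<theta> gs)\<^sup>2) \<le> real L * (C + 1))"
proof (induction L)
  case 0
  show ?case by simp
next
  case (Suc L)
  then obtain ns where ns: "length ns = L" "\<And>\<theta>. bias_on N \<theta> \<Longrightarrow>
    walk_E q (\<lambda>\<omega>. (\<Sum>n\<leftarrow>ns. stat gs n (coin \<theta> \<omega>) - moment \<theta> gs)\<^sup>2) \<le> real L * (C + 1)" by blast
  \<comment> \<open>The cross term is at most \<open>2 * L * \<eta> \<le> 1\<close>, which is the 1
    in \<open>C + 1\<close>.\<close>
  define \<eta> where "\<eta> = 1 / 2 / (real L + 1)"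
  have \<eta>: "0 < \<eta>" by (simp add: \<eta>_def)
  have "\<forall>i. \<exists>n0. \<forall>n\<ge>n0. \<forall>\<theta>. bias_on N \<theta> \<longrightarrow>
    \<bar>walk_E q (\<lambda>\<omega>. (stat gs i (coin \<theta> \<omega>) - moment \<theta> gs) * (stat gs n (coin \<theta> \<omega>) - moment \<theta> gs))\<bar> \<le> \<eta>"
    by (rule allI, rule E_stat_stat_tendsto[OF \<eta>])
  from choice[OF this] obtain f where f: "\<And>i n \<theta>. n \<ge> f i \<Longrightarrow> bias_on N \<theta> \<Longrightarrow>
    \<bar>walk_E q (\<lambda>\<omega>. (stat gs i (coin \<theta> \<omega>) - moment \<theta> gs) * (stat gs n (coin \<theta> \<omega>) - moment \<theta> gs))\<bar> \<le> \<eta>"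
    by blast
  define n where "n = (\<Sum>i\<in>set ns. f i)"
  have fn: "f i \<le> n" if "i \<in> set ns" for i
    unfolding n_def using that by (intro member_le_sum) auto
  have "walk_E q (\<lambda>\<omega>. (\<Sum>n\<leftarrow>n # ns. stat gs n (coin \<theta> \<omega>) - moment \<theta> gs)\<^sup>2) \<le> real (Suc L) * (C + 1)"
    if \<theta>: "bias_on N \<theta>" for \<theta>
  proof -
    define d where "d = (\<lambda>n \<omega>. stat gs n (coin \<theta> \<omega>) - moment \<theta> gs)"
    define A where "A = (\<lambda>\<omega>. \<Sum>n\<leftarrow>ns. d n \<omega>)"
    have rvd: "bdd_rv q (d n)" for n unfolding d_def by (intro rv_intros)
    have rvA: "bdd_rv q A" unfolding A_def by (intro rv_intros rvd)
    have "walk_E q (\<lambda>\<omega>. (d n \<omega> + A \<omega>)\<^sup>2) = walk_E q (\<lambda>\<omega>. (A \<omega>)\<^sup>2 + (d n \<omega>)\<^sup>2 + 2 * (A \<omega> * d n \<omega>))"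
      by (intro Bochner_Integration.integral_cong refl) (simp add: power2_sum)
    also have "\<dots> = walk_E q (\<lambda>\<omega>. (A \<omega>)\<^sup>2) + walk_E q (\<lambda>\<omega>. (d n \<omega>)\<^sup>2) + 2 * walk_E q (\<lambda>\<omega>. A \<omega> * d n \<omega>)"
      by (subst walk_E_add walk_E_add integral_mult_right_zero, (intro rv_intros rvd rvA)+)+ simp
    also have "walk_E q (\<lambda>\<omega>. A \<omega> * d n \<omega>) = (\<Sum>i\<leftarrow>ns. walk_E q (\<lambda>\<omega>. d i \<omega> * d n \<omega>))"
      unfolding A_def sum_list_mult_const[symmetric] by (rule walk_E_sum_list) (intro rv_intros rvd)
    also have "\<dots> \<le> (\<Sum>i\<leftarrow>ns. \<eta>)"
    proof (rule sum_list_mono)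
      fix i assume "i \<in> set ns"
      then show "walk_E q (\<lambda>\<omega>. d i \<omega> * d n \<omega>) \<le> \<eta>"
        using f[OF fn \<theta>, of i] unfolding d_def by linarith
    qed
    also have "\<dots> = real L * \<eta>" by (simp add: sum_list_triv ns)
    also have "\<dots> \<le> 1 / 2" by (simp add: \<eta>_def field_simps)
    also have "walk_E q (\<lambda>\<omega>. (A \<omega>)\<^sup>2) \<le> real L * (C + 1)" using ns(2)[OF \<theta>] by (simp add: A_def d_def)
    also have "walk_E q (\<lambda>\<omega>. (d n \<omega>)\<^sup>2) \<le> C" using C[OF \<theta>] by (simp add: d_def)
    finally show ?thesis by (simp add: A_def d_def algebra_simps)
  qed
  then show ?case using ns(1) by (intro exI[of _ "n # ns"]) auto
qed

text \<open>Averaging \<open>L\<close> almost uncorrelated terms leaves a second moment of at most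
  \<open>(C + 1) / L\<close>. The times depend on \<theta> only through its window, so one estimator
  serves every bias in that window.\<close>

lemma L2_estimator:
  assumes \<epsilon>: "0 < \<epsilon>"
  shows "\<exists>n T. (\<forall>x y. (\<forall>i\<in>{1..n}. x i = y i) \<longrightarrow> T x = T y)
    \<and> (\<forall>\<theta>. bdd_rv q (\<lambda>\<omega>. T (coin \<theta> \<omega>)))
    \<and> (\<forall>\<theta>. bias_on N \<theta> \<longrightarrow> walk_E q (\<lambda>\<omega>. (T (coin \<theta> \<omega>) - moment \<theta> gs)\<^sup>2) \<le> \<epsilon>)"
proof -
  obtain C where C: "0 \<le> C" "\<And>n \<theta>. bias_on N \<theta> \<Longrightarrow>
      walk_E q (\<lambda>\<omega>. (stat gs n (coin \<theta> \<omega>) - moment \<theta> gs)\<^sup>2) \<le> C"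
    using E_stat_centred_square_bounded by blast
  obtain L where L: "(C + 1) / \<epsilon> < real L" using reals_Archimedean2 by blast
  have L0: "0 < real L" using L C \<epsilon> by (meson add_nonneg_pos divide_pos_pos less_trans zero_less_one)
  obtain ns where ns: "length ns = L" "\<And>\<theta>. bias_on N \<theta> \<Longrightarrow>
      walk_E q (\<lambda>\<omega>. (\<Sum>n\<leftarrow>ns. stat gs n (coin \<theta> \<omega>) - moment \<theta> gs)\<^sup>2) \<le> real L * (C + 1)"
    using almost_uncorrelated_times[OF C(2)] by blast
  define T where "T = (\<lambda>x. (\<Sum>n\<leftarrow>ns. stat gs n x) * (1 / real L))"
  \<comment> \<open>Starting times are at most an entry of \<open>ns\<close>, hence at most the sum
    of the entries, and a pattern extends \<open>sum_list gs\<close> further.\<close>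
  define n where "n = sum_list ns + sum_list gs"
  have "T x = T y" if eq: "\<forall>i\<in>{1..n}. x i = y i" for x y
  proof -
    have "obs gs m x = obs gs m y" if "l \<in> set ns" "m \<in> {1..l}" for l m
      unfolding obs_shift
    proof (rule toss_prod_cong)
      fix i assume "i < length (word gs)"
      then have "m + i \<in> {1..n}"
        using that member_le_sum_list[OF that(1)] by (auto simp: length_word[OF gs] n_def)
      then show "x (m + i) = y (m + i)" using eq by blast
    qed
    then have "stat gs l x = stat gs l y" if "l \<in> set ns" for l
      using that by (simp add: stat_def)
    then show ?thesis unfolding T_def by (metis (mono_tags, lifting) map_cong)
  qed
  moreover have "bdd_rv q (\<lambda>\<omega>. T (coin \<theta> \<omega>))" for \<theta>
    unfolding T_def by (intro rv_intros)
  moreover have "walk_E q (\<lambda>\<omega>. (T (coin \<theta> \<omega>) - moment \<theta> gs)\<^sup>2) \<le> \<epsilon>" if \<theta>: "bias_on N \<theta>" for \<theta>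
  proof -
    have "T x - moment \<theta> gs = (\<Sum>n\<leftarrow>ns. stat gs n x - moment \<theta> gs) * (1 / real L)" for x
      using L0 by (simp add: T_def sum_list_subtractf sum_list_triv ns left_diff_distrib diff_divide_distrib)
    then have "walk_E q (\<lambda>\<omega>. (T (coin \<theta> \<omega>) - moment \<theta> gs)\<^sup>2)
        = walk_E q (\<lambda>\<omega>. (\<Sum>n\<leftarrow>ns. stat gs n (coin \<theta> \<omega>) - moment \<theta> gs)\<^sup>2) * (1 / real L)\<^sup>2"
      by (simp only: power_mult_distrib integral_mult_left_zero)
    also have "\<dots> \<le> real L * (C + 1) * (1 / real L)\<^sup>2"
      by (intro mult_right_mono ns(2)[OF \<theta>]) simp
    also have "\<dots> = (C + 1) / real L" using L0 by (simp add: power2_eq_square)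
    also have "\<dots> \<le> \<epsilon>"
      using L0 L \<epsilon> by (simp add: pos_divide_less_eq pos_divide_le_eq mult.commute less_imp_le)
    finally show ?thesis .
  qed
  ultimately show ?thesis by blast
qed

end

end

section \<open>Selecting a bias function from approximate moments\<close>

text \<open>Bolzano-Weierstrass, applied to one site after another with a further subsequence each
  time.\<close>

lemma convergent_subseq_finite_set:
  fixes f :: "nat \<Rightarrow> 'a \<Rightarrow> real"
  assumes "finite A" "\<And>i z. \<bar>f i z\<bar> \<le> 1"
  shows "\<exists>r g. strict_mono (r :: nat \<Rightarrow> nat) \<and> (\<forall>z\<in>A. (\<lambda>i. f (r i) z) \<longlonglongrightarrow> g z)"
  using assms(1)
proof induction
  case empty
  show ?case by (intro exI[of _ id]) (auto simp: strict_mono_def)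
next
  case (insert a A)
  then obtain r g where r: "strict_mono r" "\<And>z. z \<in> A \<Longrightarrow> (\<lambda>i. f (r i) z) \<longlonglongrightarrow> g z" by blast
  have "bounded (range (\<lambda>i. f (r i) a))"
    unfolding bounded_iff using assms(2) by auto
  then obtain l s where s: "strict_mono s" "((\<lambda>i. f (r i) a) \<circ> s) \<longlonglongrightarrow> l"
    using bounded_imp_convergent_subsequence by blast
  have "(\<lambda>i. f ((r \<circ> s) i) z) \<longlonglongrightarrow> (g(a := l)) z" if "z \<in> insert a A" for z
  proof (cases "z = a")
    case True
    then show ?thesis using s(2) by (simp add: o_def)
  next
    case False
    then show ?thesis
      using LIMSEQ_subseq_LIMSEQ[OF r(2)[of z] s(1)] that by (simp add: o_def)
  qed
  moreover have "strict_mono (r \<circ> s)" using r s by (simp add: strict_mono_o)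
  ultimately show ?case by blast
qed

text \<open>Moments are invariant under shifts, so it is enough to search for biases on intervals
  that start at 0.\<close>

definition box_biases :: "nat \<Rightarrow> (int \<Rightarrow> real) set" where
  "box_biases D = {e. (\<forall>z. 0 \<le> e z \<and> e z \<le> 1) \<and> (\<forall>z. e z \<noteq> 0 \<longrightarrow> z \<in> {0..int D})}"

lemma box_biases_eq_0: "e \<in> box_biases D \<Longrightarrow> z \<notin> {0..int D} \<Longrightarrow> e z = 0"
  unfolding box_biases_def by blast

text \<open>In the selection rule the range is the stage \<open>k\<close>, because the box of the
  previous estimate need not be the current one; late in the process the range covers both.\<close>

definition site_dist :: "nat \<Rightarrow> (int \<Rightarrow> real) \<Rightarrow> (int \<Rightarrow> real) \<Rightarrow> real" where
  "site_dist k e e' = (\<Sum>z\<in>{0..int k}. \<bar>e z - e' z\<bar>)"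

lemma site_dist_nonneg: "0 \<le> site_dist k e e'"
  unfolding site_dist_def by (rule sum_nonneg) auto

lemma site_dist_sym: "site_dist k e e' = site_dist k e' e"
  unfolding site_dist_def by (simp add: abs_minus_commute)

lemma site_dist_triangle: "site_dist k e e'' \<le> site_dist k e e' + site_dist k e' e''"
  unfolding site_dist_def sum.distrib[symmetric] by (rule sum_mono) linarith

lemma site_dist_box:
  assumes "e \<in> box_biases D" "e' \<in> box_biases D" "D \<le> k"
  shows "site_dist k e e' = site_dist D e e'"
  unfolding site_dist_def
proof (rule sum.mono_neutral_right)
  show "\<forall>z\<in>{0..int k} - {0..int D}. \<bar>e z - e' z\<bar> = 0"
    using box_biases_eq_0[OF assms(1)] box_biases_eq_0[OF assms(2)] by simp
qed (use assms in auto)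

lemma site_dist_eq_0:
  assumes "e \<in> box_biases D" "e' \<in> box_biases D" "site_dist D e e' = 0"
  shows "e = e'"
proof
  fix z
  have "\<forall>z\<in>{0..int D}. \<bar>e z - e' z\<bar> = 0"
    using assms(3) unfolding site_dist_def by (subst (asm) sum_nonneg_eq_0_iff) auto
  then show "e z = e' z"
    using box_biases_eq_0[OF assms(1)] box_biases_eq_0[OF assms(2)] by (cases "z \<in> {0..int D}") auto
qed

lemma abs_diff_le_site_dist:
  assumes "e \<in> box_biases D" "e' \<in> box_biases D"
  shows "\<bar>e z - e' z\<bar> \<le> site_dist D e e'"
proof (cases "z \<in> {0..int D}")
  case True
  then show ?thesis unfolding site_dist_def
    using member_le_sum[of z "{0..int D}" "\<lambda>z. \<bar>e z - e' z\<bar>"] by simp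
next
  case False
  then have "e z = 0" "e' z = 0"
    using box_biases_eq_0[OF assms(1)] box_biases_eq_0[OF assms(2)] by auto
  then show ?thesis using site_dist_nonneg by simp
qed

text \<open>Only continuity of the moments under pointwise convergence within a box enters the
  selection argument.\<close>

locale selection =
  fixes \<mu> :: "(int \<Rightarrow> real) \<Rightarrow> nat \<Rightarrow> real"
  assumes \<mu>_tendsto: "\<And>D f g j. (\<And>i. f i \<in> box_biases D) \<Longrightarrow> g \<in> box_biases D \<Longrightarrow>
    (\<And>z. (\<lambda>i. f i z) \<longlonglongrightarrow> g z) \<Longrightarrow> (\<lambda>i. \<mu> (f i) j) \<longlonglongrightarrow> \<mu> g j"
begin

definition fits :: "nat \<Rightarrow> (nat \<Rightarrow> real) \<Rightarrow> (int \<Rightarrow> real) \<Rightarrow> bool" where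
  "fits k t e \<longleftrightarrow> (\<forall>j\<le>k. \<bar>t j - \<mu> e j\<bar> \<le> (1/2) ^ k)"

text \<open>Minimality keeps the candidates of all late stages in one fixed box, where compactness
  applies. If nothing fits, the value is arbitrary, which under the hypotheses of
  \<open>estimate_tendsto\<close> can happen at early stages only.\<close>

definition fit_width :: "nat \<Rightarrow> (nat \<Rightarrow> real) \<Rightarrow> nat" where
  "fit_width k t = (LEAST D. \<exists>e\<in>box_biases D. fits k t e)"

definition candidates :: "nat \<Rightarrow> (nat \<Rightarrow> real) \<Rightarrow> (int \<Rightarrow> real) set" where
  "candidates k t = {e \<in> box_biases (fit_width k t). fits k t e}"

text \<open>The true biases can be fitted by several reflected copies.  Staying close to the previous
  estimate prevents the estimates from alternating between them.\<close>
definition next_estimate :: "nat \<Rightarrow> (nat \<Rightarrow> real) \<Rightarrow> (int \<Rightarrow> real) \<Rightarrow> int \<Rightarrow> real" where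
  "next_estimate k t prev = (SOME e. e \<in> candidates k t \<and>
     (\<forall>e'\<in>candidates k t. site_dist k e prev \<le> site_dist k e' prev + (1/2) ^ k))"

primrec estimate :: "(nat \<Rightarrow> nat \<Rightarrow> real) \<Rightarrow> nat \<Rightarrow> int \<Rightarrow> real" where
  "estimate T 0 = (\<lambda>_. 0)"
| "estimate T (Suc k) = next_estimate k (T k) (estimate T k)"

lemma estimate_cong: "(\<And>i. i < k \<Longrightarrow> T i = T' i) \<Longrightarrow> estimate T k = estimate T' k"
  by (induction k) auto

text \<open>The slack \<open>(1/2) ^ k\<close> makes a near-minimizer exist without showing that the
  infimum is attained.\<close>

lemma next_estimate:
  assumes "candidates k t \<noteq> {}"
  shows "next_estimate k t prev \<in> candidates k t"
    "e' \<in> candidates k t \<Longrightarrow> site_dist k (next_estimate k t prev) prev \<le> site_dist k e' prev + (1/2) ^ k"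
proof -
  let ?F = "(\<lambda>e. site_dist k e prev) ` candidates k t"
  have bdd: "bdd_below ?F" by (rule bdd_belowI[of _ 0]) (auto simp: site_dist_nonneg)
  have "Inf ?F < Inf ?F + (1/2) ^ k" by simp
  then obtain y where "y \<in> ?F" "y < Inf ?F + (1/2) ^ k"
    using cInf_lessD[of ?F] assms by blast
  then obtain e where e: "e \<in> candidates k t" "site_dist k e prev < Inf ?F + (1/2) ^ k" by blast
  have "site_dist k e prev \<le> site_dist k e' prev + (1/2) ^ k" if "e' \<in> candidates k t" for e'
    using e(2) cInf_lower[OF imageI[OF that] bdd] by linarith
  with e(1) have "\<exists>e. e \<in> candidates k t \<and>
      (\<forall>e'\<in>candidates k t. site_dist k e prev \<le> site_dist k e' prev + (1/2) ^ k)" by blast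
  from someI_ex[OF this, folded next_estimate_def]
  show "next_estimate k t prev \<in> candidates k t"
    "e' \<in> candidates k t \<Longrightarrow> site_dist k (next_estimate k t prev) prev \<le> site_dist k e' prev + (1/2) ^ k"
    by blast+
qed

text \<open>Compactness: a sequence of ever better fits at distance at least
  \<open>\<epsilon>\<close> from all solutions would have a pointwise subsequential limit in the
  box, and by continuity of \<open>\<mu>\<close> that limit would be a solution.\<close>

lemma fits_near_solution:
  assumes T: "\<And>k j. k \<ge> k0 \<Longrightarrow> j \<le> k \<Longrightarrow> \<bar>T k j - m j\<bar> \<le> (1/2) ^ k" and \<epsilon>: "0 < \<epsilon>"
  shows "\<exists>k1. \<forall>k\<ge>k1. \<forall>e'\<in>box_biases D. fits k (T k) e' \<longrightarrow>
    (\<exists>e\<in>box_biases D. \<mu> e = m \<and> site_dist D e' e < \<epsilon>)"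
proof (rule ccontr)
  assume "\<not> ?thesis"
  then have "\<forall>i. \<exists>k e'. k \<ge> i \<and> e' \<in> box_biases D \<and> fits k (T k) e' \<and>
      \<not> (\<exists>e\<in>box_biases D. \<mu> e = m \<and> site_dist D e' e < \<epsilon>)" by metis
  then obtain \<kappa> f where \<kappa>: "\<And>i. \<kappa> i \<ge> i" and f: "\<And>i. f i \<in> box_biases D" "\<And>i. fits (\<kappa> i) (T (\<kappa> i)) (f i)"
    "\<And>i e. e \<in> box_biases D \<Longrightarrow> \<mu> e = m \<Longrightarrow> \<not> site_dist D (f i) e < \<epsilon>"
    by metis
  have "\<bar>f i z\<bar> \<le> 1" for i z using f(1)[of i] unfolding box_biases_def by force
  then obtain r h where r: "strict_mono (r :: nat \<Rightarrow> nat)" and h: "\<And>z. z \<in> {0..int D} \<Longrightarrow> (\<lambda>i. f (r i) z) \<longlonglongrightarrow> h z"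
    using convergent_subseq_finite_set[of "{0..int D}" f, OF finite_atLeastAtMost_int] by blast
  define g where "g = (\<lambda>z. if z \<in> {0..int D} then h z else 0)"
  have g_lim: "(\<lambda>i. f (r i) z) \<longlonglongrightarrow> g z" for z
  proof (cases "z \<in> {0..int D}")
    case False
    then have "f (r i) z = 0" for i by (rule box_biases_eq_0[OF f(1)])
    moreover have "g z = 0" using False by (auto simp: g_def)
    ultimately show ?thesis by simp
  qed (use h in \<open>simp add: g_def\<close>)
  have g: "g \<in> box_biases D"
  proof -
    have "0 \<le> g z" "g z \<le> 1" for z
      using f(1) by (auto intro!: LIMSEQ_le_const[OF g_lim] LIMSEQ_le_const2[OF g_lim] simp: box_biases_def)
    then show ?thesis by (auto simp: box_biases_def g_def split: if_splits)
  qed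
  have "\<mu> g j = m j" for j
  proof -
    have 1: "(\<lambda>i. \<mu> (f (r i)) j) \<longlonglongrightarrow> \<mu> g j" by (rule \<mu>_tendsto[OF f(1) g g_lim])
    have z: "(\<lambda>i. 2 * (1/2::real) ^ i) \<longlonglongrightarrow> 0"
      by (rule tendsto_mult_right_zero) (rule LIMSEQ_power_zero, simp)
    have "(\<lambda>i. \<mu> (f (r i)) j - m j) \<longlonglongrightarrow> 0"
    proof (rule tendsto_0_le[OF z, of _ 1])
      show "\<forall>\<^sub>F i in sequentially. norm (\<mu> (f (r i)) j - m j) \<le> norm (2 * (1/2::real) ^ i) * 1"
        using eventually_ge_at_top[of "max k0 j"]
      proof eventually_elim
        fix i assume i: "max k0 j \<le> i"
        let ?k = "\<kappa> (r i)"
        have k: "?k \<ge> i" using \<kappa>[of "r i"] seq_suble[OF r, of i] by simp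
        have "\<bar>T ?k j - m j\<bar> \<le> (1/2) ^ ?k" using T[of ?k j] i k by simp
        moreover have "\<bar>T ?k j - \<mu> (f (r i)) j\<bar> \<le> (1/2) ^ ?k"
          using f(2)[of "r i"] i k unfolding fits_def by simp
        moreover have "(1/2::real) ^ ?k \<le> (1/2) ^ i" using k by (intro power_decreasing) auto
        ultimately have "\<bar>\<mu> (f (r i)) j - m j\<bar> \<le> 2 * (1/2) ^ i" by linarith
        then show "norm (\<mu> (f (r i)) j - m j) \<le> norm (2 * (1/2::real) ^ i) * 1"
          by (simp add: abs_mult)
      qed
    qed
    then have "(\<lambda>i. \<mu> (f (r i)) j) \<longlonglongrightarrow> m j" by (simp add: LIM_zero_iff)
    then show ?thesis using 1 LIMSEQ_unique by blast
  qed
  then have "\<mu> g = m" by blast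
  have "(\<lambda>i. site_dist D (f (r i)) g) \<longlonglongrightarrow> (\<Sum>z\<in>{0..int D}. \<bar>g z - g z\<bar>)"
    unfolding site_dist_def by (intro tendsto_intros g_lim)
  then have "\<forall>\<^sub>F i in sequentially. site_dist D (f (r i)) g < \<epsilon>"
    using \<epsilon> by (intro order_tendstoD(2)) auto
  then obtain i where "site_dist D (f (r i)) g < \<epsilon>" by (auto simp: eventually_sequentially)
  then show False using f(3)[OF g \<open>\<mu> g = m\<close>] by blast
qed

text \<open>The width settles at the smallest one admitting a solution, because smaller boxes
  contain no solution and hence, by compactness, no late fit. From then on each estimate is close to
  one of finitely many separated solutions, and the preference for small jumps keeps it at the same
  one.\<close>

theorem estimate_tendsto:
  assumes T: "\<And>k j. k \<ge> k0 \<Longrightarrow> j \<le> k \<Longrightarrow> \<bar>T k j - m j\<bar> \<le> (1/2) ^ k"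
    and ex: "\<exists>e\<in>box_biases D0. \<mu> e = m"
    and fin: "\<And>D. finite {e \<in> box_biases D. \<mu> e = m}"
  shows "\<exists>D. \<exists>e\<in>box_biases D. \<mu> e = m \<and> (\<forall>z. (\<lambda>k. estimate T k z) \<longlonglongrightarrow> e z)"
proof -
  define sol where "sol = (\<lambda>D. {e \<in> box_biases D. \<mu> e = m})"
  define D where "D = (LEAST D. sol D \<noteq> {})"
  have D: "sol D \<noteq> {}" unfolding D_def by (rule LeastI[of _ D0]) (use ex in \<open>auto simp: sol_def\<close>)
  have minD: "sol D' = {}" if "D' < D" for D' using not_less_Least[of D' "\<lambda>D. sol D \<noteq> {}"] that by (auto simp: D_def)
  have near: "\<exists>k1. \<forall>k\<ge>k1. \<forall>e'\<in>box_biases D'. fits k (T k) e' \<longrightarrow> (\<exists>e\<in>sol D'. site_dist D' e' e < \<epsilon>)"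
    if "0 < \<epsilon>" for \<epsilon> D'
  proof -
    have "(\<exists>e\<in>sol D'. site_dist D' e' e < \<epsilon>) \<longleftrightarrow> (\<exists>e\<in>box_biases D'. \<mu> e = m \<and> site_dist D' e' e < \<epsilon>)" for e'
      by (auto simp: sol_def)
    then show ?thesis using fits_near_solution[of k0 T m \<epsilon> D', OF T that] by (simp only:)
  qed
  have sol_fits: "fits k (T k) e" if "k \<ge> k0" "e \<in> sol D" for k e
    using T[OF that(1)] that(2) by (auto simp: fits_def sol_def)
  \<comment> \<open>For a box without solutions the conclusion is unsatisfiable, so there this says
    that nothing fits from stage \<open>k1\<close> on.\<close>
  have "\<forall>D'. \<exists>k1. \<forall>k\<ge>k1. \<forall>e'\<in>box_biases D'. fits k (T k) e' \<longrightarrow> (\<exists>e\<in>sol D'. site_dist D' e' e < 1)"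
    using near by simp
  then obtain \<kappa> where \<kappa>: "\<And>D' k e'. k \<ge> \<kappa> D' \<Longrightarrow> e' \<in> box_biases D' \<Longrightarrow> fits k (T k) e' \<Longrightarrow> \<exists>e\<in>sol D'. site_dist D' e' e < 1"
    by metis
  \<comment> \<open>Beyond \<open>k2\<close> no smaller box has a fit, and \<open>D \<le> k\<close>
    makes \<open>site_dist k\<close> agree with \<open>site_dist D\<close> on the box.\<close>
  define k2 where "k2 = k0 + D + (\<Sum>D'<D. \<kappa> D')"
  have width: "fit_width k (T k) = D" if k: "k \<ge> k2" for k
    unfolding fit_width_def
  proof (rule Least_equality)
    show "\<exists>e\<in>box_biases D. fits k (T k) e"
      using D sol_fits[of k] k by (auto simp: sol_def k2_def)
    fix D' assume ex: "\<exists>e\<in>box_biases D'. fits k (T k) e"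
    show "D \<le> D'"
    proof (rule ccontr)
      assume "\<not> D \<le> D'"
      then have "D' < D" by simp
      then have "\<kappa> D' \<le> k" using k member_le_sum[of D' "{..<D}" \<kappa>] by (simp add: k2_def)
      with ex \<kappa>[of D' k] minD[OF \<open>D' < D\<close>] show False by blast
    qed
  qed
  have cand: "candidates k (T k) = {e \<in> box_biases D. fits k (T k) e}" if "k \<ge> k2" for k
    by (simp add: candidates_def width[OF that])
  have sol_cand: "sol D \<subseteq> candidates k (T k)" if "k \<ge> k2" for k
    using sol_fits[of k] that by (auto simp: cand sol_def k2_def)
  have step: "estimate T (Suc k) \<in> box_biases D" "fits k (T k) (estimate T (Suc k))"
    "e \<in> sol D \<Longrightarrow> site_dist k (estimate T (Suc k)) (estimate T k) \<le> site_dist k e (estimate T k) + (1/2) ^ k"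
    if k: "k \<ge> k2" for k e
  proof -
    have ne: "candidates k (T k) \<noteq> {}" using sol_cand[OF k] D by blast
    note c = next_estimate[OF ne, where prev = "estimate T k"]
    show "estimate T (Suc k) \<in> box_biases D" "fits k (T k) (estimate T (Suc k))"
      using c(1) unfolding cand[OF k] by simp_all
    show "site_dist k (estimate T (Suc k)) (estimate T k) \<le> site_dist k e (estimate T k) + (1/2) ^ k" if "e \<in> sol D"
      unfolding estimate.simps by (rule c(2)) (use sol_cand[OF k] that in blast)
  qed
  obtain \<delta> where \<delta>: "0 < \<delta>" "\<And>e e'. e \<in> sol D \<Longrightarrow> e' \<in> sol D \<Longrightarrow> e \<noteq> e' \<Longrightarrow> \<delta> \<le> site_dist D e e'"
  proof -
    \<comment> \<open>The extra element 1 keeps the minimum defined when there is only one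
      solution.\<close>
    let ?S = "insert 1 ((\<lambda>(e, e'). site_dist D e e') ` {(e, e') \<in> sol D \<times> sol D. e \<noteq> e'})"
    have fs: "finite (sol D)" using fin[of D] by (simp only: sol_def)
    have finS: "finite ?S"
      by (intro finite.insertI finite_imageI) (rule finite_subset[OF _ finite_cartesian_product[OF fs fs]], auto)
    have "0 < x" if "x \<in> ?S" for x
    proof -
      have "0 < site_dist D e e'" if "e \<in> sol D" "e' \<in> sol D" "e \<noteq> e'" for e e'
      proof -
        have "site_dist D e e' \<noteq> 0" using site_dist_eq_0[of e D e'] that by (auto simp: sol_def)
        then show ?thesis using site_dist_nonneg[of D e e'] by simp
      qed
      then show ?thesis using that by auto
    qed
    then have "0 < Min ?S" using finS by (subst Min_gr_iff) auto
    moreover have "Min ?S \<le> site_dist D e e'" if "e \<in> sol D" "e' \<in> sol D" "e \<noteq> e'" for e e'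
      using that by (intro Min_le finS) auto
    ultimately show thesis using that by blast
  qed
  obtain k3 where k3: "\<And>k e'. k \<ge> k3 \<Longrightarrow> e' \<in> box_biases D \<Longrightarrow> fits k (T k) e' \<Longrightarrow> \<exists>e\<in>sol D. site_dist D e' e < \<delta> / 8"
    using near[of "\<delta> / 8" D] \<delta>(1) by auto
  have "\<forall>\<^sub>F k in sequentially. (1/2::real) ^ k < \<delta> / 8"
    using \<delta>(1) by (intro order_tendstoD(2)[OF LIMSEQ_power_zero]) auto
  then obtain k4 where k4: "\<And>k. k \<ge> k4 \<Longrightarrow> (1/2::real) ^ k < \<delta> / 8"
    by (auto simp: eventually_sequentially)
  define k5 where "k5 = k2 + k3 + k4"
  have in_box: "estimate T (Suc k) \<in> box_biases D" if "k \<ge> k5" for k using step(1)[of k] that by (simp add: k5_def)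
  obtain e where e: "e \<in> sol D" "site_dist D (estimate T (Suc k5)) e < \<delta> / 8"
    using k3[of k5] step(1,2)[of k5] by (auto simp: k5_def)
  have ebox: "e \<in> box_biases D" using e by (simp add: sol_def)
  \<comment> \<open>A step has length below \<delta>/8 + \<delta>/8, so the new estimate is within
    3\<delta>/8 of \<open>e\<close>, and the solution \<open>e2\<close> next to it is within
    \<delta>/2 of \<open>e\<close>; separation by \<delta> forces \<open>e2 = e\<close>.\<close>
  have stay: "site_dist D (estimate T (Suc (k5 + i))) e < \<delta> / 8" for i
  proof (induction i)
    case 0
    show ?case using e by simp
  next
    case (Suc i)
    define k where "k = Suc (k5 + i)"
    have k: "k \<ge> k2" "k \<ge> k3" "k \<ge> k4" "D \<le> k" by (simp_all add: k_def k5_def k2_def)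
    have prev: "estimate T k \<in> box_biases D" unfolding k_def by (rule in_box) simp
    obtain e2 where e2: "e2 \<in> sol D" "site_dist D (estimate T (Suc k)) e2 < \<delta> / 8"
      using k3[OF k(2) step(1,2)[OF k(1)]] by blast
    have "site_dist D (estimate T (Suc k)) (estimate T k) \<le> site_dist D e (estimate T k) + (1/2) ^ k"
      using step(3)[OF k(1) e(1)] site_dist_box[OF step(1)[OF k(1)] prev k(4)] site_dist_box[OF ebox prev k(4)] by simp
    then have "site_dist D (estimate T (Suc k)) (estimate T k) < \<delta> / 4"
      using Suc k4[OF k(3)] site_dist_sym[of D e "estimate T k"] unfolding k_def by simp
    then have "site_dist D (estimate T (Suc k)) e < 3 * \<delta> / 8"
      using site_dist_triangle[of D "estimate T (Suc k)" e "estimate T k"] Suc unfolding k_def by simp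
    then have "site_dist D e e2 < \<delta>"
      using site_dist_triangle[of D e e2 "estimate T (Suc k)"] e2(2) site_dist_sym[of D e "estimate T (Suc k)"] \<delta>(1) by simp
    then have "e2 = e" using \<delta>(2)[OF e(1) e2(1)] by force
    then show ?case using e2(2) by (simp add: k_def)
  qed
  have "(\<lambda>k. estimate T k z) \<longlonglongrightarrow> e z" for z
  proof (rule LIMSEQ_I)
    fix \<epsilon> :: real assume \<epsilon>: "0 < \<epsilon>"
    define \<epsilon>' where "\<epsilon>' = min \<epsilon> (\<delta> / 8)"
    have "0 < \<epsilon>'" using \<epsilon> \<delta>(1) by (simp add: \<epsilon>'_def)
    then obtain k6 where k6: "\<And>k e'. k \<ge> k6 \<Longrightarrow> e' \<in> box_biases D \<Longrightarrow> fits k (T k) e' \<Longrightarrow> \<exists>e\<in>sol D. site_dist D e' e < \<epsilon>'"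
      using near[of \<epsilon>' D] by auto
    show "\<exists>no. \<forall>n\<ge>no. norm (estimate T n z - e z) < \<epsilon>"
    proof (intro exI[of _ "Suc (k5 + k6)"] allI impI)
      fix n assume n: "Suc (k5 + k6) \<le> n"
      then obtain k where k: "n = Suc k" "k \<ge> k5 + k6" by (cases n) auto
      have k': "k \<ge> k2" "k \<ge> k6" using k by (auto simp: k5_def)
      obtain e2 where e2: "e2 \<in> sol D" "site_dist D (estimate T n) e2 < \<epsilon>'"
        using k6[OF k'(2) step(1,2)[OF k'(1)]] k(1) by blast
      have "site_dist D (estimate T n) e < \<delta> / 8" using stay[of "k - k5"] k by simp
      then have "site_dist D e e2 < \<delta>"
        using site_dist_triangle[of D e e2 "estimate T n"] e2(2) site_dist_sym[of D e "estimate T n"] \<delta>(1) by (simp add: \<epsilon>'_def)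
      then have "e2 = e" using \<delta>(2)[OF e(1) e2(1)] by force
      then have "site_dist D (estimate T n) e < \<epsilon>" using e2(2) by (simp add: \<epsilon>'_def)
      moreover have "estimate T n \<in> box_biases D" unfolding k(1) by (rule step(1)[OF k'(1)])
      ultimately show "norm (estimate T n z - e z) < \<epsilon>"
        using abs_diff_le_site_dist[of "estimate T n" D e z] ebox by simp
    qed
  qed
  then show ?thesis using e(1) unfolding sol_def by blast
qed

end

section \<open>Reconstruction\<close>

text \<open>Countably many moments are indexed by one number, so that stage \<open>k\<close> can
  test those of index up to \<open>k\<close>; \<open>Suc\<close> enforces positive gaps.\<close>

definition gap_triple :: "nat \<Rightarrow> nat list" where
  "gap_triple j = (case from_nat j of (a, b, c) \<Rightarrow> [Suc a, Suc b, Suc c])"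

lemma gap_triple_pos: "g \<in> set (gap_triple j) \<Longrightarrow> g \<ge> 1"
  by (auto simp: gap_triple_def split: prod.splits)

lemma gap_triple_surj:
  assumes "g1 \<ge> 1" "g2 \<ge> 1" "g3 \<ge> 1"
  shows "gap_triple (to_nat (g1 - 1, g2 - 1, g3 - 1)) = [g1, g2, g3]"
  using assms by (simp add: gap_triple_def)

lemma box_biases_finite: "e \<in> box_biases D \<Longrightarrow> finite {z. e z \<noteq> 0}"
  by (rule finite_subset[of _ "{0..int D}"]) (auto simp: box_biases_def)

section \<open>Continuity and symmetries of the moments\<close>

context symm_walk
begin

definition triple_moment :: "(int \<Rightarrow> real) \<Rightarrow> nat \<Rightarrow> real" where
  "triple_moment \<theta> j = moment \<theta> (gap_triple j)"

lemma triple_moments_determine: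
  assumes "finite {z. \<theta> z \<noteq> 0}" "\<And>z. 0 \<le> \<theta> z" "finite {z. \<theta>' z \<noteq> 0}" "\<And>z. 0 \<le> \<theta>' z"
    and eq: "triple_moment \<theta>' = triple_moment \<theta>"
  shows "\<exists>c. \<exists>s\<in>{1, -1}. \<forall>z. \<theta>' z = \<theta> (s * z + c)"
proof (rule moments_determine[OF assms(1-4)])
  fix g1 g2 g3 :: nat assume g: "g1 \<ge> 1" "g2 \<ge> 1" "g3 \<ge> 1"
  show "moment \<theta> [g1, g2, g3] = moment \<theta>' [g1, g2, g3]"
    using fun_cong[OF eq, of "to_nat (g1 - 1, g2 - 1, g3 - 1)"]
    unfolding triple_moment_def gap_triple_surj[OF g] by simp
qed

text \<open>The support of the limit may be smaller than those of the approximants, so all sums are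
  first extended to the common finite set \<open>I\<close>.\<close>

lemma chain_tendsto:
  assumes I: "finite I" "\<And>i. {z. f i z \<noteq> 0} \<subseteq> I" "{z. g z \<noteq> 0} \<subseteq> I"
    and lim: "\<And>z. (\<lambda>i. f i z) \<longlonglongrightarrow> g z"
  shows "(\<lambda>i. chain (f i) gs (\<lambda>_. 1) z) \<longlonglongrightarrow> chain g gs (\<lambda>_. 1) z"
proof (induction gs arbitrary: z)
  case Nil
  show ?case using lim by simp
next
  case (Cons a gs)
  have "(\<lambda>i. f i z * (\<Sum>w\<in>I. p a (w - z) * chain (f i) gs (\<lambda>_. 1) w))
      \<longlonglongrightarrow> g z * (\<Sum>w\<in>I. p a (w - z) * chain g gs (\<lambda>_. 1) w)"
    by (intro tendsto_intros lim Cons)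
  then show ?case
    by (simp add: sum_chain_superset[OF I(1) I(2)] sum_chain_superset[OF I(1) I(3)])
qed

lemma moment_tendsto:
  assumes I: "finite I" "\<And>i. {z. f i z \<noteq> 0} \<subseteq> I" "{z. g z \<noteq> 0} \<subseteq> I"
    and lim: "\<And>z. (\<lambda>i. f i z) \<longlonglongrightarrow> g z"
  shows "(\<lambda>i. moment (f i) gs) \<longlonglongrightarrow> moment g gs"
proof -
  have "moment \<theta> gs = (\<Sum>z\<in>I. chain1 \<theta> gs z)" if "{z. \<theta> z \<noteq> 0} \<subseteq> I" for \<theta>
    unfolding moment_def using sum_chain_superset[OF I(1) that, of "\<lambda>_. 1"] by simp
  then show ?thesis
    using I by (simp add: tendsto_sum chain_tendsto[OF I lim])
qed

lemma chain_shift: "chain (\<lambda>z. \<theta> (z + c)) gs (\<lambda>_. 1) z = chain \<theta> gs (\<lambda>_. 1) (z + c)"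
proof (induction gs arbitrary: z)
  case (Cons g gs)
  have "(\<Sum>w | \<theta> (w + c) \<noteq> 0. p g (w - z) * chain \<theta> gs (\<lambda>_. 1) (w + c))
      = (\<Sum>w | \<theta> w \<noteq> 0. p g (w - (z + c)) * chain \<theta> gs (\<lambda>_. 1) w)"
    by (rule sum.reindex_bij_witness[where i = "\<lambda>w. w - c" and j = "\<lambda>w. w + c"]) auto
  then show ?case by (simp add: Cons)
qed simp

lemma moment_shift: "moment (\<lambda>z. \<theta> (z + c)) gs = moment \<theta> gs"
  unfolding moment_def chain_shift
  by (rule sum.reindex_bij_witness[where i = "\<lambda>w. w - c" and j = "\<lambda>w. w + c"]) auto

text \<open>A solution is a shift of \<theta> or of its reflection, hence given by a sign and by the
  place in the box that corresponds to a fixed support site \<open>z0\<close>.\<close>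

lemma finite_box_solutions:
  assumes fin: "finite {z. \<theta> z \<noteq> 0}" and nn: "\<And>z. 0 \<le> \<theta> z"
  shows "finite {e \<in> box_biases D. triple_moment e = triple_moment \<theta>}"
proof -
  have copy: "\<exists>c. \<exists>s\<in>{1, -1}. \<forall>z. e z = \<theta> (s * z + c)"
    if "e \<in> box_biases D" "triple_moment e = triple_moment \<theta>" for e
    using triple_moments_determine[OF fin nn box_biases_finite[OF that(1)] _ that(2)] that(1)
    by (auto simp: box_biases_def)
  show ?thesis
  proof (cases "\<exists>z0. \<theta> z0 \<noteq> 0")
    case False
    have "{e \<in> box_biases D. triple_moment e = triple_moment \<theta>} \<subseteq> {\<lambda>_. 0}"
      using copy False by fastforce
    then show ?thesis by (rule finite_subset) simp
  next
    case True
    then obtain z0 where z0: "\<theta> z0 \<noteq> 0" by blast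
    have "{e \<in> box_biases D. triple_moment e = triple_moment \<theta>}
        \<subseteq> (\<lambda>(s, z) y. \<theta> (s * y + (z0 - s * z))) ` ({1, -1} \<times> {0..int D})"
    proof
      fix e assume e: "e \<in> {e \<in> box_biases D. triple_moment e = triple_moment \<theta>}"
      then obtain c s where s: "s \<in> {1, -1}" and c: "\<And>z. e z = \<theta> (s * z + c)" using copy by blast
      \<comment> \<open>The preimage of \<open>z0\<close> under
        \<open>\<lambda>y. s * y + c\<close>, since \<open>s\<close> is its own inverse.\<close>
      define z where "z = s * (z0 - c)"
      have sz: "s * z = z0 - c" using s by (auto simp: z_def)
      then have "e z \<noteq> 0" using z0 by (simp add: c)
      then have "z \<in> {0..int D}" using e box_biases_eq_0 by blast
      moreover have "e = (\<lambda>y. \<theta> (s * y + (z0 - s * z)))" by (simp add: c sz fun_eq_iff)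
      ultimately show "e \<in> (\<lambda>(s, z) y. \<theta> (s * y + (z0 - s * z))) ` ({1, -1} \<times> {0..int D})"
        using s by (intro image_eqI[of _ _ "(s, z)"]) auto
    qed
    then show ?thesis by (rule finite_subset) simp
  qed
qed

sublocale selection triple_moment
proof
  fix D f g j
  assume f: "\<And>i. f i \<in> box_biases D" and g: "g \<in> box_biases D" and lim: "\<And>z. (\<lambda>i. f i z) \<longlonglongrightarrow> g z"
  have sub: "{z. e z \<noteq> 0} \<subseteq> {0..int D}" if "e \<in> box_biases D" for e
    using that unfolding box_biases_def by blast
  show "(\<lambda>i. triple_moment (f i) j) \<longlonglongrightarrow> triple_moment g j"
    unfolding triple_moment_def
    by (rule moment_tendsto[of "{0..int D}"]) (use sub f g lim in auto)
qed

end

text \<open>Chebyshev and Borel-Cantelli turn the mean square bounds into errors of at most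
  \<open>(1/2) ^ k\<close> for all moments of index up to \<open>k\<close> at all late stages; the
  deterministic selection then applies path by path.\<close>

theorem theorem1p1:
  fixes q :: "int pmf"
  assumes "standing_assms q"
  shows "\<exists>est :: int list \<Rightarrow> int \<Rightarrow> real.
           \<forall>\<theta> :: int \<Rightarrow> real.
             (\<forall>z. 0 \<le> \<theta> z \<and> \<theta> z \<le> 1) \<and> finite {z. \<theta> z \<noteq> 0} \<longrightarrow>
             (AE \<omega> in walk_space q.
                \<exists>c::int. \<exists>s\<in>{1, -1::int}. \<forall>z::int.
                  (\<lambda>n. est (map (coin \<theta> \<omega>) [1..<Suc n]) z) \<longlonglongrightarrow> \<theta> (s * z + c))"
proof -
  interpret symm_walk q by unfold_locales (rule assms)
  interpret W: prob_space "walk_space q" by (rule prob_space_walk_space)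
  \<comment> \<open>The accuracy is set so that Chebyshev at level \<open>(1/2) ^ k\<close> costs a
    factor \<open>4 ^ k\<close>, the \<open>k + 1\<close> moments cancel the denominator, and the
    summable \<open>(1/2) ^ k\<close> remains.\<close>
  have "\<forall>k j. \<exists>n T. (\<forall>x y. (\<forall>i\<in>{1..n}. x i = y i) \<longrightarrow> T x = T y)
    \<and> (\<forall>\<theta>. bdd_rv q (\<lambda>\<omega>. T (coin \<theta> \<omega>)))
    \<and> (\<forall>\<theta>. bias_on k \<theta> \<longrightarrow> walk_E q (\<lambda>\<omega>. (T (coin \<theta> \<omega>) - moment \<theta> (gap_triple j))\<^sup>2) \<le> (1/8) ^ k / (k + 1))"
    by (intro allI L2_estimator gap_triple_pos) auto
  then obtain n T where T_cong: "\<And>k j x y. (\<forall>i\<in>{1..n k j :: nat}. x i = y i) \<Longrightarrow> T k j x = T k j y"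
    and T_rv: "\<And>k j \<theta>. bdd_rv q (\<lambda>\<omega>. T k j (coin \<theta> \<omega>))"
    and T_L2: "\<And>k j \<theta>. bias_on k \<theta> \<Longrightarrow>
      walk_E q (\<lambda>\<omega>. (T k j (coin \<theta> \<omega>) - triple_moment \<theta> j)\<^sup>2) \<le> (1/8) ^ k / (k + 1)"
    unfolding choice_iff triple_moment_def by blast
  \<comment> \<open>Entries beyond \<open>k\<close> are set to 0, so that stage \<open>k\<close>
    depends on finitely many tosses, none later than \<open>h k\<close>.\<close>
  define stats where "stats = (\<lambda>x k j. if j \<le> k then T k j x else 0)"
  define h where "h = (\<lambda>k. \<Sum>j\<le>k. n k j)"
  \<comment> \<open>The largest number of stages computable from \<open>l\<close> tosses;
    \<open>k \<le> l\<close> keeps the set finite.\<close>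
  define stage where "stage = (\<lambda>l. Max {k. k \<le> l \<and> (\<forall>i<k. h i \<le> l)})"
  \<comment> \<open>Toss number \<open>i\<close> sits at list position \<open>i - 1\<close>. The
    default 0 does not influence the result, since the statistics in use depend only on times from 1
    to the length of the list.\<close>
  define est where "est = (\<lambda>xs. estimate (stats (\<lambda>i. if i \<in> {1..length xs} then xs ! (i - 1) else 0)) (stage (length xs)))"
  have fin_stage: "finite {k. k \<le> l \<and> (\<forall>i<k. h i \<le> l)}" for l by simp
  have stage_h: "h i \<le> l" if "i < stage l" for i l
  proof -
    have "stage l \<in> {k. k \<le> l \<and> (\<forall>i<k. h i \<le> l)}"
      unfolding stage_def by (rule Max_in[OF fin_stage]) (auto intro: exI[of _ 0])
    then show ?thesis using that by simp
  qed
  have stage_top: "filterlim stage at_top sequentially"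
    unfolding filterlim_at_top
  proof
    fix k
    show "\<forall>\<^sub>F l in sequentially. k \<le> stage l"
      using eventually_ge_at_top[of "k + (\<Sum>i<k. h i)"]
    proof eventually_elim
      fix l assume l: "k + (\<Sum>i<k. h i) \<le> l"
      have "h i \<le> l" if "i < k" for i
        using member_le_sum[of i "{..<k}" h] that l by simp
      then show "k \<le> stage l" unfolding stage_def using l by (intro Max_ge[OF fin_stage]) auto
    qed
  qed
  have est_eq: "est (map x [1..<Suc l]) = estimate (stats x) (stage l)" for x l
  proof -
    have "estimate (stats (\<lambda>i. if i \<in> {1..l} then map x [1..<Suc l] ! (i - 1) else 0)) (stage l) = estimate (stats x) (stage l)"
    proof (rule estimate_cong, rule ext)
      fix i j assume i: "i < stage l"
      show "stats (\<lambda>i. if i \<in> {1..l} then map x [1..<Suc l] ! (i - 1) else 0) i j = stats x i j"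
      proof (cases "j \<le> i")
        case True
        have "n i j \<le> h i" unfolding h_def using True by (intro member_le_sum) auto
        also have "\<dots> \<le> l" by (rule stage_h[OF i])
        finally have nl: "n i j \<le> l" .
        have "T i j (\<lambda>i. if i \<in> {1..l} then map x [1..<Suc l] ! (i - 1) else 0) = T i j x"
          by (rule T_cong) (use nl in \<open>auto simp: nth_append simp del: upt_Suc\<close>)
        then show ?thesis using True by (simp add: stats_def)
      qed (simp add: stats_def)
    qed
    moreover have "length (map x [1..<Suc l]) = l" by simp
    ultimately show ?thesis by (simp only: est_def)
  qed
  show ?thesis
  proof (intro exI[of _ est] allI impI)
    fix \<theta> :: "int \<Rightarrow> real"
    assume \<theta>: "(\<forall>z. 0 \<le> \<theta> z \<and> \<theta> z \<le> 1) \<and> finite {z. \<theta> z \<noteq> 0}"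
    then have nn: "\<And>z. 0 \<le> \<theta> z" and fin: "finite {z. \<theta> z \<noteq> 0}" by auto
    obtain N where "\<forall>z\<in>{z. \<theta> z \<noteq> 0}. nat \<bar>z\<bar> \<le> N"
      using fin finite_nat_set_iff_bounded_le[of "(\<lambda>z. nat \<bar>z\<bar>) ` {z. \<theta> z \<noteq> 0}"] by auto
    then have N: "bias_on k \<theta>" if "k \<ge> N" for k
      using that \<theta> unfolding bias_on_def by force
    define d where "d = (\<lambda>k j \<omega>. T k j (coin \<theta> \<omega>) - triple_moment \<theta> j)"
    have rvd: "bdd_rv q (d k j)" for k j unfolding d_def by (intro bdd_rv_intros T_rv)
    then have [measurable]: "d k j \<in> borel_measurable (walk_space q)" for k j by (simp add: bdd_rv_def)
    define A where "A = (\<lambda>k. {\<omega> \<in> space (walk_space q). \<exists>j\<le>k. (1/2) ^ k < \<bar>d k j \<omega>\<bar>})"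
    have A_sets [measurable]: "A k \<in> sets (walk_space q)" for k unfolding A_def by measurable
    have A_le: "measure (walk_space q) (A k) \<le> (1/2) ^ k" if k: "k \<ge> N" for k
    proof -
      have "measure (walk_space q) (A k) = walk_E q (indicator (A k))" using A_sets by simp
      \<comment> \<open>Chebyshev in pointwise form: on \<open>A k\<close> some term
        \<open>(d k j \<omega>)\<^sup>2 * 4 ^ k\<close> is at least 1.\<close>
      also have "\<dots> \<le> walk_E q (\<lambda>\<omega>. \<Sum>j\<le>k. (d k j \<omega>)\<^sup>2 * 4 ^ k)"
      proof (rule walk_E_mono)
        show "bdd_rv q (indicator (A k))"
          unfolding bdd_rv_def by (auto intro!: exI[of _ 1] split: split_indicator)
        show "bdd_rv q (\<lambda>\<omega>. \<Sum>j\<le>k. (d k j \<omega>)\<^sup>2 * 4 ^ k)" by (intro bdd_rv_intros rvd)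
        fix \<omega>
        show "indicator (A k) \<omega> \<le> (\<Sum>j\<le>k. (d k j \<omega>)\<^sup>2 * 4 ^ k)"
        proof (cases "\<omega> \<in> A k")
          case True
          then obtain j where j: "j \<le> k" "(1/2) ^ k < \<bar>d k j \<omega>\<bar>" by (auto simp: A_def)
          have "((1/2) ^ k)\<^sup>2 \<le> \<bar>d k j \<omega>\<bar>\<^sup>2" using j(2) by (intro power_mono) auto
          then have "((1/2) ^ k)\<^sup>2 * 4 ^ k \<le> (d k j \<omega>)\<^sup>2 * 4 ^ k" by (intro mult_right_mono) auto
          moreover have "((1/2::real) ^ k)\<^sup>2 * 4 ^ k = 1"
            by (simp add: power_mult[symmetric] mult.commute[of k] power_mult power_mult_distrib[symmetric] power2_eq_square)
          moreover have "(d k j \<omega>)\<^sup>2 * 4 ^ k \<le> (\<Sum>j\<le>k. (d k j \<omega>)\<^sup>2 * 4 ^ k)"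
            using j(1) by (intro member_le_sum) auto
          ultimately show ?thesis using True by simp
        qed (auto intro!: sum_nonneg)
      qed
      also have "\<dots> = (\<Sum>j\<le>k. walk_E q (\<lambda>\<omega>. (d k j \<omega>)\<^sup>2) * 4 ^ k)"
        by (subst walk_E_sum) (auto intro!: bdd_rv_intros rvd)
      also have "\<dots> \<le> (\<Sum>j\<le>k. (1/8) ^ k / (k + 1) * 4 ^ k)"
        unfolding d_def by (intro sum_mono mult_right_mono)
        (use T_L2[OF N[OF k]] in \<open>simp_all add: add.commute\<close>)
      also have "\<dots> = (1/8) ^ k * 4 ^ k" by simp
      also have "\<dots> = (1/2) ^ k" unfolding power_mult_distrib[symmetric] by simp
      finally show ?thesis .
    qed
    have "summable (\<lambda>k. measure (walk_space q) (A k))"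
      by (rule summable_comparison_test_ev[OF _ summable_geometric[of "1/2"]])
         (use A_le in \<open>auto simp: eventually_sequentially\<close>)
    then have "AE \<omega> in walk_space q. \<forall>\<^sub>F k in sequentially. \<omega> \<in> space (walk_space q) - A k"
      by (intro borel_cantelli_AE1 A_sets) (auto simp: W.emeasure_eq_measure)
    then show "AE \<omega> in walk_space q. \<exists>c::int. \<exists>s\<in>{1, -1::int}. \<forall>z::int.
        (\<lambda>n. est (map (coin \<theta> \<omega>) [1..<Suc n]) z) \<longlonglongrightarrow> \<theta> (s * z + c)"
    proof eventually_elim
      fix \<omega> assume "\<forall>\<^sub>F k in sequentially. \<omega> \<in> space (walk_space q) - A k"
      then obtain k0 where k0: "\<And>k. k \<ge> k0 \<Longrightarrow> \<omega> \<in> space (walk_space q) - A k"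
        by (auto simp: eventually_sequentially)
      have fit: "\<bar>stats (coin \<theta> \<omega>) k j - triple_moment \<theta> j\<bar> \<le> (1/2) ^ k" if "k \<ge> k0" "j \<le> k" for k j
        using k0[OF that(1)] that(2) by (auto simp: A_def d_def stats_def not_less)
      \<comment> \<open>The shift by \<open>N\<close> moves the support from -N..N into 0..2N and
        leaves the moments unchanged.\<close>
      have ex: "\<exists>e\<in>box_biases (2 * N). triple_moment e = triple_moment \<theta>"
      proof
        show "(\<lambda>z. \<theta> (z + - int N)) \<in> box_biases (2 * N)"
          using bias_onD(1-3)[OF N[OF order_refl]] unfolding box_biases_def by force
        show "triple_moment (\<lambda>z. \<theta> (z + - int N)) = triple_moment \<theta>"
          unfolding triple_moment_def moment_shift ..
      qed
      obtain D e where e: "e \<in> box_biases D" "triple_moment e = triple_moment \<theta>"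
        "\<And>z. (\<lambda>k. estimate (stats (coin \<theta> \<omega>)) k z) \<longlonglongrightarrow> e z"
        using estimate_tendsto[OF fit ex finite_box_solutions[OF fin nn]] by blast
      have "\<And>z. 0 \<le> e z" using e(1) by (simp add: box_biases_def)
      from triple_moments_determine[OF fin nn box_biases_finite[OF e(1)] this e(2)]
      obtain c s where cs: "s \<in> {1, -1}" "\<And>z. e z = \<theta> (s * z + c)" by blast
      have "(\<lambda>n. est (map (coin \<theta> \<omega>) [1..<Suc n]) z) \<longlonglongrightarrow> \<theta> (s * z + c)" for z
        unfolding est_eq cs(2)[symmetric] by (rule filterlim_compose[OF e(3) stage_top])
      then show "\<exists>c::int. \<exists>s\<in>{1, -1::int}. \<forall>z::int.
          (\<lambda>n. est (map (coin \<theta> \<omega>) [1..<Suc n]) z) \<longlonglongrightarrow> \<theta> (s * z + c)"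
        using cs(1) by blast
    qed
  qed
qed

end
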